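(* Let $G$ be a smooth function, let $m_G$ be defined implicitly by $x=\pi\int_{\sqrt{m_G(x)}}^{+\infty}\eta(it/2)^4G(R(e^{-\pi t}))dt$, with inverse $m_G^{(-1)}$, put $y(x)=R\!\left(e^{-\pi\sqrt{m_G(x)}}\right)$ and $Q_{n^2}(A)=m_G\!\left(n^2 m_G^{(-1)}(A)\right)$. For $n>0$ set $H_n(x)=\Omega_{1/n}\circ F_1\circ b(x)=\Omega_{1/n}\!\left(F_1(b_x)\right)$. Then $$y(n^2x)=H_n\circ\left(n^2\cdot Q_{n^2}\right)\circ\left(n^{-2}H_n^{(-1)}\right)\circ y(x),$$ i.e. $y(n^2x)=H_n\!\left(n^2\,Q_{n^2}\!\left(n^{-2}H_n^{(-1)}(y(x))\right)\right)$.
   Context: $\eta(\tau)=e^{\pi i\tau/12}\prod_{n\ge1}(1-e^{2\pi i n\tau})$ is the Dedekind eta function; $R(q)=\cfrac{q^{1/5}}{1+\cfrac{q}{1+\cfrac{q^2}{1+\cdots}}}$ ($0<q<1$) is the Rogers–Ramanujan continued fraction. For $s>0$, $\Omega_s$ is defined by $\Omega_s(R(e^{-\pi\sqrt r}))=R(e^{-\pi s\sqrt r})$ for $r>0$. For $r>0$, $k_r\in(0,1)$ is the elliptic singular modulus ($K(\sqrt{1-k_r^2})/K(k_r)=\sqrt r$, $K(k)=\int_0^{\pi/2}(1-k^2\sin^2\theta)^{-1/2}d\theta$), and $b_r=3\sqrt[3]{2k_r}\cdot{}_2F_1\!\left[\frac16,\frac13;\frac76;k_r^2\right]$. $F_1$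 is defined by $x=5\int_0^{F_1(x)}\frac{dt}{t\sqrt[6]{t^{-5}-11-t^5}}$. $H_n^{(-1)}$ is the inverse of $H_n$. *)

theory Defs
  imports "HOL-Analysis.Analysis"
begin

definition eta :: "complex \<Rightarrow> complex" where
  "eta \<tau> = exp (pi * \<i> * \<tau> / 12) *
      prodinf (\<lambda>n. 1 - exp (2 * pi * \<i> * of_nat (Suc n) * \<tau>))"

text \<open>Convergents of the Rogers--Ramanujan continued fraction:
  rr_conv q N k = 1 + q^(k+1)/(1 + q^(k+2)/(1 + ... )) truncated after N levels.\<close>
fun rr_conv :: "real \<Rightarrow> nat \<Rightarrow> nat \<Rightarrow> real" where
  "rr_conv q 0 k = 1"
| "rr_conv q (Suc N) k = 1 + q ^ (Suc k) / rr_conv q N (Suc k)"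

definition RR :: "real \<Rightarrow> real" where
  "RR q = q powr (1/5) / lim (\<lambda>N. rr_conv q N 0)"

definition Omega :: "real \<Rightarrow> real \<Rightarrow> real" where
  "Omega s w = RR (exp (- pi * s * sqrt (THE r. 0 < r \<and> RR (exp (- pi * sqrt r)) = w)))"

definition ellK :: "real \<Rightarrow> real" where
  "ellK k = integral {0..pi/2} (\<lambda>\<theta>. 1 / sqrt (1 - k\<^sup>2 * (sin \<theta>)\<^sup>2))"

definition sing_mod :: "real \<Rightarrow> real" where
  "sing_mod r = (THE k. 0 < k \<and> k < 1 \<and> ellK (sqrt (1 - k\<^sup>2)) / ellK k = sqrt r)"

definition hyp2f1 :: "real \<Rightarrow> real \<Rightarrow> real \<Rightarrow> real \<Rightarrow> real" where
  "hyp2f1 a b c z = (\<Sum>n. pochhammer a n * pochhammer b n / (pochhammer c n * fact n) * z ^ n)"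

definition bmod :: "real \<Rightarrow> real" where
  "bmod r = 3 * (2 * sing_mod r) powr (1/3) * hyp2f1 (1/6) (1/3) (7/6) ((sing_mod r)\<^sup>2)"

definition F1 :: "real \<Rightarrow> real" where
  "F1 x = (THE y. 0 < y \<and> 1 / y ^ 5 - 11 - y ^ 5 > 0 \<and>
      x = 5 * integral {0..y} (\<lambda>t. 1 / (t * (1 / t ^ 5 - 11 - t ^ 5) powr (1/6))))"

definition H :: "real \<Rightarrow> real \<Rightarrow> real" where
  "H n x = Omega (1 / n) (F1 (bmod x))"

definition Hinv :: "real \<Rightarrow> real \<Rightarrow> real" where
  "Hinv n w = (THE x. 0 < x \<and> H n x = w)"

definition smooth :: "(real \<Rightarrow> real) \<Rightarrow> bool" where
  "smooth G \<longleftrightarrow> (\<forall>k x. ((deriv ^^ k) G) differentiable (at x))"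

definition mG_eq :: "(real \<Rightarrow> real) \<Rightarrow> real \<Rightarrow> real \<Rightarrow> bool" where
  "mG_eq G x m \<longleftrightarrow>
     ((\<lambda>t. eta (\<i> * complex_of_real t / 2) ^ 4 * complex_of_real (G (RR (exp (- pi * t)))))
        has_integral complex_of_real (x / pi)) {sqrt m..}"

definition mG_dom :: "(real \<Rightarrow> real) \<Rightarrow> real set" where
  "mG_dom G = {x. \<exists>!m. 0 < m \<and> mG_eq G x m}"

definition mG :: "(real \<Rightarrow> real) \<Rightarrow> real \<Rightarrow> real" where
  "mG G x = (THE m. 0 < m \<and> mG_eq G x m)"

definition mGinv :: "(real \<Rightarrow> real) \<Rightarrow> real \<Rightarrow> real" where
  "mGinv G A = (THE x. x \<in> mG_dom G \<and> mG G x = A)"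

definition ycf :: "(real \<Rightarrow> real) \<Rightarrow> real \<Rightarrow> real" where
  "ycf G x = RR (exp (- pi * sqrt (mG G x)))"

definition Q :: "(real \<Rightarrow> real) \<Rightarrow> real \<Rightarrow> real \<Rightarrow> real" where
  "Q G N A = mG G (N * mGinv G A)"

end

theory Submission
  imports Defs "HOL-Real_Asymp.Real_Asymp"
begin

text \<open>
  The function \<open>G\<close> plays no role beyond making \<open>m_G\<close> injective: everything rests on the identity
  \<open>F1 (b_r) = R (exp (-pi sqrt r))\<close> and on the injectivity of \<open>R\<close> on the unit interval, from which
  \<open>H n x = R (exp (-pi sqrt x / n))\<close>.

  Write \<open>f(q)\<close> for Euler's product. Both sides of the identity are matched by showing that, as functions
  of \<open>q\<close>, \<open>b\<close> and five times the integral up to \<open>R q\<close> vanish at 0 and have the same derivative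
  \<open>q^(-5/6) f(q)^4\<close>.

  On the continued fraction side \<open>R q = q^(1/5) B / A\<close>, where \<open>A\<close> and \<open>B\<close> are the bilateral theta series with
  exponents \<open>k(5k+1)/2\<close> and \<open>k(5k+3)/2\<close> (Rogers). The derivative then follows from
  \<open>A B (A^10 - 11 q A^5 B^5 - q^2 B^10) = f^12\<close> and \<open>A B + 5 q (A B' - A' B) = f^6\<close>. The first relation comes from the
  triple product at fifth roots of unity, which factors \<open>A^10 - 11 q A^5 B^5 - q^2 B^10\<close> into ten linear forms; the second from
  Jacobi's formula for \<open>f^3\<close> by factoring \<open>1 + 2i\<close> out of a Gaussian integer.

  On the elliptic side the modulus \<open>x = k^2\<close> is \<open>theta_2^4 / theta_3^4\<close> at the nome \<open>q\<close>. Both \<open>K'/K = - ln q / pi\<close> and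
  \<open>q x' = x theta_4^4\<close> are invariant under \<open>q -> q^2\<close> (Landen's transformation, duplication formulas)
  and are therefore determined by their behaviour as \<open>q -> 0\<close>.
\<close>

no_notation Infinite_Set_Sum.abs_summable_on (infix "abs'_summable'_on" 50)

section \<open>The Jacobi triple product\<close>

text \<open>The sixth root in \<open>F1\<close> is what lets the two derivatives meet. With
  \<open>1 / R^5 - 11 - R^5 = f^12 / (q (A B)^6)\<close> and
  \<open>q R' / R = f^6 / (5 A B)\<close>, the factor \<open>A B\<close> cancels in
  \<open>R' / (R (1 / R^5 - 11 - R^5)^(1/6))\<close> and a fifth of \<open>q^(-5/6) f^4\<close> is
  left. On the other side the parameters 1/6, 1/3, 7/6 make \<open>b\<close> an integral of
  \<open>x^(-5/6) (1 - x)^(-1/3)\<close>, and \<open>x' = x theta_4^4 / q\<close> turns its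
  derivative into a monomial in theta constants, which collapses by
  \<open>theta_2 theta_3 theta_4 = 2 eta^3\<close>. Apart from an excursion to fifth roots of unity
  the argument stays on the real interval \<open>0 < q < 1\<close>. In place of modular
  transformations there is one principle: a function fixed by \<open>q -> q^2\<close> equals its
  limit at 0. The other obstacle is that \<open>Omega\<close>, \<open>F1\<close>,
  \<open>sing_mod\<close>, \<open>Hinv\<close> and \<open>mGinv\<close> are definite descriptions.
  Each needs existence and uniqueness, which is why monotonicity of \<open>R\<close>,
  \<open>b\<close> and \<open>K'/K\<close> is proved along with their values.\<close>

definition qpoch :: "'a::{real_normed_field,banach} \<Rightarrow> 'a \<Rightarrow> 'a" where
  "qpoch a q = (\<Prod>n. 1 - a * q ^ n)"

definition qfac :: "'a::{real_normed_field,banach} \<Rightarrow> nat \<Rightarrow> 'a" where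
  "qfac q n = (\<Prod>i<n. 1 - q * q ^ i)"

lemma convergent_prod_qpoch:
  fixes q a :: "'a::{real_normed_field,banach}"
  assumes "norm q < 1"
  shows "convergent_prod (\<lambda>n. 1 - a * q ^ n)"
proof (intro abs_convergent_prod_imp_convergent_prod summable_imp_abs_convergent_prod)
  have "summable (\<lambda>n. norm a * norm q ^ n)"
    using assms by (intro summable_mult summable_geometric) auto
  thus "summable (\<lambda>i. norm (1 - a * q ^ i - 1))" by (simp add: norm_mult norm_power)
qed

lemma qpoch_LIMSEQ:
  fixes q a :: "'a::{real_normed_field,banach}"
  assumes "norm q < 1"
  shows "(\<lambda>N. \<Prod>k<N. 1 - a * q ^ k) \<longlonglongrightarrow> qpoch a q"
  using convergent_prod_LIMSEQ[OF convergent_prod_qpoch[OF assms, of a]]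
  unfolding qpoch_def by (subst (asm) LIMSEQ_lessThan_iff_atMost[symmetric]) simp_all

lemma qpoch_nonzero:
  fixes q a :: "'a::{real_normed_field,banach}"
  assumes "norm q < 1" "\<And>k. a * q ^ k \<noteq> 1"
  shows "qpoch a q \<noteq> 0"
  unfolding qpoch_def
  by (rule prodinf_nonzero[OF convergent_prod_qpoch[OF assms(1)]])
     (use assms(2) in \<open>metis right_minus_eq\<close>)

lemma norm_mult_power_less_1:
  fixes q :: "'a::real_normed_field"
  assumes "norm q < 1" shows "norm (q * q ^ k) < 1"
  using assms by (metis norm_ge_zero norm_power power_Suc power_Suc_less_one power_less_one_iff
      zero_less_Suc power_0_left norm_zero le_less power_Suc2 less_numeral_extra(1) nat.simps(3))

lemma mult_power_neq_1:
  fixes q :: "'a::real_normed_field"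
  assumes "norm q < 1" shows "q * q ^ k \<noteq> 1"
  using norm_mult_power_less_1[OF assms, of k] by (metis norm_one less_irrefl)

lemma qfac_nonzero:
  fixes q :: "'a::{real_normed_field,banach}"
  assumes "norm q < 1" shows "qfac q n \<noteq> 0"
  using mult_power_neq_1[OF assms] by (simp add: qfac_def)

lemma qfac_0 [simp]: "qfac q 0 = 1"
  and qfac_Suc: "qfac q (Suc n) = qfac q n * (1 - q ^ Suc n)"
  by (simp_all add: qfac_def)

lemma qfac_LIMSEQ:
  fixes q :: "'a::{real_normed_field,banach}"
  assumes "norm q < 1" shows "qfac q \<longlonglongrightarrow> qpoch q q"
  using qpoch_LIMSEQ[OF assms, of q] by (simp add: qfac_def[abs_def])

lemma qpoch_self_nonzero:
  fixes q :: "'a::{real_normed_field,banach}"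
  assumes "norm q < 1" shows "qpoch q q \<noteq> 0"
  using assms mult_power_neq_1[OF assms] by (intro qpoch_nonzero)

text \<open>Gaussian binomial coefficients, given by a Pascal rule so that they exist in every
  commutative ring without division; \<open>qbinom_qfac\<close> is the quotient form.\<close>

fun qbinom :: "'a::comm_ring_1 \<Rightarrow> nat \<Rightarrow> nat \<Rightarrow> 'a" where
  "qbinom q n 0 = 1"
| "qbinom q 0 (Suc k) = 0"
| "qbinom q (Suc n) (Suc k) = qbinom q n k + q ^ Suc k * qbinom q n (Suc k)"

lemma qbinom_eq_0: "n < k \<Longrightarrow> qbinom q n k = 0"
  by (induction q n k rule: qbinom.induct) auto

text \<open>The indices \<open>k\<close> and \<open>m\<close> stand for \<open>n - m\<close> and
  \<open>n - k\<close>, and all denominators are multiplied out. Induction on \<open>k + m\<close>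
  reaches both Pascal neighbours, \<open>(k - 1, m)\<close> and \<open>(k, m - 1)\<close>.\<close>

lemma qbinom_qfac:
  fixes q :: "'a::{real_normed_field,banach}"
  shows "qbinom q (k + m) k * qfac q k * qfac q m = qfac q (k + m)"
proof (induction "k + m" arbitrary: k m)
  case 0
  thus ?case by simp
next
  case (Suc n)
  show ?case
  proof (cases k)
    case 0
    thus ?thesis by simp
  next
    case k: (Suc k')
    have n: "n = k' + m" using Suc(2) k by simp
    have IH1: "qbinom q n k' * qfac q k' * qfac q m = qfac q n"
      using Suc(1)[of k' m] n by simp
    \<comment> \<open>The factor \<open>1 - q ^ m\<close> also covers \<open>m = 0\<close>, where it
      vanishes together with \<open>qbinom q n k\<close>.\<close>
    have IH2: "qbinom q n k * qfac q k * qfac q m = qfac q n * (1 - q ^ m)"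
    proof (cases m)
      case 0
      thus ?thesis using n k by (simp add: qbinom_eq_0)
    next
      case (Suc m')
      have "qbinom q n k * qfac q k * qfac q m' = qfac q n"
        using Suc.hyps(1)[of k m'] n k Suc by simp
      thus ?thesis by (simp add: Suc qfac_Suc mult.assoc[symmetric])
    qed
    have "qbinom q (k + m) k * qfac q k * qfac q m
        = (qbinom q n k' * qfac q k' * qfac q m) * (1 - q ^ k)
          + q ^ k * (qbinom q n k * qfac q k * qfac q m)"
      using n by (simp add: k qfac_Suc algebra_simps)
    also have "\<dots> = qfac q n * (1 - q ^ (k + m))"
      unfolding IH1 IH2 by (simp add: algebra_simps power_add)
    also have "\<dots> = qfac q (k + m)"
      using n k by (simp add: qfac_Suc)
    finally show ?thesis .
  qed
qed

text \<open>The argument is an integer because the theta sums are bilateral; the value is natural so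
  that \<open>q ^ tri j\<close> makes sense for every \<open>q\<close>.\<close>

definition tri :: "int \<Rightarrow> nat" where "tri j = nat (j * (j - 1) div 2)"

lemma int_tri: "int (tri j) = j * (j - 1) div 2"
proof -
  have "j * (j - 1) \<ge> 0"
    by (cases "j \<le> 0") (auto simp: zero_le_mult_iff)
  thus ?thesis by (simp add: tri_def)
qed

lemma two_tri: "2 * int (tri j) = j * (j - 1)"
  unfolding int_tri by simp

lemma triI: "2 * int e = j * (j - 1) \<Longrightarrow> tri j = e"
  using two_tri[of j] by linarith

lemma int_tri_add: "int (tri (j + 1)) = int (tri j) + j"
  using two_tri[of j] two_tri[of "j+1"] by (simp add: algebra_simps)

lemma tri_Suc: "tri (int (Suc k)) = tri (int k) + k"
  using int_tri_add[of "int k"] by (simp add: add.commute)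

lemma tri_0 [simp]: "tri 0 = 0" and tri_1 [simp]: "tri 1 = 0" by (simp_all add: tri_def)

text \<open>Peeling off the factor with \<open>k = 0\<close> leaves the same product at
  \<open>x * q\<close>, which is why \<open>x\<close> varies in the induction.\<close>

lemma qbinomial_theorem:
  fixes x q :: "'a::comm_ring_1"
  shows "(\<Prod>k<n. 1 + x * q ^ k) = (\<Sum>k\<le>n. qbinom q n k * q ^ tri (int k) * x ^ k)"
proof (induction n arbitrary: x)
  case 0
  show ?case by simp
next
  case (Suc n)
  let ?g = "\<lambda>k. qbinom q n k * q ^ tri (int k) * (x * q) ^ k"
  have "(\<Prod>k<Suc n. 1 + x * q ^ k) = (1 + x) * (\<Prod>k<n. 1 + (x * q) * q ^ k)"
    by (simp add: prod.lessThan_Suc_shift mult_ac del: prod.lessThan_Suc)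
  also have "\<dots> = (\<Sum>k\<le>n. ?g k) + x * (\<Sum>k\<le>n. ?g k)"
    unfolding Suc.IH by (simp only: distrib_right mult_1_left)
  also have "\<dots> = 1 + (\<Sum>k\<le>n. ?g (Suc k) + x * ?g k)"
  proof -
    have "(\<Sum>k\<le>n. ?g k) = (\<Sum>k\<le>Suc n. ?g k)"
      by (simp add: qbinom_eq_0)
    hence 1: "(\<Sum>k\<le>n. ?g k) = 1 + (\<Sum>k\<le>n. ?g (Suc k))"
      unfolding sum.atMost_Suc_shift[of _ n] by (simp del: of_nat_Suc power_Suc)
    have "(\<Sum>k\<le>n. ?g k) + x * (\<Sum>k\<le>n. ?g k) = (1 + (\<Sum>k\<le>n. ?g (Suc k))) + (\<Sum>k\<le>n. x * ?g k)"
      unfolding sum_distrib_left[symmetric] by (subst 1) (rule refl)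
    thus ?thesis by (simp only: sum.distrib add.assoc)
  qed
  also have "(\<Sum>k\<le>n. ?g (Suc k) + x * ?g k)
      = (\<Sum>k\<le>n. qbinom q (Suc n) (Suc k) * q ^ tri (int (Suc k)) * x ^ Suc k)"
  proof (rule sum.cong[OF refl])
    fix k
    have gen: "G1 * q ^ (t + k) * (x * q) ^ Suc k + x * (G0 * q ^ t * (x * q) ^ k)
       = (G0 + q ^ Suc k * G1) * q ^ (t + k) * x ^ Suc k" for G0 G1 t
      by (simp only: power_add power_mult_distrib power_Suc distrib_left distrib_right mult_ac add_ac)
    show "?g (Suc k) + x * ?g k = qbinom q (Suc n) (Suc k) * q ^ tri (int (Suc k)) * x ^ Suc k"
      unfolding tri_Suc qbinom.simps by (rule gen)
  qed
  also have "1 + (\<Sum>k\<le>n. qbinom q (Suc n) (Suc k) * q ^ tri (int (Suc k)) * x ^ Suc k)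
      = (\<Sum>k\<le>Suc n. qbinom q (Suc n) k * q ^ tri (int k) * x ^ k)"
    unfolding sum.atMost_Suc_shift[of _ n] by (simp del: qbinom.simps(3) of_nat_Suc power_Suc)
  finally show ?case .
qed

lemma power_tri_shift:
  fixes q :: "'a::field"
  assumes "q \<noteq> 0"
  shows "q ^ tri (j + 1) = q ^ tri j * q powi j"
proof -
  have "q ^ tri (j + 1) = q powi (int (tri j) + j)"
    by (metis int_tri_add power_int_of_nat)
  thus ?thesis using assms by (simp add: power_int_add)
qed

text \<open>Replacing \<open>z\<close> by \<open>z / q\<close> moves one factor from the second
  product to the first at the price of \<open>- (q / z)\<close>. Hence \<open>M\<close> and
  \<open>N\<close> are independent, \<open>M\<close> and \<open>z\<close> vary in the induction, and
  the case \<open>N = 0\<close> is the q-binomial theorem.\<close>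

lemma finite_jacobi_triple:
  fixes z q :: "'a::{real_normed_field,banach}"
  assumes "q \<noteq> 0" "z \<noteq> 0"
  shows "(\<Prod>k<M. 1 - z * q ^ k) * (\<Prod>k<N. 1 - q ^ Suc k / z)
       = (\<Sum>j\<in>{-int N..int M}. (-1) powi j * z powi j * q ^ tri j * qbinom q (M + N) (nat (int N + j)))"
  using assms
proof (induction N arbitrary: M z)
  case 0
  have "(\<Prod>k<M. 1 - z * q ^ k) = (\<Sum>k\<le>M. qbinom q M k * q ^ tri (int k) * (-z) ^ k)"
    using qbinomial_theorem[of "-z" q M] by simp
  also have "\<dots> = (\<Sum>j\<in>int ` {..M}. (-1) powi j * z powi j * q ^ tri j * qbinom q M (nat j))"
    by (subst sum.reindex) (auto simp: power_minus[of z] mult_ac intro!: sum.cong)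
  also have "int ` {..M} = {0..int M}"
    by (simp add: atMost_atLeast0 image_int_atLeastAtMost)
  finally show ?case by simp
next
  case (Suc N)
  let ?h = "\<lambda>z M N j. (-1) powi j * z powi j * q ^ tri j * qbinom q (M + N) (nat (int N + j))"
  have eq: "(\<Prod>k<M. 1 - z * q ^ k) * (\<Prod>k<Suc N. 1 - q ^ Suc k / z)
     = - (q / z) * ((\<Prod>k<Suc M. 1 - (z/q) * q ^ k) * (\<Prod>k<N. 1 - q ^ Suc k / (z/q)))"
  proof -
    have A: "(\<Prod>k<Suc M. 1 - (z/q) * q ^ k) = (1 - z / q) * (\<Prod>k<M. 1 - z * q ^ k)"
    proof -
      have "(z/q) * q ^ Suc k = z * q ^ k" for k using Suc.prems by simp
      thus ?thesis by (subst prod.lessThan_Suc_shift) simp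
    qed
    have B: "(\<Prod>k<Suc N. 1 - q ^ Suc k / z) = (1 - q / z) * (\<Prod>k<N. 1 - q ^ Suc k / (z/q))"
    proof -
      have eq: "q ^ Suc (Suc k) / z = q ^ Suc k / (z/q)" for k using Suc.prems by simp
      show ?thesis unfolding prod.lessThan_Suc_shift[of _ N] eq by simp
    qed
    have C: "-(q/z) * (1 - z/q) = 1 - q/z" using Suc.prems by (simp add: field_simps)
    show ?thesis unfolding A B C[symmetric] by (simp add: mult_ac)
  qed
  have "(\<Prod>k<Suc M. 1 - (z/q) * q ^ k) * (\<Prod>k<N. 1 - q ^ Suc k / (z/q)) = (\<Sum>j\<in>{-int N..int (Suc M)}. ?h (z/q) (Suc M) N j)"
    by (rule Suc.IH) (use Suc.prems in auto)
  also have "- (q / z) * \<dots> = (\<Sum>j\<in>{-int N..int (Suc M)}. - (q / z) * ?h (z/q) (Suc M) N j)"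
    by (simp add: sum_distrib_left)
  also have "\<dots> = (\<Sum>i\<in>{-int (Suc N)..int M}. ?h z M (Suc N) i)"
  proof (rule sum.reindex_bij_witness[of _ "\<lambda>i. i + 1" "\<lambda>j. j - 1"], goal_cases)
    case (5 j)
    define i where "i = j - 1"
    have j: "j = i + 1" by (simp add: i_def)
    have "nat (int N + j) = nat (int (Suc N) + i)" by (simp add: j)
    moreover have "- (q / z) * ((-1) powi j * (z/q) powi j * q ^ tri j) = (-1) powi i * z powi i * q ^ tri i"
      unfolding j power_tri_shift[OF Suc.prems(1)]
      using Suc.prems by (simp add: power_int_add power_int_divide_distrib)
    ultimately show ?case unfolding i_def[symmetric] by (simp add: mult.assoc[symmetric])
  qed auto
  finally show ?case using eq by simp
qed

section \<open>Passage to the limit in bilateral sums\<close>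

lemma summable_on_int_split:
  fixes f :: "int \<Rightarrow> 'a::banach"
  assumes "summable (\<lambda>n. norm (f (int n)))" "summable (\<lambda>n. norm (f (- int n)))"
  shows "f abs_summable_on UNIV"
proof -
  have 1: "f abs_summable_on range int"
    using assms(1) by (subst summable_on_reindex) (auto simp: o_def norm_summable_imp_summable_on)
  have 2: "f abs_summable_on range (\<lambda>n. - int n)"
    using assms(2) by (subst summable_on_reindex) (auto simp: o_def inj_def norm_summable_imp_summable_on)
  have "x \<in> range int \<union> range (\<lambda>n. - int n)" for x
    by (cases x rule: int_cases2) auto
  hence "(UNIV :: int set) = range int \<union> range (\<lambda>n. - int n)" by blast
  thus ?thesis using summable_on_union[OF 1 2] by metis
qed

lemma summable_power_tri:
  fixes w r :: real
  assumes "w \<ge> 0" "0 \<le> r" "r < 1"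
  shows "summable (\<lambda>n. w ^ n * r ^ tri (int n))"
proof -
  have "(\<lambda>n. w * r ^ n) \<longlonglongrightarrow> w * 0"
    using assms by (intro tendsto_intros LIMSEQ_power_zero) auto
  hence "eventually (\<lambda>n. w * r ^ n < 1/2) sequentially"
    by (rule order_tendstoD(2)) simp
  then obtain N where N: "\<And>n. n \<ge> N \<Longrightarrow> w * r ^ n < 1/2"
    unfolding eventually_sequentially by blast
  show ?thesis
  proof (rule summable_ratio_test[of "1/2" N])
    fix n assume "n \<ge> N"
    have "w ^ Suc n * r ^ tri (int (Suc n)) = (w * r ^ n) * (w ^ n * r ^ tri (int n))"
      by (simp only: tri_Suc power_add) (simp add: mult_ac)
    also have "\<dots> \<le> 1/2 * (w ^ n * r ^ tri (int n))"
      using N[OF \<open>n \<ge> N\<close>] assms by (intro mult_right_mono) auto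
    finally show "norm (w ^ Suc n * r ^ tri (int (Suc n))) \<le> 1/2 * norm (w ^ n * r ^ tri (int n))"
      using assms by simp
  qed simp
qed

lemma abs_summable_theta:
  fixes z q :: "'a::{real_normed_field,banach}"
  assumes "norm q < 1"
  shows "(\<lambda>j. z powi j * q ^ tri j) abs_summable_on (UNIV::int set)"
proof (rule summable_on_int_split)
  show "summable (\<lambda>n. norm (z powi int n * q ^ tri (int n)))"
    using summable_power_tri[of "norm z" "norm q"] assms by (simp add: norm_mult norm_power)
next
  have "tri (- int n) = tri (int n) + n" for n
    by (rule triI) (use two_tri[of "int n"] in \<open>simp add: algebra_simps\<close>)
  hence "norm (z powi (- int n) * q ^ tri (- int n)) = (inverse (norm z) * norm q) ^ n * norm q ^ tri (int n)" for n
    by (simp add: norm_mult norm_power power_int_minus power_add norm_inverse power_mult_distrib power_inverse mult_ac)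
  thus "summable (\<lambda>n. norm (z powi (- int n) * q ^ tri (- int n)))"
    using summable_power_tri[of "inverse (norm z) * norm q" "norm q"] assms by simp
qed

text \<open>Tannery's theorem and termwise differentiation act on series over \<open>nat\<close>; an
  enumeration of the integers carries absolutely convergent unordered sums over to them.\<close>

lemma suminf_int_decode:
  fixes f :: "int \<Rightarrow> 'a::banach"
  assumes "f abs_summable_on UNIV"
  shows "(\<lambda>n. f (int_decode n)) sums infsum f UNIV" "summable (\<lambda>n. norm (f (int_decode n)))"
proof -
  have "f summable_on UNIV" using assms by (rule abs_summable_summable)
  hence "(f has_sum infsum f UNIV) UNIV" by (rule has_sum_infsum)
  hence "((\<lambda>n. f (int_decode n)) has_sum infsum f UNIV) UNIV"
    by (subst has_sum_reindex_bij_betw[OF bij_int_decode])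
  thus "(\<lambda>n. f (int_decode n)) sums infsum f UNIV" by (rule has_sum_imp_sums)
  have "(\<lambda>n. norm (f (int_decode n))) summable_on UNIV"
    using assms by (subst summable_on_reindex_bij_betw[OF bij_int_decode, of "\<lambda>x. norm (f x)"])
  thus "summable (\<lambda>n. norm (f (int_decode n)))" by (rule summable_on_imp_summable)
qed

text \<open>Both \<open>qfac q\<close> and its inverse converge, hence are bounded. Uniformity in
  the two indices is what the domination in Tannery's theorem asks for.\<close>

lemma qbinom_bounded:
  fixes q :: "'a::{real_normed_field,banach}"
  assumes "norm q < 1"
  obtains B where "\<And>n k. norm (qbinom q n k) \<le> B" "B > 0"
proof -
  have 1: "qfac q \<longlonglongrightarrow> qpoch q q" by (rule qfac_LIMSEQ[OF assms])
  have 2: "(\<lambda>n. inverse (qfac q n)) \<longlonglongrightarrow> inverse (qpoch q q)"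
    by (intro tendsto_inverse 1 qpoch_self_nonzero assms)
  obtain A where A: "A > 0" "\<And>n. norm (qfac q n) \<le> A"
    using convergent_imp_Bseq[OF convergentI[OF 1]] unfolding Bseq_def by blast
  obtain C where C: "C > 0" "\<And>n. norm (inverse (qfac q n)) \<le> C"
    using convergent_imp_Bseq[OF convergentI[OF 2]] unfolding Bseq_def by blast
  have "norm (qbinom q n k) \<le> A * C * C" for n k
  proof (cases "k \<le> n")
    case True
    define m where "m = n - k"
    have n: "n = k + m" using True m_def by simp
    have "qbinom q n k = qfac q n * inverse (qfac q k) * inverse (qfac q m)"
      using qbinom_qfac[of q k m] qfac_nonzero[OF assms, of k] qfac_nonzero[OF assms, of m] n
      by (simp add: field_simps)
    thus ?thesis using A C by (auto simp: norm_mult intro!: mult_mono)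
  next
    case False
    thus ?thesis using A C by (simp add: qbinom_eq_0)
  qed
  thus ?thesis using A C by (intro that[of "A * C * C"]) auto
qed

text \<open>Both complementary indices \<open>N + j\<close> and \<open>N + 1 - j\<close> tend to
  infinity, so all three \<open>qfac\<close> of the quotient form have the same limit and one
  inverse survives.\<close>

lemma qbinom_LIMSEQ:
  fixes q :: "'a::{real_normed_field,banach}"
  assumes "norm q < 1"
  shows "(\<lambda>N. qbinom q (2 * N + 1) (nat (int N + j))) \<longlonglongrightarrow> inverse (qpoch q q)"
proof -
  note 1 = qfac_LIMSEQ[OF assms] and nz = qpoch_self_nonzero[OF assms]
  have a: "filterlim (\<lambda>N. nat (int N + j)) at_top sequentially"
    and b: "filterlim (\<lambda>N. nat (int N + 1 - j)) at_top sequentially"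
    and c: "filterlim (\<lambda>N::nat. 2 * N + 1) at_top sequentially"
  proof -
    show "filterlim (\<lambda>N. nat (int N + j)) at_top sequentially"
      unfolding filterlim_at_top eventually_sequentially
    proof
      fix Z show "\<exists>N. \<forall>n\<ge>N. Z \<le> nat (int n + j)" by (rule exI[of _ "nat (int Z - j)"]) auto
    qed
    show "filterlim (\<lambda>N. nat (int N + 1 - j)) at_top sequentially"
      unfolding filterlim_at_top eventually_sequentially
    proof
      fix Z show "\<exists>N. \<forall>n\<ge>N. Z \<le> nat (int n + 1 - j)" by (rule exI[of _ "nat (int Z + j)"]) auto
    qed
    show "filterlim (\<lambda>N::nat. 2 * N + 1) at_top sequentially"
      unfolding filterlim_at_top eventually_sequentially
    proof
      fix Z :: nat show "\<exists>N. \<forall>n\<ge>N. Z \<le> 2 * n + 1" by (rule exI[of _ Z]) auto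
    qed
  qed
  have "(\<lambda>N. qfac q (2 * N + 1) * inverse (qfac q (nat (int N + j))) * inverse (qfac q (nat (int N + 1 - j))))
     \<longlonglongrightarrow> qpoch q q * inverse (qpoch q q) * inverse (qpoch q q)"
    by (intro tendsto_intros filterlim_compose[OF 1] a b c nz)
  moreover have "eventually (\<lambda>N. qfac q (2 * N + 1) * inverse (qfac q (nat (int N + j))) * inverse (qfac q (nat (int N + 1 - j)))
      = qbinom q (2 * N + 1) (nat (int N + j))) sequentially"
    using eventually_ge_at_top[of "nat \<bar>j\<bar>"]
  proof eventually_elim
    case (elim N)
    define k m where "k = nat (int N + j)" and "m = nat (int N + 1 - j)"
    have "2 * N + 1 = k + m" using elim unfolding k_def m_def by linarith
    thus ?case unfolding k_def[symmetric] m_def[symmetric]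
      using qbinom_qfac[of q k m] qfac_nonzero[OF assms, of k] qfac_nonzero[OF assms, of m]
      by (simp add: field_simps)
  qed
  ultimately show ?thesis using nz by (simp add: Lim_transform_eventually)
qed

text \<open>Shared by the triple product and by its derivative at \<open>z = 1\<close>, which differ
  only in the coefficient \<open>f\<close>. The range from \<open>-N\<close> to \<open>N + 1\<close>
  comes from \<open>N + 1\<close> factors of one kind and \<open>N\<close> of the other.\<close>

lemma qbinom_sum_LIMSEQ:
  fixes q :: "'a::{real_normed_field,banach}" and f :: "int \<Rightarrow> 'a"
  assumes q: "norm q < 1" and f: "f abs_summable_on UNIV"
  shows "(\<lambda>N. \<Sum>j\<in>{-int N..int (N+1)}. f j * qbinom q (2 * N + 1) (nat (int N + j)))
          \<longlonglongrightarrow> infsum f UNIV / qpoch q q"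
proof -
  obtain B where B: "\<And>n k. norm (qbinom q n k) \<le> B" "B > 0" using qbinom_bounded[OF q] by blast
  let ?g = "\<lambda>N j. if j \<in> {-int N..int (N+1)} then f j * qbinom q (2 * N + 1) (nat (int N + j)) else 0"
  have lim: "(\<lambda>N. ?g N j) \<longlonglongrightarrow> f j * inverse (qpoch q q)" for j
  proof -
    have "(\<lambda>N. f j * qbinom q (2 * N + 1) (nat (int N + j))) \<longlonglongrightarrow> f j * inverse (qpoch q q)"
      by (intro tendsto_intros qbinom_LIMSEQ q)
    moreover have "eventually (\<lambda>N. f j * qbinom q (2 * N + 1) (nat (int N + j)) = ?g N j) sequentially"
      using eventually_ge_at_top[of "nat \<bar>j\<bar>"] by eventually_elim auto
    ultimately show ?thesis by (rule Lim_transform_eventually)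
  qed
  have bd: "\<forall>\<^sub>F (k, N) in sequentially \<times>\<^sub>F sequentially. norm (?g N (int_decode k)) \<le> norm (f (int_decode k)) * B"
  proof -
    have "\<forall>k N. norm (?g N (int_decode k)) \<le> norm (f (int_decode k)) * B"
      using B by (auto simp: norm_mult intro!: mult_left_mono)
    thus ?thesis by (intro always_eventually) auto
  qed
  have sm: "summable (\<lambda>k. norm (f (int_decode k)) * B)"
    by (intro summable_mult2 suminf_int_decode(2) f)
  have T: "(\<lambda>N. \<Sum>k. ?g N (int_decode k)) \<longlonglongrightarrow> (\<Sum>k. f (int_decode k) * inverse (qpoch q q))"
    using tannerys_theorem[OF lim bd sm] by simp
  have "(\<lambda>k. f (int_decode k) * inverse (qpoch q q)) sums (infsum f UNIV * inverse (qpoch q q))"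
    by (intro sums_mult2 suminf_int_decode(1) f)
  hence R: "(\<Sum>k. f (int_decode k) * inverse (qpoch q q)) = infsum f UNIV / qpoch q q"
    by (simp add: sums_iff divide_inverse)
  have L: "(\<Sum>k. ?g N (int_decode k)) = (\<Sum>j\<in>{-int N..int (N+1)}. f j * qbinom q (2 * N + 1) (nat (int N + j)))" for N
  proof -
    have "(\<Sum>k. ?g N (int_decode k)) = (\<Sum>k\<in>int_encode ` {-int N..int (N+1)}. ?g N (int_decode k))"
    proof (rule suminf_finite)
      fix k assume "k \<notin> int_encode ` {- int N..int (N + 1)}"
      hence "int_decode k \<notin> {- int N..int (N + 1)}" by (metis imageI int_decode_inverse)
      thus "?g N (int_decode k) = 0" by (rule if_not_P)
    qed auto
    also have "\<dots> = (\<Sum>j\<in>{-int N..int (N+1)}. ?g N j)"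
      by (subst sum.reindex) (auto intro!: inj_onI dest: arg_cong[where f = int_decode])
    finally show ?thesis by simp
  qed
  show ?thesis using T unfolding L R .
qed

theorem jacobi_triple:
  fixes z q :: "'a::{real_normed_field,banach}"
  assumes q: "norm q < 1" "q \<noteq> 0" and z: "z \<noteq> 0"
  shows "(\<Sum>\<^sub>\<infinity>j. (-z) powi j * q ^ tri j) = qpoch q q * qpoch z q * qpoch (q / z) q"
proof -
  have s: "(\<lambda>j. (-z) powi j * q ^ tri j) abs_summable_on UNIV"
    by (rule abs_summable_theta[OF q(1)])
  have eq: "(\<Sum>j\<in>{-int N..int (N+1)}. (-z) powi j * q ^ tri j * qbinom q (2 * N + 1) (nat (int N + j)))
     = (\<Prod>k<Suc N. 1 - z * q ^ k) * (\<Prod>k<N. 1 - q / z * q ^ k)" for N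
  proof -
    have 1: "(-z) powi j = (-1) powi j * z powi j" for j
      by (metis mult_minus1 power_int_mult_distrib)
    have 2: "q / z * q ^ k = q ^ Suc k / z" for k by simp
    have 3: "2 * N + 1 = Suc N + N" and 4: "N + 1 = Suc N" by simp_all
    show ?thesis unfolding 1 2 3 4 by (rule finite_jacobi_triple[OF q(2) z, symmetric])
  qed
  have "(\<lambda>N. (\<Prod>k<Suc N. 1 - z * q ^ k) * (\<Prod>k<N. 1 - q / z * q ^ k)) \<longlonglongrightarrow> (\<Sum>\<^sub>\<infinity>j. (-z) powi j * q ^ tri j) / qpoch q q"
    using qbinom_sum_LIMSEQ[OF q(1) s] unfolding eq .
  moreover have "(\<lambda>N. (\<Prod>k<Suc N. 1 - z * q ^ k) * (\<Prod>k<N. 1 - q / z * q ^ k)) \<longlonglongrightarrow> qpoch z q * qpoch (q / z) q"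
    by (intro tendsto_intros filterlim_compose[OF qpoch_LIMSEQ[OF q(1)] filterlim_Suc] qpoch_LIMSEQ q)
  ultimately have "(\<Sum>\<^sub>\<infinity>j. (-z) powi j * q ^ tri j) / qpoch q q = qpoch z q * qpoch (q / z) q"
    by (rule LIMSEQ_unique)
  thus ?thesis using qpoch_self_nonzero[OF q(1)] by (simp add: field_simps)
qed

section \<open>Jacobi's identity for the cube of Euler's product, and bilateral power series\<close>

text \<open>The finite triple product with one extra factor contains \<open>1 - z\<close>, so its
  derivative at \<open>z = 1\<close> is minus the remaining product. Differentiating before the
  limit avoids differentiating a bilateral series in \<open>z\<close>. Pairing \<open>j\<close> with
  \<open>1 - j\<close> gives the usual form with coefficients \<open>2 n + 1\<close>.\<close>

theorem jacobi_cube: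
  fixes q :: "'a::{real_normed_field,banach}"
  assumes q: "norm q < 1" "q \<noteq> 0" and sm: "(\<lambda>j. of_int j * (-1) powi j * q ^ tri j) abs_summable_on UNIV"
  shows "qpoch q q ^ 3 = - (\<Sum>\<^sub>\<infinity>j. of_int j * (-1) powi j * q ^ tri j)"
proof -
  have fin: "- (qfac q N)\<^sup>2 = (\<Sum>j\<in>{-int N..int (N+1)}. (of_int j * (-1) powi j * q ^ tri j) * qbinom q (2 * N + 1) (nat (int N + j)))" for N
  proof -
    define g where "g = (\<lambda>z. (\<Prod>k<N. 1 - z * q ^ Suc k) * (\<Prod>k<N. 1 - q ^ Suc k / z))"
    define S where "S = (\<lambda>z. \<Sum>j\<in>{-int N..int (N+1)}. ((-1) powi j * q ^ tri j * qbinom q (2 * N + 1) (nat (int N + j))) * z powi j)"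
    have SF: "S z = (1 - z) * g z" if "z \<noteq> 0" for z
    proof -
      have 3: "2 * N + 1 = Suc N + N" and 4: "N + 1 = Suc N" by simp_all
      have 5: "(\<Prod>k<Suc N. 1 - z * q ^ k) = (1 - z) * (\<Prod>k<N. 1 - z * q ^ Suc k)"
        unfolding prod.lessThan_Suc_shift[of _ N] by simp
      show ?thesis
        using finite_jacobi_triple[OF q(2) that, of "Suc N" N] unfolding 5
        unfolding S_def g_def 3 4 by (simp add: mult_ac)
    qed
    have "g \<midarrow>1\<rightarrow> g 1" unfolding g_def
      by (intro tendsto_intros) auto
    \<comment> \<open>Caratheodory's criterion: for a product with \<open>1 - z\<close> the
      derivative at 1 requires only continuity of the cofactor \<open>g\<close>.\<close>
    hence "((\<lambda>z. (1 - z) * g z) has_field_derivative - g 1) (at 1)"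
      unfolding CARAT_DERIV by (intro exI[of _ "\<lambda>z. - g z"]) (auto simp: algebra_simps isCont_def intro!: tendsto_intros)
    hence D1: "(S has_field_derivative - g 1) (at 1)"
    proof (rule has_field_derivative_transform_within_open[where S = "-{0}"])
    qed (auto simp: SF)
    have D2: "(S has_field_derivative (\<Sum>j\<in>{-int N..int (N+1)}. ((-1) powi j * q ^ tri j * qbinom q (2 * N + 1) (nat (int N + j))) * of_int j)) (at 1)"
      unfolding S_def
      by (intro DERIV_sum DERIV_cmult) (auto intro!: derivative_eq_intros)
    have "g 1 = (qfac q N)\<^sup>2" by (simp add: g_def qfac_def power2_eq_square)
    with DERIV_unique[OF D1 D2] show ?thesis by (simp add: mult_ac)
  qed
  have "(\<lambda>N. - (qfac q N)\<^sup>2) \<longlonglongrightarrow> (\<Sum>\<^sub>\<infinity>j. of_int j * (-1) powi j * q ^ tri j) / qpoch q q"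
    unfolding fin by (rule qbinom_sum_LIMSEQ[OF q(1) sm])
  moreover have "(\<lambda>N. - (qfac q N)\<^sup>2) \<longlonglongrightarrow> - (qpoch q q)\<^sup>2"
    by (intro tendsto_intros qfac_LIMSEQ q)
  ultimately have "- (qpoch q q)\<^sup>2 = (\<Sum>\<^sub>\<infinity>j. of_int j * (-1) powi j * q ^ tri j) / qpoch q q"
    using LIMSEQ_unique by blast
  hence "(\<Sum>\<^sub>\<infinity>j. of_int j * (-1) powi j * q ^ tri j) = - (qpoch q q)\<^sup>2 * qpoch q q"
    using qpoch_self_nonzero[OF q(1)] by (simp add: nonzero_eq_divide_eq)
  thus ?thesis by (simp only:) (simp add: power3_eq_cube power2_eq_square)
qed

section \<open>Convergence and termwise differentiation of bilateral power series\<close>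

lemma poly_times_power_bounded:
  fixes D s r :: real
  assumes "0 \<le> r" "r < s"
  obtains K where "K \<ge> 0" "\<And>m::nat. \<bar>D + real m\<bar> ^ k * r ^ m \<le> K * s ^ m"
proof -
  \<comment> \<open>Any \<open>t\<close> strictly between 0 and 1 with \<open>r \<le> t * s\<close>
    works; the maximum with 1/2 keeps it positive when \<open>r = 0\<close>.\<close>
  define t where "t = max (1/2) (r / s)"
  have t: "0 < t" "t < 1" using assms by (auto simp: t_def)
  have "(\<lambda>m::nat. (D+real m)^k * t^m) \<longlonglongrightarrow> 0" using t by real_asymp
  hence "Bseq (\<lambda>m::nat. (D+real m)^k * t^m)" by (intro convergent_imp_Bseq convergentI)
  then obtain K where K: "K > 0" "\<And>m. norm ((D+real m)^k * t^m) \<le> K" unfolding Bseq_def by blast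
  have "\<bar>D + real m\<bar> ^ k * r ^ m \<le> K * s ^ m" for m
  proof -
    have "r = (r/s) * s" using assms by simp
    also have "\<dots> \<le> t * s" using assms by (intro mult_right_mono) (auto simp: t_def)
    finally have "r ^ m \<le> (t * s) ^ m" using assms by (intro power_mono)
    hence "\<bar>D + real m\<bar> ^ k * r ^ m \<le> \<bar>D + real m\<bar> ^ k * (t * s) ^ m" by (intro mult_left_mono) auto
    also have "\<dots> = norm ((D+real m)^k * t^m) * s ^ m"
      using t by (simp add: norm_mult norm_power power_mult_distrib abs_mult power_abs)
    also have "\<dots> \<le> K * s ^ m" using assms K by (intro mult_right_mono) auto
    finally show ?thesis .
  qed
  thus ?thesis using K(1) by (intro that[of K]) auto
qed

text \<open>Exponents need only dominate \<open>\<bar>n\<bar>\<close> up to a constant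
  \<open>d\<close>, and coefficients may grow polynomially in the exponent. This class is closed
  under termwise differentiation, which raises \<open>k\<close> and \<open>d\<close> by one.\<close>

lemma abs_summable_qseries:
  fixes c :: "int \<Rightarrow> 'a::{real_normed_field,banach}" and e :: "int \<Rightarrow> nat"
  assumes q: "norm q < 1" and e: "\<And>n. \<bar>n\<bar> \<le> int (e n) + int d"
    and c: "\<And>n. norm (c n) \<le> C * (D + real (e n)) ^ k"
  shows "(\<lambda>n. c n * q ^ e n) abs_summable_on UNIV"
proof -
  obtain s where s: "norm q < s" "s < 1" using dense[OF q] by blast
  have s0: "s > 0" using s(1) norm_ge_zero[of q] by linarith
  obtain K where K: "K \<ge> 0" "\<And>m. \<bar>D + real m\<bar> ^ k * norm q ^ m \<le> K * s ^ m"
    using poly_times_power_bounded[of "norm q" s D k] s by auto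
  have b: "norm (norm (c n * q ^ e n)) \<le> (\<bar>C\<bar> * K / s ^ d) * s ^ nat \<bar>n\<bar>" for n
  proof -
    have "norm (c n * q ^ e n) \<le> (\<bar>C\<bar> * \<bar>D + real (e n)\<bar> ^ k) * norm q ^ e n"
    proof -
      have "norm (c n) \<le> \<bar>C * (D + real (e n)) ^ k\<bar>" using c[of n] by linarith
      thus ?thesis by (auto simp: norm_mult norm_power abs_mult power_abs intro!: mult_right_mono)
    qed
    also have "\<dots> \<le> \<bar>C\<bar> * (K * s ^ e n)"
      unfolding mult.assoc by (intro mult_left_mono K) auto
    also have "s ^ e n \<le> s ^ nat \<bar>n\<bar> / s ^ d"
    proof -
      have "s ^ (e n + d) \<le> s ^ nat \<bar>n\<bar>"
        using e[of n] s s0 by (intro power_decreasing) auto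
      thus ?thesis using s0 by (simp add: power_add field_simps)
    qed
    hence "\<bar>C\<bar> * (K * s ^ e n) \<le> \<bar>C\<bar> * (K * (s ^ nat \<bar>n\<bar> / s ^ d))"
      using K by (intro mult_left_mono) auto
    finally show ?thesis by simp
  qed
  have "(\<lambda>n::int. norm (s ^ nat \<bar>n\<bar>)) summable_on UNIV"
    by (rule summable_on_int_split) (use s s0 in \<open>auto simp: norm_power intro!: summable_geometric\<close>)
  hence "(\<lambda>n::int. (\<bar>C\<bar> * K / s ^ d) * s ^ nat \<bar>n\<bar>) summable_on UNIV"
    using s0 by (intro summable_on_cmult_right) simp
  thus ?thesis by (rule summable_on_comparison_test) (use b in auto)
qed

text \<open>The truncated exponent \<open>e n - 1\<close> is harmless because its coefficient
  contains \<open>e n\<close>. The point may be 0 or negative: the former gives limits at the nome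
  0, the latter the theta function with alternating signs.\<close>

lemma qseries_has_derivative:
  fixes c :: "int \<Rightarrow> real" and e :: "int \<Rightarrow> nat"
  assumes q: "\<bar>q\<bar> < 1" and e: "\<And>n. \<bar>n\<bar> \<le> int (e n) + int d"
    and c: "\<And>n. \<bar>c n\<bar> \<le> C * (D + real (e n)) ^ k"
  shows "((\<lambda>x. \<Sum>\<^sub>\<infinity>n. c n * x ^ e n) has_real_derivative (\<Sum>\<^sub>\<infinity>n. c n * real (e n) * q ^ (e n - 1))) (at q)"
    and "(\<lambda>n. norm (c n * real (e n) * q ^ (e n - 1))) summable_on UNIV"
proof -
  have sm: "(\<lambda>n. norm (c n * x ^ e n)) summable_on UNIV" if "\<bar>x\<bar> < 1" for x
    using that e c by (intro abs_summable_qseries[where d = d and C = C and D = D and k = k]) auto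
  have sm': "(\<lambda>n. norm (c n * real (e n) * x ^ (e n - 1))) summable_on UNIV" if "\<bar>x\<bar> < 1" for x
  proof (rule abs_summable_qseries[where d = "d+1" and C = "\<bar>C\<bar>" and D = "1 + \<bar>D\<bar>" and k = "k+1"])
    fix n
    show "\<bar>n\<bar> \<le> int (e n - 1) + int (d + 1)" using e[of n] by linarith
    have "\<bar>c n\<bar> \<le> \<bar>C * (D + real (e n)) ^ k\<bar>" using c[of n] by linarith
    also have "\<dots> = \<bar>C\<bar> * \<bar>D + real (e n)\<bar> ^ k" by (simp add: abs_mult power_abs)
    also have "\<dots> \<le> \<bar>C\<bar> * (1 + \<bar>D\<bar> + real (e n - 1)) ^ k"
      by (intro mult_left_mono power_mono) auto
    finally have "\<bar>c n\<bar> * real (e n) \<le> (\<bar>C\<bar> * (1 + \<bar>D\<bar> + real (e n - 1)) ^ k) * (1 + \<bar>D\<bar> + real (e n - 1))"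
      by (intro mult_mono) auto
    thus "norm (c n * real (e n)) \<le> \<bar>C\<bar> * (1 + \<bar>D\<bar> + real (e n - 1)) ^ (k + 1)"
      by (simp add: abs_mult mult_ac)
  qed (use that in auto)
  show "(\<lambda>n. norm (c n * real (e n) * q ^ (e n - 1))) summable_on UNIV" by (rule sm'[OF q])
  obtain r where r: "\<bar>q\<bar> < r" "r < 1" using dense[OF q] by blast
  have r0: "r > 0" using r by linarith
  let ?f = "\<lambda>n x. c (int_decode n) * x ^ e (int_decode n)"
  let ?f' = "\<lambda>n x. c (int_decode n) * real (e (int_decode n)) * x ^ (e (int_decode n) - 1)"
  have suml: "(\<Sum>n. ?f n x) = (\<Sum>\<^sub>\<infinity>n. c n * x ^ e n)" if "\<bar>x\<bar> < 1" for x
    using suminf_int_decode(1)[OF sm[OF that]] by (simp add: sums_iff)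
  have suml': "(\<Sum>n. ?f' n q) = (\<Sum>\<^sub>\<infinity>n. c n * real (e n) * q ^ (e n - 1))"
    using suminf_int_decode(1)[OF sm'[OF q]] by (simp add: sums_iff)
  have "((\<lambda>x. \<Sum>n. ?f n x) has_field_derivative (\<Sum>n. ?f' n q)) (at q)"
  proof (rule has_field_derivative_series'(2)[where f = ?f and f' = ?f' and x = q and S = "{-r..r}" and x0 = 0])
    show "convex {-r..r}" by simp
    show "(?f n has_field_derivative ?f' n x) (at x within {-r..r})" for n x
      by (auto intro!: derivative_eq_intros)
    show "uniformly_convergent_on {-r..r} (\<lambda>n x. \<Sum>i<n. ?f' i x)"
    proof (rule Weierstrass_m_test'[where M = "\<lambda>n. norm (?f' n r)"])
      fix n x assume "x \<in> {-r..r}"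
      thus "norm (?f' n x) \<le> norm (?f' n r)"
        unfolding norm_mult norm_power using r0 by (intro mult_left_mono power_mono) auto
    qed (use suminf_int_decode(2)[OF sm'[of r]] r r0 in auto)
    show "summable (\<lambda>n. ?f n 0)"
      using suminf_int_decode(1)[OF sm[of 0]] by (simp add: sums_iff)
  qed (use r r0 in auto)
  hence "((\<lambda>x. \<Sum>n. ?f n x) has_field_derivative (\<Sum>\<^sub>\<infinity>n. c n * real (e n) * q ^ (e n - 1))) (at q)"
    unfolding suml' .
  thus "((\<lambda>x. \<Sum>\<^sub>\<infinity>n. c n * x ^ e n) has_real_derivative (\<Sum>\<^sub>\<infinity>n. c n * real (e n) * q ^ (e n - 1))) (at q)"
    by (rule has_field_derivative_transform_within_open[where S = "{-1<..<1}"]) (use q suml in auto)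
qed

section \<open>The Rogers--Ramanujan continued fraction\<close>

text \<open>
  \<open>rogers_G\<close> and \<open>rogers_H\<close> are Rogers' very-well-poised forms of \<open>(zq)_\<infinity> F(z)\<close> and \<open>(zq)_\<infinity> F(zq)\<close>, where
  \<open>F(z) = \<Sum> z^n q^(n^2) / (q)_n\<close> solves \<open>F(z) = F(zq) + zq F(zq^2)\<close>. Working with them from the start makes the
  sums at \<open>z = 1\<close> theta series, so that no separate Rogers--Ramanujan identity is needed. Here \<open>e5 n = n(5n+1)/2\<close>.
\<close>

definition qratio :: "real \<Rightarrow> real \<Rightarrow> nat \<Rightarrow> real" where
  "qratio q z n = (\<Prod>i<n. (1 - z * q * q ^ i) / (1 - q * q ^ i))"

fun e5 :: "nat \<Rightarrow> nat" where "e5 0 = 0" | "e5 (Suc n) = e5 n + 5 * n + 3"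

definition rog_A :: "real \<Rightarrow> real \<Rightarrow> nat \<Rightarrow> real" where
  "rog_A q z n = (-1) ^ n * z ^ (2 * n) * q ^ e5 n * qratio q z n"

definition rogers_G :: "real \<Rightarrow> real \<Rightarrow> real" where
  "rogers_G q z = (\<Sum>n. rog_A q z n * (1 - z\<^sup>2 * q ^ (4 * n + 2)))"

definition rogers_H :: "real \<Rightarrow> real \<Rightarrow> real" where
  "rogers_H q z = (\<Sum>n. rog_A q z n * q ^ n * (1 - z * q ^ (2 * n + 1)))"

lemma e5_ge: "e5 n \<ge> n"
  by (induction n) auto

lemma two_e5: "2 * e5 n = n * (5 * n + 1)"
  by (induction n) (auto simp: algebra_simps)

lemma qratio_0 [simp]: "qratio q z 0 = 1"
  and qratio_Suc: "qratio q z (Suc n) = qratio q z n * ((1 - z * q * q ^ n) / (1 - q * q ^ n))"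
  by (simp_all add: qratio_def)

context
  fixes q :: real
  assumes q: "0 < q" "q < 1"
begin

lemma one_minus_pos: "1 - q * q ^ n > 0"
  using q by (metis diff_gt_0_iff_gt power_Suc power_Suc_less_one)

lemma qratio_shift: "(1 - z * q) * qratio q (z * q) n = qratio q z n * (1 - z * q * q ^ n)"
proof (induction n)
  case (Suc n)
  have "(1 - z * q) * qratio q (z * q) (Suc n)
      = ((1 - z * q) * qratio q (z * q) n) * ((1 - z * q * q * q ^ n) / (1 - q * q ^ n))"
    by (simp add: qratio_Suc)
  also have "\<dots> = qratio q z (Suc n) * (1 - z * q * q ^ Suc n)"
    unfolding Suc.IH by (simp add: qratio_Suc mult_ac)
  finally show ?case .
qed auto

text \<open>The bound must be uniform in \<open>z\<close>, since \<open>z\<close> will run through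
  all powers of \<open>q\<close>.\<close>

lemma qratio_bounded: obtains B where "B > 0" "\<And>z n. 0 \<le> z \<Longrightarrow> z \<le> 1 \<Longrightarrow> \<bar>qratio q z n\<bar> \<le> B"
proof -
  have nq: "norm q < 1" using q by simp
  have 2: "(\<lambda>n. inverse (qfac q n)) \<longlonglongrightarrow> inverse (qpoch q q)"
    by (intro tendsto_inverse qfac_LIMSEQ qpoch_self_nonzero nq)
  obtain C where C: "C > 0" "\<And>n. norm (inverse (qfac q n)) \<le> C"
    using convergent_imp_Bseq[OF convergentI[OF 2]] unfolding Bseq_def by blast
  have "\<bar>qratio q z n\<bar> \<le> C" if "0 \<le> z" "z \<le> 1" for z n
  proof -
    have "\<bar>qratio q z n\<bar> = (\<Prod>i<n. \<bar>1 - z * q * q ^ i\<bar> / (1 - q * q ^ i))"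
      unfolding qratio_def abs_prod using one_minus_pos by (intro prod.cong) (auto simp: less_imp_le)
    also have "\<dots> \<le> (\<Prod>i<n. 1 / (1 - q * q ^ i))"
    proof (intro prod_mono conjI divide_right_mono)
      fix i
      have "z * (q * q ^ i) \<le> 1" "0 \<le> z * (q * q ^ i)"
        using that q one_minus_pos[of i] by (auto intro!: mult_le_one power_le_one simp: less_imp_le)
      thus "\<bar>1 - z * q * q ^ i\<bar> \<le> 1" by (simp add: mult.assoc)
    qed (use one_minus_pos in \<open>auto simp: less_imp_le\<close>)
    also have "\<dots> = inverse (qfac q n)"
      by (simp add: qfac_def prod_dividef inverse_eq_divide)
    also have "\<dots> \<le> C" using abs_le_D1[of "inverse (qfac q n)" C] C(2)[of n] by simp
    finally show ?thesis .
  qed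
  thus ?thesis using C(1) that by blast
qed

lemma rog_A_bound: obtains B where "B > 0" 
   "\<And>z n. 0 \<le> z \<Longrightarrow> z \<le> 1 \<Longrightarrow> \<bar>rog_A q z n\<bar> \<le> B * z ^ n * q ^ n"
proof -
  obtain B where B: "B > 0" "\<And>z n. 0 \<le> z \<Longrightarrow> z \<le> 1 \<Longrightarrow> \<bar>qratio q z n\<bar> \<le> B"
    using qratio_bounded by blast
  have "\<bar>rog_A q z n\<bar> \<le> B * z ^ n * q ^ n" if z: "0 \<le> z" "z \<le> 1" for z n
  proof -
    have "\<bar>rog_A q z n\<bar> = z ^ (2 * n) * q ^ e5 n * \<bar>qratio q z n\<bar>"
      using q z by (simp add: rog_A_def abs_mult power_abs)
    also have "\<dots> \<le> z ^ n * q ^ n * B"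
      using q z e5_ge[of n] B(2)[OF z] B(1) by (intro mult_mono power_decreasing) auto
    finally show ?thesis by (simp add: mult_ac)
  qed
  thus ?thesis using that B(1) by blast
qed

lemma summable_rog:
  assumes z: "0 \<le> z" "z \<le> 1" and h: "\<And>n. \<bar>h n\<bar> \<le> C"
  shows "summable (\<lambda>n. rog_A q z n * h n)"
proof -
  obtain B where B: "B > 0" "\<And>z n. 0 \<le> z \<Longrightarrow> z \<le> 1 \<Longrightarrow> \<bar>rog_A q z n\<bar> \<le> B * z ^ n * q ^ n"
    using rog_A_bound by blast
  have C: "C \<ge> 0" using h[of 0] by linarith
  show ?thesis
  proof (rule summable_comparison_test')
    show "summable (\<lambda>n. B * C * q ^ n)" using q by (intro summable_mult summable_geometric) auto
    fix n
    have "\<bar>rog_A q z n\<bar> \<le> B * z ^ n * q ^ n" by (rule B(2)[OF z])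
    also have "\<dots> \<le> B * 1 * q ^ n"
      using z q B(1) by (intro mult_right_mono mult_left_mono power_le_one) auto
    finally have "\<bar>rog_A q z n\<bar> * \<bar>h n\<bar> \<le> (B * q ^ n) * C"
      using h[of n] B(1) q by (intro mult_mono) auto
    thus "norm (rog_A q z n * h n) \<le> B * C * q ^ n" by (simp add: abs_mult mult_ac)
  qed
qed

lemma mult_power_bounds:
  assumes "0 \<le> z" "z \<le> 1"
  shows "0 \<le> z * q ^ k" "z * q ^ k \<le> 1"
proof -
  have "q ^ k \<le> 1" using q by (simp add: power_le_one)
  thus "0 \<le> z * q ^ k" "z * q ^ k \<le> 1" using assms q by (auto intro!: mult_le_one)
qed

lemma shift_bounds: "0 \<le> z \<Longrightarrow> z \<le> 1 \<Longrightarrow> 0 \<le> z * q \<and> z * q \<le> 1"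
  using mult_power_bounds[of z 1] by simp

lemma factor_bound:
  assumes "0 \<le> z" "z \<le> 1"
  shows "\<bar>1 - z * q ^ k\<bar> \<le> 1" "\<bar>1 - z\<^sup>2 * q ^ k\<bar> \<le> 1"
  using mult_power_bounds[OF assms, of k] mult_power_bounds[of "z\<^sup>2" k] assms
  by (auto simp: power_le_one)

lemma rogers_sums:
  assumes z: "0 \<le> z" "z \<le> 1"
  shows "(\<lambda>n. rog_A q z n * (1 - z\<^sup>2 * q ^ (4 * n + 2))) sums rogers_G q z"
    and "(\<lambda>n. rog_A q z n * q ^ n * (1 - z * q ^ (2 * n + 1))) sums rogers_H q z"
proof -
  show "(\<lambda>n. rog_A q z n * (1 - z\<^sup>2 * q ^ (4 * n + 2))) sums rogers_G q z"
    unfolding rogers_G_def by (intro summable_sums summable_rog[OF z, of _ 1] factor_bound z)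
  have "summable (\<lambda>n. rog_A q z n * (q ^ n * (1 - z * q ^ (2 * n + 1))))"
  proof (rule summable_rog[OF z, of _ 1])
    fix n
    have "\<bar>q ^ n\<bar> * \<bar>1 - z * q ^ (2 * n + 1)\<bar> \<le> 1 * 1"
      using q by (intro mult_mono factor_bound z) (auto simp: power_le_one)
    thus "\<bar>q ^ n * (1 - z * q ^ (2 * n + 1))\<bar> \<le> 1" by (simp add: abs_mult)
  qed
  thus "(\<lambda>n. rog_A q z n * q ^ n * (1 - z * q ^ (2 * n + 1))) sums rogers_H q z"
    unfolding rogers_H_def by (intro summable_sums) (simp add: mult.assoc)
qed

lemma rog_A_Suc: "rog_A q z (Suc n) = - rog_A q z n * z\<^sup>2 * q ^ (5 * n + 3) * ((1 - z * q * q ^ n) / (1 - q * q ^ n))"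
  by (simp add: rog_A_def qratio_Suc power_add power_mult power2_eq_square mult_ac)

lemma rog_A_shift: "(1 - z * q) * rog_A q (z * q) n = rog_A q z n * q ^ (2 * n) * (1 - z * q * q ^ n)"
proof -
  have "(1 - z * q) * rog_A q (z * q) n = (-1) ^ n * (z * q) ^ (2 * n) * q ^ e5 n * ((1 - z * q) * qratio q (z * q) n)"
    by (simp add: rog_A_def)
  also have "\<dots> = rog_A q z n * q ^ (2 * n) * (1 - z * q * q ^ n)"
    unfolding qratio_shift by (simp add: rog_A_def power_mult_distrib)
  finally show ?thesis .
qed

text \<open>The two series do not agree term by term. Splitting the factor
  \<open>1 - (z * q)\<^sup>2 * q ^ (4 * n + 2)\<close> on the right into two series and delaying the
  second by one index makes them agree, which is \<open>key\<close>.\<close>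

lemma rogers_H_eq:
  assumes z: "0 \<le> z" "z \<le> 1"
  shows "rogers_H q z = (1 - z * q) * rogers_G q (z * q)"
proof -
  note w = shift_bounds[OF z, THEN conjunct1] shift_bounds[OF z, THEN conjunct2]
  define T where "T n = rog_A q z n * q ^ n * (1 - z * q ^ (2 * n + 1))" for n
  define X where "X n = (1 - z * q) * rog_A q (z * q) n * ((z * q)\<^sup>2 * q ^ (4 * n + 2))" for n
  define S where "S = (\<Sum>n. rog_A q (z * q) n)"
  have key: "T (Suc n) = (1 - z * q) * rog_A q (z * q) (Suc n) - X n" for n
  proof -
    define P t where "P = rog_A q z n" and "t = q ^ n"
    have nz: "1 - q * t \<noteq> 0" using one_minus_pos[of n] by (simp add: t_def)
    have pn: "q ^ (n * 2) = q ^ n * q ^ n" "q ^ (n * 3) = q ^ n * (q ^ n * q ^ n)"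
      by (simp_all add: power_mult power2_eq_square power3_eq_cube)
    have pw: "q ^ (5 * n + 3) = t ^ 5 * q ^ 3" "q ^ (2 * Suc n + 1) = t\<^sup>2 * q ^ 3" "q ^ Suc n = t * q"
      "q ^ (2 * Suc n) = t\<^sup>2 * q\<^sup>2" "q ^ (4 * n + 2) = t ^ 4 * q\<^sup>2" "q ^ (2 * n) = t\<^sup>2"
      using pn unfolding t_def by (simp_all add: power_add power_mult[symmetric] mult.commute power3_eq_cube power2_eq_square)
    have 1: "T (Suc n) = - P * z\<^sup>2 * (t ^ 5 * q ^ 3) * ((1 - z * q * t) / (1 - q * t)) * (t * q) * (1 - z * (t\<^sup>2 * q ^ 3))"
      unfolding T_def rog_A_Suc pw by (simp add: P_def t_def)
    have 2: "(1 - z * q) * rog_A q (z * q) (Suc n) = - P * z\<^sup>2 * (t ^ 5 * q ^ 3) * ((1 - z * q * t) / (1 - q * t)) * (t\<^sup>2 * q\<^sup>2) * (1 - z * q * (t * q))"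
      unfolding rog_A_shift[of z "Suc n"] unfolding rog_A_Suc pw by (simp add: P_def t_def)
    have 3: "X n = P * t\<^sup>2 * (1 - z * q * t) * ((z * q)\<^sup>2 * (t ^ 4 * q\<^sup>2))"
      unfolding X_def rog_A_shift pw by (simp add: P_def t_def)
    have "a / (1 - q * t) * (1 - q * t) = a" for a using nz by simp
    have alg: "- P * z\<^sup>2 * (t ^ 5 * q ^ 3) * ((1 - z * q * t) * r) * (t * q) * (1 - z * (t\<^sup>2 * q ^ 3))
      = - P * z\<^sup>2 * (t ^ 5 * q ^ 3) * ((1 - z * q * t) * r) * (t\<^sup>2 * q\<^sup>2) * (1 - z * q * (t * q))
        - (r * (1 - q * t)) * (P * t\<^sup>2 * (1 - z * q * t) * ((z * q)\<^sup>2 * (t ^ 4 * q\<^sup>2)))" for r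
      by algebra
    have r: "inverse (1 - q * t) * (1 - q * t) = 1" using nz by simp
    show ?thesis unfolding 1 2 3 divide_inverse alg r by simp
  qed
  have sA: "summable (\<lambda>n. rog_A q (z * q) n)"
    using summable_rog[OF w, of "\<lambda>_. 1" 1] by simp
  have "(z * q)\<^sup>2 \<le> 1" using w by (intro power_le_one) auto
  hence "\<bar>(z * q)\<^sup>2 * q ^ (4 * n + 2)\<bar> \<le> 1" for n
    using mult_power_bounds[of "(z*q)\<^sup>2" "4 * n + 2"] by (simp only: abs_of_nonneg zero_le_power2)
  hence sG: "summable (\<lambda>n. rog_A q (z * q) n * ((z * q)\<^sup>2 * q ^ (4 * n + 2)))"
    by (rule summable_rog[OF w])
  have sX: "summable X"
    unfolding X_def using summable_mult[OF sG, of "1 - z * q"] by (simp add: mult.assoc)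
  have sA': "(\<lambda>n. (1 - z * q) * rog_A q (z * q) n) sums ((1 - z * q) * S)"
    unfolding S_def by (intro sums_mult summable_sums sA)
  have "(\<lambda>n. (1 - z * q) * rog_A q (z * q) (Suc n)) sums ((1 - z * q) * S - (1 - z * q) * rog_A q (z * q) 0)"
    by (subst sums_Suc_iff) (use sA' in simp)
  from sums_diff[OF this summable_sums[OF sX]]
  have "(\<lambda>n. T (Suc n)) sums ((1 - z * q) * S - (1 - z * q) * rog_A q (z * q) 0 - suminf X)"
    unfolding key .
  hence "T sums ((1 - z * q) * S - (1 - z * q) * rog_A q (z * q) 0 - suminf X + T 0)"
    by (simp add: sums_Suc_iff)
  also have "T 0 = (1 - z * q) * rog_A q (z * q) 0" by (simp add: T_def rog_A_def)
  finally have T: "T sums ((1 - z * q) * S - suminf X)" by simp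
  have "rogers_H q z = (1 - z * q) * S - suminf X"
    using sums_unique2[OF rogers_sums(2)[OF z] T[unfolded T_def]] .
  moreover have "(\<lambda>n. (1 - z * q) * rog_A q (z * q) n - X n) sums ((1 - z * q) * S - suminf X)"
    by (intro sums_diff sA' summable_sums sX)
  moreover have "(\<lambda>n. (1 - z * q) * rog_A q (z * q) n - X n) sums ((1 - z * q) * rogers_G q (z * q))"
    using sums_mult[OF rogers_sums(1)[OF w], of "1 - z * q"] by (simp add: X_def algebra_simps)
  ultimately show ?thesis using sums_unique2 by metis
qed

text \<open>The difference of the two factors is
  \<open>(1 - q^n) + z q^(3n+1) (1 - z q^(n+1))\<close>. The part \<open>U\<close> vanishes at
  \<open>n = 0\<close>, so it may be advanced by one index; there its factor
  \<open>1 - q^(n+1)\<close> cancels the new denominator of \<open>rog_A\<close>, and it combines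
  with \<open>Y\<close>.\<close>

lemma rogers_G_minus_H:
  assumes z: "0 \<le> z" "z \<le> 1"
  shows "rogers_G q z - rogers_H q z = z * q * (1 - z * q) * rogers_H q (z * q)"
proof -
  note w = shift_bounds[OF z, THEN conjunct1] shift_bounds[OF z, THEN conjunct2]
  define U where "U n = rog_A q z n * (1 - q ^ n)" for n
  define Y where "Y n = rog_A q z n * (z * q ^ (3 * n + 1) * (1 - z * q * q ^ n))" for n
  have UY: "rog_A q z n * (1 - z\<^sup>2 * q ^ (4 * n + 2)) - rog_A q z n * q ^ n * (1 - z * q ^ (2 * n + 1)) = U n + Y n" for n
    by (simp add: U_def Y_def algebra_simps power_add power2_eq_square power_mult[symmetric] flip: power_mult)
       (simp add: power_mult power_numeral_reduce mult_ac)
  have sU: "summable U" unfolding U_def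
    using q by (intro summable_rog[OF z, of _ 1]) (auto simp: power_le_one)
  have "rogers_G q z - rogers_H q z = suminf (\<lambda>n. U n + Y n)"
    using sums_diff[OF rogers_sums[OF z]] unfolding UY by (simp add: sums_iff)
  have D: "(\<lambda>n. U n + Y n) sums (rogers_G q z - rogers_H q z)"
    using sums_diff[OF rogers_sums[OF z]] unfolding UY .
  have sY: "Y sums (rogers_G q z - rogers_H q z - suminf U)"
    using sums_diff[OF D summable_sums[OF sU]] by simp
  have "(\<lambda>n. U (Suc n)) sums suminf U"
    using summable_sums[OF sU] by (subst sums_Suc_iff) (simp add: U_def)
  from sums_add[OF this sY] have L: "(\<lambda>n. U (Suc n) + Y n) sums (rogers_G q z - rogers_H q z)" by simp
  have key: "U (Suc n) + Y n = z * q * ((1 - z * q) * (rog_A q (z * q) n * q ^ n * (1 - z * q * q ^ (2 * n + 1))))" for n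
  proof -
    define P t where "P = rog_A q z n" and "t = q ^ n"
    have nz: "1 - q * t \<noteq> 0" using one_minus_pos[of n] by (simp add: t_def)
    have pn: "q ^ (n * 2) = q ^ n * q ^ n" "q ^ (n * 3) = q ^ n * (q ^ n * q ^ n)"
      by (simp_all add: power_mult power2_eq_square power3_eq_cube)
    have pw: "q ^ (5 * n + 3) = t ^ 5 * q ^ 3" "q ^ (2 * n + 1) = t\<^sup>2 * q" "q ^ Suc n = q * t"
      "q ^ (3 * n + 1) = t ^ 3 * q" "q ^ (2 * n) = t\<^sup>2"
      using pn unfolding t_def by (simp_all add: power_add power_mult[symmetric] mult.commute power3_eq_cube power2_eq_square)
    have 1: "U (Suc n) = - P * z\<^sup>2 * (t ^ 5 * q ^ 3) * (1 - z * q * t)"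
      unfolding U_def rog_A_Suc pw using nz by (simp add: P_def t_def)
    have 2: "Y n = P * (z * (t ^ 3 * q) * (1 - z * q * t))"
      unfolding Y_def pw by (simp add: P_def t_def)
    have "z * q * ((1 - z * q) * (rog_A q (z * q) n * q ^ n * (1 - z * q * q ^ (2 * n + 1))))
       = z * q * (((1 - z * q) * rog_A q (z * q) n) * q ^ n * (1 - z * q * q ^ (2 * n + 1)))"
      by (simp add: mult_ac)
    also have "\<dots> = z * q * (P * t\<^sup>2 * (1 - z * q * t) * t * (1 - z * q * (t\<^sup>2 * q)))"
      unfolding rog_A_shift pw by (simp add: P_def t_def)
    finally have 3: "z * q * ((1 - z * q) * (rog_A q (z * q) n * q ^ n * (1 - z * q * q ^ (2 * n + 1)))) = \<dots>" .
    show ?thesis unfolding 1 2 3 by algebra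
  qed
  have "(\<lambda>n. U (Suc n) + Y n) sums (z * q * ((1 - z * q) * rogers_H q (z * q)))"
    unfolding key by (intro sums_mult rogers_sums w)
  from sums_unique2[OF L this] show ?thesis by (simp add: mult_ac)
qed

text \<open>The term with \<open>n = 0\<close> differs from 1 by at most \<open>z\<close>, and every
  later term carries \<open>z ^ n\<close>; the rest is a geometric series in
  \<open>q\<close>.\<close>

lemma rogers_near_1:
  obtains C where "\<And>z. 0 \<le> z \<Longrightarrow> z \<le> 1 \<Longrightarrow> \<bar>rogers_G q z - 1\<bar> \<le> C * z"
    "\<And>z. 0 \<le> z \<Longrightarrow> z \<le> 1 \<Longrightarrow> \<bar>rogers_H q z - 1\<bar> \<le> C * z"
proof -
  obtain B where B: "B > 0" "\<And>z n. 0 \<le> z \<Longrightarrow> z \<le> 1 \<Longrightarrow> \<bar>rog_A q z n\<bar> \<le> B * z ^ n * q ^ n"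
    using rog_A_bound by blast
  have gen: "\<bar>S - 1\<bar> \<le> ((B + 1) / (1 - q)) * z"
    if z: "0 \<le> z" "z \<le> 1" and S: "(\<lambda>n. rog_A q z n * h n) sums S" and h: "\<And>n. \<bar>h n\<bar> \<le> 1" and h0: "\<bar>h 0 - 1\<bar> \<le> z"
    for h S z
  proof -
    have a: "(\<lambda>n. if n = 0 then 1 else 0::real) sums 1"
      using sums_single[of 0 "\<lambda>_. 1::real"] by simp
    have b: "(\<lambda>n. rog_A q z n * h n - (if n = 0 then 1 else 0)) sums (S - 1)"
      by (intro sums_diff S a)
    have c: "(\<lambda>n. ((B + 1) * z) * q ^ n) sums (((B + 1) * z) * (1 / (1 - q)))"
      using q by (intro sums_mult geometric_sums) auto
    have d: "\<bar>rog_A q z n * h n - (if n = 0 then 1 else 0)\<bar> \<le> ((B + 1) * z) * q ^ n" for n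
    proof (cases n)
      case 0
      have "rog_A q z 0 = 1" by (simp add: rog_A_def)
      moreover have "z \<le> (B + 1) * z" using B z by (simp add: algebra_simps)
      ultimately show ?thesis using h0 0 by simp
    next
      case (Suc m)
      have "\<bar>rog_A q z n\<bar> * \<bar>h n\<bar> \<le> (B * z ^ n * q ^ n) * 1"
        using h[of n] B(2)[OF z, of n] by (intro mult_mono) auto
      also have "\<dots> \<le> B * z ^ 1 * q ^ n"
        unfolding mult_1_right using z q B(1) Suc by (intro mult_right_mono mult_left_mono power_decreasing) auto
      also have "\<dots> \<le> ((B + 1) * z) * q ^ n"
        using z q by (intro mult_right_mono) (auto simp: algebra_simps)
      finally show ?thesis using Suc by (simp add: abs_mult)
    qed
    have "\<bar>\<Sum>n. rog_A q z n * h n - (if n = 0 then 1 else 0)\<bar> \<le> (\<Sum>n. ((B + 1) * z) * q ^ n)"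
      using norm_suminf_le[of "\<lambda>n. rog_A q z n * h n - (if n = 0 then 1 else 0)" "\<lambda>n. ((B + 1) * z) * q ^ n"] d c
      by (simp add: sums_iff)
    thus ?thesis using b c by (simp add: sums_iff mult_ac)
  qed
  show ?thesis
  proof (rule that[of "(B + 1) / (1 - q)"])
    fix z :: real assume z: "0 \<le> z" "z \<le> 1"
    have "z * q\<^sup>2 \<le> 1" using z q by (intro mult_le_one power_le_one) auto
    hence zq: "z * z * q\<^sup>2 \<le> z" "z * q \<le> z"
      using mult_left_le[of "z * q\<^sup>2" z] z q by (auto simp: mult.assoc mult_left_le)
    show "\<bar>rogers_G q z - 1\<bar> \<le> (B + 1) / (1 - q) * z"
      by (rule gen[OF z rogers_sums(1)[OF z] factor_bound(2)[OF z]]) (use zq z q in \<open>simp add: power2_eq_square\<close>)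
    show "\<bar>rogers_H q z - 1\<bar> \<le> (B + 1) / (1 - q) * z"
    proof (rule gen[OF z, of "\<lambda>n. q ^ n * (1 - z * q ^ (2 * n + 1))"])
      show "(\<lambda>n. rog_A q z n * (q ^ n * (1 - z * q ^ (2 * n + 1)))) sums rogers_H q z"
        using rogers_sums(2)[OF z] by (simp add: mult.assoc)
      fix n
      have "\<bar>q ^ n\<bar> * \<bar>1 - z * q ^ (2 * n + 1)\<bar> \<le> 1 * 1"
        using q by (intro mult_mono factor_bound z) (auto simp: power_le_one)
      thus "\<bar>q ^ n * (1 - z * q ^ (2 * n + 1))\<bar> \<le> 1" by (simp add: abs_mult)
    qed (use zq z q in auto)
  qed
qed

text \<open>For large \<open>k\<close> both values are near 1, and positivity descends from
  \<open>k + 1\<close> to \<open>k\<close> because the two functional equations have positive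
  coefficients. It matters at \<open>k = 0\<close>, where the series alternate.\<close>

lemma rogers_pos:
  shows "rogers_G q (q ^ k) > 0" "rogers_H q (q ^ k) > 0"
proof -
  obtain C where C: "\<And>z. 0 \<le> z \<Longrightarrow> z \<le> 1 \<Longrightarrow> \<bar>rogers_G q z - 1\<bar> \<le> C * z"
    "\<And>z. 0 \<le> z \<Longrightarrow> z \<le> 1 \<Longrightarrow> \<bar>rogers_H q z - 1\<bar> \<le> C * z" using rogers_near_1 by blast
  have b: "0 \<le> q ^ k" "q ^ k \<le> 1" for k using q by (auto simp: power_le_one)
  have "(\<lambda>k. C * q ^ k) \<longlonglongrightarrow> C * 0" using q by (intro tendsto_intros LIMSEQ_power_zero) auto
  hence "eventually (\<lambda>k. C * q ^ k < 1) sequentially" by (rule order_tendstoD(2)) simp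
  then obtain N where N: "\<And>k. k \<ge> N \<Longrightarrow> C * q ^ k < 1" unfolding eventually_sequentially by blast
  have big: "rogers_G q (q ^ k) > 0 \<and> rogers_H q (q ^ k) > 0" if "k \<ge> N" for k
    using C[OF b, of k] N[OF that] by linarith
  have step: "rogers_G q (q ^ k) > 0 \<and> rogers_H q (q ^ k) > 0"
    if "rogers_G q (q ^ Suc k) > 0 \<and> rogers_H q (q ^ Suc k) > 0" for k
  proof -
    have p: "1 - q ^ k * q > 0" using one_minus_pos[of k] by (simp add: mult.commute)
    have H: "rogers_H q (q ^ k) = (1 - q ^ k * q) * rogers_G q (q ^ Suc k)"
      using rogers_H_eq[OF b, of k] by (simp add: mult.commute)
    have G: "rogers_G q (q ^ k) = rogers_H q (q ^ k) + q ^ k * q * (1 - q ^ k * q) * rogers_H q (q ^ Suc k)"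
      using rogers_G_minus_H[OF b, of k] by (simp add: mult.commute)
    have "rogers_H q (q ^ k) > 0" unfolding H using p that by simp
    moreover have "q ^ k * q * (1 - q ^ k * q) * rogers_H q (q ^ Suc k) > 0" using p that q by simp
    ultimately show ?thesis using G by linarith
  qed
  have "rogers_G q (q ^ (m - j)) > 0 \<and> rogers_H q (q ^ (m - j)) > 0" if "m \<ge> N" "j \<le> m" for m j
    using that
  proof (induction j)
    case 0 thus ?case using big by simp
  next
    case (Suc j)
    have "Suc (m - Suc j) = m - j" using Suc.prems by linarith
    thus ?case using step[of "m - Suc j"] Suc by simp
  qed
  from this[of "k + N" N] show "rogers_G q (q ^ k) > 0" "rogers_H q (q ^ k) > 0" by auto
qed

text \<open>The value of the tail of the continued fraction that starts at level \<open>k\<close>,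
  to be compared with \<open>rr_conv q N k\<close>.\<close>

definition rog_c :: "nat \<Rightarrow> real" where "rog_c k = rogers_G q (q ^ k) / rogers_H q (q ^ k)"

lemma rog_c_rec: "rog_c k = 1 + q ^ Suc k / rog_c (Suc k)"
proof -
  have b: "0 \<le> q ^ k" "q ^ k \<le> 1" using q by (auto simp: power_le_one)
  have p: "1 - q ^ k * q > 0" using one_minus_pos[of k] by (simp add: mult.commute)
  have H: "rogers_H q (q ^ k) = (1 - q ^ k * q) * rogers_G q (q ^ Suc k)"
    using rogers_H_eq[OF b] by (simp add: mult.commute)
  have G: "rogers_G q (q ^ k) = rogers_H q (q ^ k) + q ^ k * q * (1 - q ^ k * q) * rogers_H q (q ^ Suc k)"
    using rogers_G_minus_H[OF b] by (simp add: mult.commute)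
  have "rog_c k = 1 + q ^ k * q * (1 - q ^ k * q) * rogers_H q (q ^ Suc k) / rogers_H q (q ^ k)"
    unfolding rog_c_def using rogers_pos(2)[of k] by (subst G) (simp add: add_divide_distrib)
  also have "\<dots> = 1 + q ^ Suc k / rog_c (Suc k)"
    unfolding rog_c_def H using p by (simp add: divide_simps)
  finally show ?thesis .
qed

lemma rog_c_ge_1: "rog_c k \<ge> 1"
proof -
  have "rog_c (Suc k) > 0" unfolding rog_c_def using rogers_pos[of "Suc k"] by (rule divide_pos_pos)
  thus ?thesis using q by (subst rog_c_rec) simp
qed

lemma rr_conv_ge_1: "rr_conv q N k \<ge> 1"
proof (induction N arbitrary: k)
  case (Suc N)
  have "rr_conv q N (Suc k) > 0" using Suc[of "Suc k"] by linarith
  hence "q ^ Suc k / rr_conv q N (Suc k) \<ge> 0" using q by (intro divide_nonneg_pos) auto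
  thus ?case by (simp del: power_Suc)
qed simp

text \<open>On the half-line from 1 the map \<open>x -> 1 + q^(k+1) / x\<close> contracts at least
  by the factor \<open>q\<close>, and both the convergents and the candidate value stay there. This
  proves convergence and identifies the limit at once; the level \<open>k\<close> varies in the
  induction.\<close>

lemma rr_conv_error: "\<bar>rr_conv q N k - rog_c k\<bar> \<le> q ^ N"
proof (induction N arbitrary: k)
  case 0
  have "q ^ Suc k / rog_c (Suc k) \<le> 1 / 1"
    using q rog_c_ge_1[of "Suc k"] by (intro frac_le) (auto simp: power_le_one simp del: power_Suc)
  moreover have "rog_c k \<ge> 1" by (rule rog_c_ge_1)
  ultimately show ?case using rog_c_rec[of k] by simp
next
  case (Suc N)
  define x y where "x = rr_conv q N (Suc k)" and "y = rog_c (Suc k)"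
  have xy: "x \<ge> 1" "y \<ge> 1" using rr_conv_ge_1 rog_c_ge_1 by (auto simp: x_def y_def)
  have "\<bar>rr_conv q (Suc N) k - rog_c k\<bar> = \<bar>q ^ Suc k / x - q ^ Suc k / y\<bar>"
    by (subst rog_c_rec) (simp add: x_def y_def)
  also have "\<dots> = q ^ Suc k * \<bar>x - y\<bar> / (x * y)"
  proof -
    have "q ^ Suc k / x - q ^ Suc k / y = q ^ Suc k * (y - x) / (x * y)"
      using xy by (simp add: field_simps)
    thus ?thesis using xy q by (simp add: abs_mult abs_minus_commute)
  qed
  also have "\<dots> \<le> q * q ^ N / 1"
  proof (intro frac_le mult_mono)
    show "q ^ Suc k \<le> q" using q power_decreasing[of 1 "Suc k" q] by simp
    show "\<bar>x - y\<bar> \<le> q ^ N" unfolding x_def y_def by (rule Suc.IH)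
    show "1 \<le> x * y" using mult_mono[of 1 x 1 y] xy by simp
  qed (use q in auto)
  finally show ?case by simp
qed

theorem RR_eq_rogers: "RR q = q powr (1/5) * rogers_H q 1 / rogers_G q 1"
proof -
  have "(\<lambda>N. rr_conv q N 0 - rog_c 0) \<longlonglongrightarrow> 0"
    by (rule Lim_null_comparison[OF always_eventually LIMSEQ_power_zero[of q]]) (use rr_conv_error q in auto)
  hence "(\<lambda>N. rr_conv q N 0) \<longlonglongrightarrow> rog_c 0" by (simp add: LIM_zero_iff)
  hence "lim (\<lambda>N. rr_conv q N 0) = rogers_G q 1 / rogers_H q 1"
    by (simp add: limI rog_c_def)
  thus ?thesis by (simp add: RR_def)
qed

lemma rogers_at_1:
  "(\<lambda>n. (-1) ^ n * q ^ e5 n * (1 - q ^ (4 * n + 2))) sums rogers_G q 1"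
  "(\<lambda>n. (-1) ^ n * q ^ (e5 n + n) * (1 - q ^ (2 * n + 1))) sums rogers_H q 1"
proof -
  have "qratio q 1 n = 1" for n
    using one_minus_pos by (auto simp: qratio_def intro!: prod.neutral simp: less_imp_neq[symmetric])
  hence A: "rog_A q 1 n = (-1) ^ n * q ^ e5 n" for n by (simp add: rog_A_def)
  show "(\<lambda>n. (-1) ^ n * q ^ e5 n * (1 - q ^ (4 * n + 2))) sums rogers_G q 1"
    using rogers_sums(1)[of 1] unfolding A by simp
  show "(\<lambda>n. (-1) ^ n * q ^ (e5 n + n) * (1 - q ^ (2 * n + 1))) sums rogers_H q 1"
    using rogers_sums(2)[of 1] unfolding A by (simp add: power_add mult.assoc)
qed

end

section \<open>The icosahedral relation\<close>

lemma infsum_int_mod: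
  fixes f :: "int \<Rightarrow> 'a::banach"
  assumes "f abs_summable_on UNIV" and m: "m > 0"
  shows "infsum f UNIV = (\<Sum>r<m. \<Sum>\<^sub>\<infinity>k. f (int m * k + int r))"
proof -
  have bij: "bij_betw (\<lambda>(r,k). int m * k + int r) ({..<m} \<times> UNIV) UNIV"
  proof (rule bij_betw_byWitness[where f' = "\<lambda>j. (nat (j mod int m), j div int m)"])
    show "\<forall>a\<in>{..<m} \<times> UNIV. (\<lambda>j. (nat (j mod int m), j div int m)) (case a of (r, k) \<Rightarrow> int m * k + int r) = a"
      by (auto simp: mod_add_eq div_mult_self4)
  qed (use m in \<open>auto simp: nat_less_iff\<close>)
  have "f summable_on UNIV" by (rule abs_summable_summable[OF assms(1)])
  hence s: "(\<lambda>(r,k). f (int m * k + int r)) summable_on ({..<m} \<times> UNIV)"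
    using summable_on_reindex_bij_betw[OF bij, of f] by (simp add: case_prod_unfold)
  have "infsum f UNIV = infsum (\<lambda>(r,k). f (int m * k + int r)) ({..<m} \<times> UNIV)"
    using infsum_reindex_bij_betw[OF bij, of f] by (simp add: case_prod_unfold)
  also have "\<dots> = (\<Sum>\<^sub>\<infinity>r\<in>{..<m}. \<Sum>\<^sub>\<infinity>k. f (int m * k + int r))"
    using infsum_Sigma_banach[OF s] by simp
  finally show ?thesis by simp
qed

lemma qpoch_dissect:
  fixes a q :: "'a::{real_normed_field,banach}"
  assumes q: "norm q < 1" and m: "m > 0"
  shows "qpoch a q = (\<Prod>r<m. qpoch (a * q ^ r) (q ^ m))"
proof -
  have qm: "norm (q ^ m) < 1" using q m by (simp add: norm_power power_less_one_iff)
  have eq: "(\<Prod>k<N*m. 1 - a * q ^ k) = (\<Prod>r<m. \<Prod>j<N. 1 - (a * q ^ r) * (q ^ m) ^ j)" for N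
  proof -
    have "(\<Prod>k<N*m. 1 - a * q ^ k) = (\<Prod>j<N. \<Prod>k\<in>{j*m..<j*m+m}. 1 - a * q ^ k)"
      by (rule prod.nat_group[symmetric])
    also have "\<dots> = (\<Prod>j<N. \<Prod>r<m. 1 - (a * q ^ r) * (q ^ m) ^ j)"
    proof (rule prod.cong[OF refl])
      fix j
      show "(\<Prod>k\<in>{j*m..<j*m+m}. 1 - a * q ^ k) = (\<Prod>r<m. 1 - (a * q ^ r) * (q ^ m) ^ j)"
        by (rule prod.reindex_bij_witness[of _ "\<lambda>r. j * m + r" "\<lambda>k. k - j * m"])
           (auto simp: power_mult[symmetric] power_add[symmetric] mult.assoc mult.commute[of m j])
    qed
    also have "\<dots> = (\<Prod>r<m. \<Prod>j<N. 1 - (a * q ^ r) * (q ^ m) ^ j)" by (rule prod.swap)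
    finally show ?thesis .
  qed
  have "filterlim (\<lambda>N. N * m) at_top sequentially"
    using m by (simp add: mult_nat_right_at_top)
  hence "(\<lambda>N. \<Prod>k<N*m. 1 - a * q ^ k) \<longlonglongrightarrow> qpoch a q"
    by (rule filterlim_compose[OF qpoch_LIMSEQ[OF q]])
  moreover have "(\<lambda>N. \<Prod>r<m. \<Prod>j<N. 1 - (a * q ^ r) * (q ^ m) ^ j) \<longlonglongrightarrow> (\<Prod>r<m. qpoch (a * q ^ r) (q ^ m))"
    by (intro tendsto_prod qpoch_LIMSEQ qm)
  ultimately show ?thesis unfolding eq by (rule LIMSEQ_unique)
qed

lemma qpoch_rec:
  fixes a q :: "'a::{real_normed_field,banach}"
  assumes q: "norm q < 1"
  shows "qpoch a q = (1 - a) * qpoch (a * q) q"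
proof -
  have "(\<lambda>N. \<Prod>k<Suc N. 1 - a * q ^ k) \<longlonglongrightarrow> qpoch a q"
    by (rule filterlim_compose[OF qpoch_LIMSEQ[OF q] filterlim_Suc])
  moreover have "(\<Prod>k<Suc N. 1 - a * q ^ k) = (1 - a) * (\<Prod>k<N. 1 - (a * q) * q ^ k)" for N
    by (simp add: prod.lessThan_Suc_shift mult_ac del: prod.lessThan_Suc)
  moreover have "(\<lambda>N. (1 - a) * (\<Prod>k<N. 1 - (a * q) * q ^ k)) \<longlonglongrightarrow> (1 - a) * qpoch (a * q) q"
    by (intro tendsto_intros qpoch_LIMSEQ q)
  ultimately show ?thesis using LIMSEQ_unique by simp
qed

text \<open>Fifth roots of unity force a detour through the complex numbers; this brings the real
  products back.\<close>

lemma qpoch_of_real: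
  fixes a q :: real
  assumes "\<bar>q\<bar> < 1"
  shows "qpoch (of_real a) (of_real q) = (of_real (qpoch a q) :: complex)"
proof -
  have "(\<lambda>N. of_real (\<Prod>k<N. 1 - a * q ^ k) :: complex) \<longlonglongrightarrow> of_real (qpoch a q)"
    using assms by (intro tendsto_of_real qpoch_LIMSEQ) auto
  moreover have "(\<lambda>N. \<Prod>k<N. 1 - of_real a * (of_real q :: complex) ^ k) \<longlonglongrightarrow> qpoch (of_real a) (of_real q)"
    using assms by (intro qpoch_LIMSEQ) auto
  ultimately show ?thesis using LIMSEQ_unique by simp
qed

definition eA :: "int \<Rightarrow> nat" where "eA k = nat (k * (5 * k + 1) div 2)"
definition eB :: "int \<Rightarrow> nat" where "eB k = nat (k * (5 * k + 3) div 2)"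

lemma two_eA: "2 * int (eA k) = k * (5 * k + 1)"
proof -
  have "k * (5 * k + 1) \<ge> 0" by (cases "k \<ge> 0") (auto simp: zero_le_mult_iff)
  moreover have "even (k * (5 * k + 1))" by simp
  ultimately show ?thesis by (simp add: eA_def)
qed

lemma two_eB: "2 * int (eB k) = k * (5 * k + 3)"
proof -
  have "k * (5 * k + 3) \<ge> 0" by (cases "k \<ge> 0") (auto simp: zero_le_mult_iff)
  moreover have "even (k * (5 * k + 3))" by simp
  ultimately show ?thesis by (simp add: eB_def)
qed

lemma int_square_ge: "(k::int) * k \<ge> \<bar>k\<bar>"
proof -
  have "\<bar>k\<bar> * \<bar>k\<bar> \<ge> \<bar>k\<bar>" using mult_left_mono[of 1 "\<bar>k\<bar>" "\<bar>k\<bar>"] by (cases "k = 0") auto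
  thus ?thesis by simp
qed

lemma eA_ge: "\<bar>k\<bar> \<le> int (eA k) + int 0"
  using two_eA[of k] int_square_ge[of k] by (simp add: algebra_simps)

lemma eB_ge: "\<bar>k\<bar> \<le> int (eB k) + int 0"
  using two_eB[of k] int_square_ge[of k] by (simp add: algebra_simps)

definition thA :: "'a::{real_normed_field,banach} \<Rightarrow> 'a" where
  "thA q = (\<Sum>\<^sub>\<infinity>k. (-1) powi k * q ^ eA k)"
definition thB :: "'a::{real_normed_field,banach} \<Rightarrow> 'a" where
  "thB q = (\<Sum>\<^sub>\<infinity>k. (-1) powi k * q ^ eB k)"

lemma norm_sign: "norm ((-1) powi k :: 'a::real_normed_field) = 1"
  by (simp add: norm_power_int)

lemma sign_shift: "(-1::'a::field) powi (k + 1) = - ((-1) powi k)"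
  by (simp add: power_int_add)

lemma sign_minus: "(-1::'a::field) powi (- k) = (-1) powi k"
  by (cases "even k") (auto simp: power_int_minus_left)

lemma summable_thA:
  fixes q :: "'a::{real_normed_field,banach}"
  assumes "norm q < 1"
  shows "(\<lambda>k. (-1) powi k * q ^ eA k) abs_summable_on UNIV" "(\<lambda>k. (-1) powi k * q ^ eB k) abs_summable_on UNIV"
  by (rule abs_summable_qseries[where d = 0 and C = 1 and D = 0 and k = 0, OF assms];
      use eA_ge eB_ge in \<open>auto simp: norm_sign\<close>)+

lemma thA_triple:
  fixes q :: "'a::{real_normed_field,banach}"
  assumes q: "norm q < 1" "q \<noteq> 0"
  shows "thA q = qpoch (q^5) (q^5) * qpoch (q^3) (q^5) * qpoch (q^2) (q^5)"
    and "thB q = qpoch (q^5) (q^5) * qpoch (q^4) (q^5) * qpoch q (q^5)"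
proof -
  have q5: "norm (q ^ 5) < 1" using q by (simp add: norm_power power_less_one_iff)
  have t: "(-(q ^ m)) powi j * (q ^ 5) ^ tri j = (-1) powi j * q ^ E" if "int E = int m * j + 5 * int (tri j)" for m j E
  proof -
    have "(-(q ^ m)) powi j = (-1) powi j * q powi (int m * j)"
      by (metis mult_minus1 power_int_mult_distrib power_int_mult power_int_of_nat)
    moreover have "(q ^ 5) ^ tri j = q powi (5 * int (tri j))"
      by (metis of_nat_mult of_nat_numeral power_int_of_nat power_mult)
    moreover have "q powi (int m * j) * q powi (5 * int (tri j)) = q powi int E"
      unfolding that using q by (simp add: power_int_add)
    ultimately show ?thesis by (simp add: mult.assoc power_int_of_nat)
  qed
  have "(\<Sum>\<^sub>\<infinity>j. (-(q ^ 3)) powi j * (q ^ 5) ^ tri j) = qpoch (q^5) (q^5) * qpoch (q^3) (q^5) * qpoch (q^5 / q^3) (q^5)"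
    by (rule jacobi_triple) (use q q5 in auto)
  moreover have "q ^ 5 / q ^ 3 = q\<^sup>2" using q by (simp add: field_simps power_numeral_reduce)
  moreover have "(-(q ^ 3)) powi j * (q ^ 5) ^ tri j = (-1) powi j * q ^ eA j" for j
    by (rule t) (use two_eA[of j] two_tri[of j] in \<open>simp add: algebra_simps\<close>)
  ultimately show "thA q = qpoch (q^5) (q^5) * qpoch (q^3) (q^5) * qpoch (q^2) (q^5)"
    unfolding thA_def by simp
  have "(\<Sum>\<^sub>\<infinity>j. (-(q ^ 4)) powi j * (q ^ 5) ^ tri j) = qpoch (q^5) (q^5) * qpoch (q^4) (q^5) * qpoch (q^5 / q^4) (q^5)"
    by (rule jacobi_triple) (use q q5 in auto)
  moreover have "q ^ 5 / q ^ 4 = q" using q by (simp add: field_simps power_numeral_reduce)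
  moreover have "(-(q ^ 4)) powi j * (q ^ 5) ^ tri j = (-1) powi j * q ^ eB j" for j
    by (rule t) (use two_eB[of j] two_tri[of j] in \<open>simp add: algebra_simps\<close>)
  ultimately show "thB q = qpoch (q^5) (q^5) * qpoch (q^4) (q^5) * qpoch q (q^5)"
    unfolding thB_def by simp
qed

text \<open>The two triple products together contain the residue classes 1, 2, 3, 4 modulo 5 once
  and the class 0 twice.\<close>

lemma thA_times_thB:
  fixes q :: "'a::{real_normed_field,banach}"
  assumes q: "norm q < 1" "q \<noteq> 0"
  shows "thA q * thB q = qpoch q q * qpoch (q^5) (q^5)"
proof -
  have "qpoch q q = (\<Prod>r<5. qpoch (q * q ^ r) (q ^ 5))" by (rule qpoch_dissect) (use q in auto)
  also have "\<dots> = qpoch q (q^5) * qpoch (q^2) (q^5) * qpoch (q^3) (q^5) * qpoch (q^4) (q^5) * qpoch (q^5) (q^5)"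
    by (simp add: eval_nat_numeral lessThan_Suc mult_ac)
  finally show ?thesis unfolding thA_triple[OF q] by (simp add: mult_ac)
qed

section \<open>Products over the fifth roots of unity\<close>

lemma fifth_root_powers:
  fixes w :: "'a::field"
  assumes w: "w ^ 5 = 1" "w \<noteq> 1"
  shows "w ^ 2 \<noteq> 1" "w ^ 3 \<noteq> 1" "w ^ 4 \<noteq> 1"
proof -
  have "w ^ 5 = w ^ 2 * w ^ 2 * w" "w ^ 5 * w = w ^ 3 * w ^ 3" "w ^ 5 = w ^ 4 * w"
    by (simp_all add: eval_nat_numeral mult_ac)
  thus "w ^ 2 \<noteq> 1" "w ^ 3 \<noteq> 1" "w ^ 4 \<noteq> 1" using w by (metis mult_1_left)+
qed

lemma norm_fifth_root:
  fixes w :: "'a::real_normed_field"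
  assumes "w ^ 5 = 1" shows "norm w = 1"
proof (rule power_eq_imp_eq_base[of _ 5])
  show "norm w ^ 5 = 1 ^ 5" using assms by (simp flip: norm_power)
qed auto

lemma prod_fifth_roots:
  fixes w X Y :: "'a::field"
  assumes "w ^ 5 = 1" "w \<noteq> 1"
  shows "(\<Prod>j<5. X - w ^ j * Y) = X ^ 5 - Y ^ 5"
proof -
  have "(w - 1) * (1 + w + w^2 + w^3 + w^4) = 0" using assms(1) by algebra
  hence S: "1 + w + w^2 + w^3 + w^4 = 0" using assms(2) by simp
  have "(\<Prod>j<5. X - w ^ j * Y) = (X - Y) * (X - w * Y) * (X - w^2 * Y) * (X - w^3 * Y) * (X - w^4 * Y)"
    by (simp add: eval_nat_numeral lessThan_Suc mult_ac)
  also have "\<dots> = X ^ 5 - Y ^ 5"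
    using S assms(1) by algebra
  finally show ?thesis .
qed

lemma prod_qpoch_fifth_roots:
  fixes w x q :: "'a::{real_normed_field,banach}"
  assumes w: "w ^ 5 = 1" "w \<noteq> 1" and q: "norm q < 1"
  shows "(\<Prod>j<5. qpoch (w ^ j * x) q) = qpoch (x ^ 5) (q ^ 5)"
proof -
  have q5: "norm (q ^ 5) < 1" using q by (simp add: norm_power power_less_one_iff)
  have "(\<lambda>N. \<Prod>j<5. \<Prod>k<N. 1 - w ^ j * x * q ^ k) \<longlonglongrightarrow> (\<Prod>j<5. qpoch (w ^ j * x) q)"
    by (intro tendsto_prod qpoch_LIMSEQ q)
  moreover have "(\<Prod>j<5. \<Prod>k<N. 1 - w ^ j * x * q ^ k) = (\<Prod>k<N. 1 - x ^ 5 * (q ^ 5) ^ k)" for N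
  proof -
    have "(\<Prod>j<5. \<Prod>k<N. 1 - w ^ j * x * q ^ k) = (\<Prod>k<N. \<Prod>j<5. 1 - w ^ j * (x * q ^ k))"
      by (subst prod.swap) (simp add: mult.assoc)
    also have "\<dots> = (\<Prod>k<N. 1 - x ^ 5 * (q ^ 5) ^ k)"
      unfolding prod_fifth_roots[OF w] by (simp add: power_mult_distrib power_mult[symmetric] mult.commute)
    finally show ?thesis .
  qed
  moreover have "(\<lambda>N. \<Prod>k<N. 1 - x ^ 5 * (q ^ 5) ^ k) \<longlonglongrightarrow> qpoch (x ^ 5) (q ^ 5)"
    by (intro qpoch_LIMSEQ q5)
  ultimately show ?thesis using LIMSEQ_unique by simp
qed

text \<open>Split each Euler product by residues modulo 5. In a class prime to 5 the powers of
  \<open>w\<close> run through all fifth roots, and the five products merge into one with base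
  \<open>p^25\<close>; the class 0 does not see \<open>w\<close> and contributes a fifth power. The
  factor in \<open>p^25\<close> completes the merged classes to one more Euler product.\<close>

lemma prod_euler_fifth_roots:
  fixes w p :: "'a::{real_normed_field,banach}"
  assumes w: "w ^ 5 = 1" "w \<noteq> 1" and p: "norm p < 1"
  shows "(\<Prod>j<5. qpoch (w ^ j * p) (w ^ j * p)) * qpoch (p ^ 25) (p ^ 25) = qpoch (p ^ 5) (p ^ 5) ^ 6"
proof -
  have p5: "norm (p ^ 5) < 1" using p by (simp add: norm_power power_less_one_iff)
  have nw: "norm w = 1"
    by (rule norm_fifth_root[OF w(1)])
  have wp: "norm (w ^ j * p) < 1" for j using p nw by (simp add: norm_mult norm_power)
  have wr: "(w ^ r) ^ 5 = 1" "r \<in> {1,2,3,4} \<Longrightarrow> w ^ r \<noteq> 1" for r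
  proof -
    show "(w ^ r) ^ 5 = 1" by (simp only: power_mult[symmetric] mult.commute[of r]) (simp only: power_mult w(1) power_one)
    assume "r \<in> {1,2,3,4}"
    hence "r = 1 \<or> r = 2 \<or> r = 3 \<or> r = 4" by simp
    thus "w ^ r \<noteq> 1" using w(2) fifth_root_powers[OF w] by (elim disjE) (simp_all only: power_one_right not_False_eq_True)
  qed
  have "qpoch (w ^ j * p) (w ^ j * p) = (\<Prod>r<5. qpoch ((w ^ Suc r) ^ j * p ^ Suc r) (p ^ 5))" for j
  proof -
    have "qpoch (w ^ j * p) (w ^ j * p) = (\<Prod>r<5. qpoch ((w ^ j * p) * (w ^ j * p) ^ r) ((w ^ j * p) ^ 5))"
      by (rule qpoch_dissect) (use wp in auto)
    moreover have "(w ^ j * p) ^ 5 = p ^ 5" by (simp add: power_mult_distrib wr)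
    moreover have "(w ^ j * p) * (w ^ j * p) ^ r = (w ^ Suc r) ^ j * p ^ Suc r" for r
    proof -
      have "(w ^ j * p) * (w ^ j * p) ^ r = (w ^ j * p) ^ Suc r" by simp
      also have "\<dots> = (w ^ Suc r) ^ j * p ^ Suc r"
        by (simp only: power_mult_distrib power_mult[symmetric] mult.commute[of j])
      finally show ?thesis .
    qed
    ultimately show ?thesis by simp
  qed
  hence "(\<Prod>j<5. qpoch (w ^ j * p) (w ^ j * p)) = (\<Prod>j<5. \<Prod>r<5. qpoch ((w ^ Suc r) ^ j * p ^ Suc r) (p ^ 5))"
    by (rule prod.cong[OF refl])
  also have "\<dots> = (\<Prod>r<5. \<Prod>j<5. qpoch ((w ^ Suc r) ^ j * p ^ Suc r) (p ^ 5))"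
    by (rule prod.swap)
  finally have "(\<Prod>j<5. qpoch (w ^ j * p) (w ^ j * p)) = \<dots>" .
  also have "\<dots> = (\<Prod>r<4. \<Prod>j<5. qpoch ((w ^ Suc r) ^ j * p ^ Suc r) (p ^ 5)) * (\<Prod>j<5::nat. qpoch (p ^ 5) (p ^ 5))"
  proof -
    have "{..<5::nat} = {..<Suc 4}" by simp
    hence "(\<Prod>r<5. \<Prod>j<5. qpoch ((w ^ Suc r) ^ j * p ^ Suc r) (p ^ 5))
        = (\<Prod>r<4. \<Prod>j<5. qpoch ((w ^ Suc r) ^ j * p ^ Suc r) (p ^ 5)) * (\<Prod>j<5::nat. qpoch ((w ^ Suc 4) ^ j * p ^ Suc 4) (p ^ 5))"
      by (simp only: prod.lessThan_Suc)
    moreover have "(w ^ Suc 4) ^ j * p ^ Suc 4 = p ^ 5" for j using w by (simp add: eval_nat_numeral)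
    ultimately show ?thesis by (simp only:)
  qed
  also have "(\<Prod>r<4. \<Prod>j<5. qpoch ((w ^ Suc r) ^ j * p ^ Suc r) (p ^ 5)) = (\<Prod>r<4. qpoch ((p ^ Suc r) ^ 5) ((p ^ 5) ^ 5))"
  proof (rule prod.cong[OF refl])
    fix r :: nat assume "r \<in> {..<4}"
    hence "Suc r \<in> {1,2,3,4}" by auto
    thus "(\<Prod>j<5. qpoch ((w ^ Suc r) ^ j * p ^ Suc r) (p ^ 5)) = qpoch ((p ^ Suc r) ^ 5) ((p ^ 5) ^ 5)"
      by (intro prod_qpoch_fifth_roots wr p5)
  qed
  also have "(\<Prod>j<5::nat. qpoch (p ^ 5) (p ^ 5)) = qpoch (p ^ 5) (p ^ 5) ^ 5" by simp
  finally have 1: "(\<Prod>j<5. qpoch (w ^ j * p) (w ^ j * p)) = (\<Prod>r<4. qpoch ((p ^ Suc r) ^ 5) ((p ^ 5) ^ 5)) * qpoch (p ^ 5) (p ^ 5) ^ 5" .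
  have "qpoch (p ^ 5) (p ^ 5) = (\<Prod>r<5. qpoch (p ^ 5 * (p ^ 5) ^ r) ((p ^ 5) ^ 5))"
    by (rule qpoch_dissect) (use p5 in auto)
  also have "\<dots> = (\<Prod>r<5. qpoch ((p ^ Suc r) ^ 5) ((p ^ 5) ^ 5))"
  proof (rule prod.cong[OF refl])
    fix r
    have "(p ^ Suc r) ^ 5 = (p ^ 5) ^ Suc r"
      by (simp only: power_mult[symmetric] mult.commute[of "Suc r"])
    thus "qpoch (p ^ 5 * (p ^ 5) ^ r) ((p ^ 5) ^ 5) = qpoch ((p ^ Suc r) ^ 5) ((p ^ 5) ^ 5)"
      by (simp only: power_Suc)
  qed
  also have "\<dots> = (\<Prod>r<4. qpoch ((p ^ Suc r) ^ 5) ((p ^ 5) ^ 5)) * qpoch ((p ^ 5) ^ 5) ((p ^ 5) ^ 5)"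
  proof -
    have "{..<5::nat} = {..<Suc 4}" by simp
    moreover have "p ^ Suc 4 = p ^ 5" by (simp add: eval_nat_numeral)
    ultimately show ?thesis by (simp only: prod.lessThan_Suc)
  qed
  also have "(p ^ 5) ^ 5 = p ^ 25" by (simp add: power_mult[symmetric])
  finally have 2: "qpoch (p ^ 5) (p ^ 5) = (\<Prod>r<4. qpoch ((p ^ Suc r) ^ 5) (p ^ 25)) * qpoch (p ^ 25) (p ^ 25)" .
  have 3: "(p ^ 5) ^ 5 = p ^ 25" by (simp add: power_mult[symmetric])
  have 4: "E * F ^ 5 * G = F ^ 6" if "F = E * G" for E F G :: 'a
  proof -
    have "E * F ^ 5 * G = F ^ 5 * (E * G)" by (simp only: mult_ac)
    also have "\<dots> = F ^ 5 * F" using that by simp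
    also have "\<dots> = F ^ 6" by (simp add: power_numeral_reduce mult_ac)
    finally show ?thesis .
  qed
  show ?thesis unfolding 1 3 by (rule 4[OF 2])
qed

lemma tri_reflect: "tri (1 - j) = tri j"
  by (rule triI) (use two_tri[of j] in \<open>simp add: algebra_simps\<close>)

text \<open>Splitting the theta series by residues mod 5: the class 3 cancels, and the others pair up into \<open>thA\<close> and \<open>thB\<close>.\<close>

lemma theta_fifth_root:
  fixes w p :: "'a::{real_normed_field,banach}"
  assumes w: "w ^ 5 = 1" "w \<noteq> 1" and p: "norm p < 1" "p \<noteq> 0"
  shows "thA (p^5) - (1 + w + w ^ 4) * p * thB (p^5) = qpoch p p * qpoch (w * p) p * qpoch (w ^ 4 * p) p"
proof -
  have w0: "w \<noteq> 0" using w by auto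
  define f where "f = (\<lambda>j. (-w) powi j * p ^ tri j)"
  have sm: "f abs_summable_on UNIV" unfolding f_def by (rule abs_summable_theta[OF p(1)])
  have sg: "(-w) powi (5 * k + int r) = (-1) powi k * (-w) ^ r" for k r
  proof -
    have "(-w) powi (5 * k + int r) = ((-w) powi 5) powi k * (-w) powi int r"
      using w0 by (simp add: power_int_add power_int_mult)
    also have "(-w) powi 5 = -1" using w(1) by (simp add: power_minus_odd)
    finally show ?thesis by simp
  qed
  have p5: "(p ^ 5) ^ n = p ^ (5 * n)" for n by (simp add: power_mult)
  have t0: "tri (5 * k) = 5 * eA (-k)" for k
    by (rule triI) (use two_eA[of "-k"] in \<open>simp add: algebra_simps\<close>)
  have t1: "tri (5 * k + 1) = 5 * eA k" for k
    by (rule triI) (use two_eA[of k] in \<open>simp add: algebra_simps\<close>)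
  have t2: "tri (5 * k + 2) = Suc (5 * eB k)" for k
    by (rule triI) (use two_eB[of k] in \<open>simp add: algebra_simps\<close>)
  have s0: "(\<Sum>\<^sub>\<infinity>k. f (5 * k)) = thA (p^5)"
  proof -
    have 1: "(\<Sum>\<^sub>\<infinity>k. f (5 * k)) = (\<Sum>\<^sub>\<infinity>k. f (5 * (-k)))"
      by (rule infsum_reindex_bij_witness[of _ uminus uminus]) auto
    have 2: "f (5 * (-k)) = (-1) powi k * (p^5) ^ eA k" for k
      using sg[of "-k" 0] t0[of "-k"] by (simp add: f_def p5 sign_minus)
    show ?thesis unfolding 1 2 thA_def ..
  qed
  have s1: "(\<Sum>\<^sub>\<infinity>k. f (5 * k + 1)) = - w * thA (p^5)"
  proof -
    have "f (5 * k + 1) = (- w) * ((-1) powi k * (p^5) ^ eA k)" for k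
      using sg[of k 1] t1[of k] by (simp add: f_def p5)
    thus ?thesis by (simp only: infsum_cmult_right' thA_def)
  qed
  have s2: "(\<Sum>\<^sub>\<infinity>k. f (5 * k + 2)) = w ^ 2 * p * thB (p^5)"
  proof -
    have "f (5 * k + 2) = (w ^ 2 * p) * ((-1) powi k * (p^5) ^ eB k)" for k
      using sg[of k 2] t2[of k] by (simp add: f_def p5)
    thus ?thesis by (simp only: infsum_cmult_right' thB_def)
  qed
  have s3: "(\<Sum>\<^sub>\<infinity>k. f (5 * k + 3)) = 0"
  proof -
    have e: "f (5 * (-1 - k) + 3) = - f (5 * k + 3)" for k
    proof -
      have "tri (5 * (-1 - k) + 3) = tri (5 * k + 3)"
        using tri_reflect[of "5 * k + 3"] by (simp add: algebra_simps)
      moreover have "(-1::'a) powi (-1 - k) = - ((-1) powi k)"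
        using sign_shift[of "-1-k", where 'a = 'a] sign_minus[of k, where 'a = 'a] by simp
      ultimately show ?thesis using sg[of "-1-k" 3] sg[of k 3] by (simp add: f_def)
    qed
    have "(\<Sum>\<^sub>\<infinity>k. f (5 * k + 3)) = (\<Sum>\<^sub>\<infinity>k. f (5 * (-1 - k) + 3))"
      by (rule infsum_reindex_bij_witness[of _ "\<lambda>k. -1 - k" "\<lambda>k. -1 - k"]) auto
    also have "\<dots> = - (\<Sum>\<^sub>\<infinity>k. f (5 * k + 3))" unfolding e by (rule infsum_uminus)
    finally have "2 * (\<Sum>\<^sub>\<infinity>k. f (5 * k + 3)) = 0" by (simp only: mult_2 add_eq_0_iff2) 
    thus ?thesis by simp
  qed
  have s4: "(\<Sum>\<^sub>\<infinity>k. f (5 * k + 4)) = - (w ^ 4) * p * thB (p^5)"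
  proof -
    have 1: "(\<Sum>\<^sub>\<infinity>k. f (5 * k + 4)) = (\<Sum>\<^sub>\<infinity>k. f (5 * (-1 - k) + 4))"
      by (rule infsum_reindex_bij_witness[of _ "\<lambda>k. -1 - k" "\<lambda>k. -1 - k"]) auto
    have 2: "f (5 * (-1 - k) + 4) = (- (w ^ 4) * p) * ((-1) powi k * (p^5) ^ eB k)" for k
    proof -
      have "tri (5 * (-1 - k) + 4) = Suc (5 * eB k)"
        using tri_reflect[of "5 * k + 2"] t2[of k] by (simp add: algebra_simps)
      moreover have "(-1::'a) powi (-1 - k) = - ((-1) powi k)"
        using sign_shift[of "-1-k", where 'a = 'a] sign_minus[of k, where 'a = 'a] by simp
      ultimately show ?thesis using sg[of "-1-k" 4] by (simp add: f_def p5)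
    qed
    show ?thesis unfolding 1 2 by (simp only: infsum_cmult_right' thB_def)
  qed
  have "infsum f UNIV = (\<Sum>r<5. \<Sum>\<^sub>\<infinity>k. f (int 5 * k + int r))"
    by (rule infsum_int_mod[OF sm]) simp
  also have "\<dots> = thA (p^5) - w * thA (p^5) + w ^ 2 * p * thB (p^5) - w ^ 4 * p * thB (p^5)"
    using s0 s1 s2 s3 s4 by (simp add: eval_nat_numeral lessThan_Suc)
  also have "infsum f UNIV = qpoch p p * qpoch w p * qpoch (p / w) p"
    unfolding f_def by (rule jacobi_triple) (use p w0 in auto)
  also have "p / w = w ^ 4 * p"
    using w w0 by (simp add: field_simps power_numeral_reduce)
  also have "qpoch w p = (1 - w) * qpoch (w * p) p" by (rule qpoch_rec[OF p(1)])
  finally have "(1 - w) * (qpoch p p * qpoch (w * p) p * qpoch (w ^ 4 * p) p)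
     = thA (p^5) - w * thA (p^5) + w ^ 2 * p * thB (p^5) - w ^ 4 * p * thB (p^5)" by (simp add: mult_ac)
  also have "\<dots> = (1 - w) * (thA (p^5) - (1 + w + w ^ 4) * p * thB (p^5))"
    using w(1) by algebra
  finally show ?thesis using w(2) by simp
qed

text \<open>The triple products for \<open>w\<close> and \<open>w^2\<close> supply the factors with
  \<open>w\<close>, \<open>w^4\<close> and with \<open>w^2\<close>, \<open>w^3\<close>. With one of
  the two copies of \<open>qpoch p p\<close> these are all five fifth roots, and they multiply to
  \<open>qpoch (p^5) (p^5)\<close>.\<close>

lemma golden_quadratic:
  fixes w p :: "'a::{real_normed_field,banach}"
  assumes w: "w ^ 5 = 1" "w \<noteq> 1" and p: "norm p < 1" "p \<noteq> 0"
  shows "(thA (p^5) - (1 + w + w ^ 4) * p * thB (p^5)) * (thA (p^5) - (1 + w ^ 2 + w ^ 3) * p * thB (p^5))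
      = qpoch p p * qpoch (p^5) (p^5)"
proof -
  have w2: "(w ^ 2) ^ 5 = 1" "w ^ 2 \<noteq> 1" "(w ^ 2) ^ 4 = w ^ 3"
  proof -
    show "(w ^ 2) ^ 5 = 1" using w(1) by algebra
    show "w ^ 2 \<noteq> 1" by (rule fifth_root_powers[OF w])
    show "(w ^ 2) ^ 4 = w ^ 3" using w(1) by algebra
  qed
  have "(\<Prod>j<5. qpoch (w ^ j * p) p) = qpoch p p * qpoch (w * p) p * qpoch (w ^ 2 * p) p * qpoch (w ^ 3 * p) p * qpoch (w ^ 4 * p) p"
    by (simp add: eval_nat_numeral lessThan_Suc mult_ac)
  hence "qpoch p p * qpoch (w * p) p * qpoch (w ^ 2 * p) p * qpoch (w ^ 3 * p) p * qpoch (w ^ 4 * p) p = qpoch (p^5) (p^5)"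
    using prod_qpoch_fifth_roots[OF w p(1), of p] by simp
  thus ?thesis
    using theta_fifth_root[OF w p] theta_fifth_root[OF w2(1,2) p] unfolding w2(3) by (simp add: mult_ac)
qed

text \<open>As \<open>p^5\<close> is unchanged under \<open>p -> w^j p\<close>, the product over
  \<open>j\<close> keeps \<open>thA\<close> and \<open>thB\<close> fixed and turns each linear form
  into a difference of fifth powers. \<open>c1\<close> and \<open>c2\<close> are the roots of
  \<open>x^2 = x + 1\<close>, so 11 arises as the Lucas number \<open>c1^5 + c2^5\<close>.\<close>

theorem icosahedral_complex:
  fixes w p :: "'a::{real_normed_field,banach}"
  assumes w: "w ^ 5 = 1" "w \<noteq> 1" and p: "norm p < 1" "p \<noteq> 0"
  shows "(thA (p^5) ^ 10 - 11 * p ^ 5 * (thA (p^5) * thB (p^5)) ^ 5 - p ^ 10 * thB (p^5) ^ 10) * qpoch (p ^ 25) (p ^ 25)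
      = qpoch (p^5) (p^5) ^ 11"
proof -
  define A B where "A = thA (p^5)" and "B = thB (p^5)"
  define c1 c2 where "c1 = 1 + w + w ^ 4" and "c2 = 1 + w ^ 2 + w ^ 3"
  have "(w - 1) * (1 + w + w^2 + w^3 + w^4) = 0" using w(1) by algebra
  hence S: "1 + w + w^2 + w^3 + w^4 = 0" using w(2) by simp
  have cs: "c1 + c2 = 1" unfolding c1_def c2_def using S by algebra
  have cp: "c1 * c2 = -1" unfolding c1_def c2_def using S w(1) by algebra
  have nw: "norm w = 1"
    by (rule norm_fifth_root[OF w(1)])
  have wp: "norm (w ^ j * p) < 1" "w ^ j * p \<noteq> 0" "(w ^ j * p) ^ 5 = p ^ 5" for j
  proof -
    show "norm (w ^ j * p) < 1" using p nw by (simp add: norm_mult norm_power)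
    show "w ^ j * p \<noteq> 0" using p nw by auto
    have "(w ^ j) ^ 5 = 1"
      by (simp only: power_mult[symmetric] mult.commute[of j]) (simp only: power_mult w(1) power_one)
    thus "(w ^ j * p) ^ 5 = p ^ 5" by (simp add: power_mult_distrib)
  qed
  have "(\<Prod>j<5. (A - w ^ j * (c1 * p * B)) * (A - w ^ j * (c2 * p * B))) = (\<Prod>j<5. qpoch (w ^ j * p) (w ^ j * p) * qpoch (p^5) (p^5))"
    using golden_quadratic[OF w wp(1,2)] unfolding wp(3) A_def[symmetric] B_def[symmetric] c1_def[symmetric] c2_def[symmetric]
    by (intro prod.cong) (simp_all add: mult_ac)
  hence "(A ^ 5 - (c1 * p * B) ^ 5) * (A ^ 5 - (c2 * p * B) ^ 5) = (\<Prod>j<5. qpoch (w ^ j * p) (w ^ j * p)) * qpoch (p^5) (p^5) ^ 5"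
    unfolding prod.distrib prod_fifth_roots[OF w] by simp
  hence "(A ^ 5 - (c1 * p * B) ^ 5) * (A ^ 5 - (c2 * p * B) ^ 5) * qpoch (p^25) (p^25)
     = ((\<Prod>j<5. qpoch (w ^ j * p) (w ^ j * p)) * qpoch (p^25) (p^25)) * qpoch (p^5) (p^5) ^ 5"
    by (simp add: mult_ac)
  also have "\<dots> = qpoch (p^5) (p^5) ^ 11"
    unfolding prod_euler_fifth_roots[OF w p(1)] by (simp flip: power_add)
  also have "(A ^ 5 - (c1 * p * B) ^ 5) * (A ^ 5 - (c2 * p * B) ^ 5) = A ^ 10 - 11 * p ^ 5 * (A * B) ^ 5 - p ^ 10 * B ^ 10"
  proof -
    have "c1 ^ 5 + c2 ^ 5 = 11" "c1 ^ 5 * c2 ^ 5 = -1" using cs cp by algebra+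
    moreover have "p ^ 10 = (p ^ 5)\<^sup>2" "A ^ 10 = (A ^ 5)\<^sup>2" "B ^ 10 = (B ^ 5)\<^sup>2"
      by (simp_all flip: power_mult)
    moreover have "(X - a * P * Y) * (X - b * P * Y) = X\<^sup>2 - 11 * P * (X * Y) - P\<^sup>2 * Y\<^sup>2"
      if "a + b = 11" "a * b = -1" for X a b P Y :: 'a
    proof -
      have "(X - a * P * Y) * (X - b * P * Y) = X\<^sup>2 - (a + b) * P * (X * Y) + (a * b) * P\<^sup>2 * Y\<^sup>2"
        by (simp add: algebra_simps power2_eq_square)
      thus ?thesis unfolding that by simp
    qed
    ultimately show ?thesis unfolding power_mult_distrib by metis
  qed
  finally show ?thesis by (simp add: A_def B_def)
qed

lemma thA_of_real:
  fixes q :: real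
  assumes "\<bar>q\<bar> < 1"
  shows "thA (of_real q) = (of_real (thA q) :: complex)" "thB (of_real q) = (of_real (thB q) :: complex)"
proof -
  have s: "(\<lambda>k. (-1) powi k * q ^ eA k) summable_on UNIV" "(\<lambda>k. (-1) powi k * q ^ eB k) summable_on UNIV"
    using summable_thA[of q] assms by (auto intro: abs_summable_summable)
  have "((\<lambda>k. of_real ((-1) powi k * q ^ eA k) :: complex) has_sum of_real (thA q)) UNIV"
       "((\<lambda>k. of_real ((-1) powi k * q ^ eB k) :: complex) has_sum of_real (thB q)) UNIV"
    unfolding thA_def thB_def by (intro has_sum_of_real has_sum_infsum s)+
  thus "thA (of_real q) = (of_real (thA q) :: complex)" "thB (of_real q) = (of_real (thB q) :: complex)"
    unfolding thA_def thB_def by (auto dest!: infsumI simp: of_real_power_int)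
qed

theorem icosahedral:
  fixes q :: real
  assumes q: "0 < q" "q < 1"
  shows "(thA q ^ 10 - 11 * q * (thA q * thB q) ^ 5 - q\<^sup>2 * thB q ^ 10) * qpoch (q ^ 5) (q ^ 5) = qpoch q q ^ 11"
proof -
  define p where "p = root 5 q"
  have p: "0 < p" "p < 1" "p ^ 5 = q" using q by (auto simp: p_def)
  define w where "w = cis (2 * pi / 5)"
  have "w ^ 5 = cis (real 5 * (2 * pi / 5))" unfolding w_def by (rule Complex.DeMoivre)
  also have "real 5 * (2 * pi / 5) = 2 * pi" by simp
  finally have w: "w ^ 5 = 1" by simp
  have w1: "w \<noteq> 1"
  proof
    assume "w = 1"
    hence "cos (2 * pi / 5) = 1" by (simp add: w_def complex_eq_iff)
    moreover have "cos (2 * pi / 5) < cos 0" by (intro cos_monotone_0_pi) auto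
    ultimately show False by simp
  qed
  have n5: "\<bar>q ^ 5\<bar> < 1" using q by (simp add: power_less_one_iff)
  have pp: "(of_real p :: complex) ^ 5 = of_real q" "(of_real p :: complex) ^ 25 = of_real (q ^ 5)" "(of_real p :: complex) ^ 10 = of_real (q\<^sup>2)"
    unfolding p(3)[symmetric] by (simp_all flip: power_mult)
  have "(of_real (thA q) ^ 10 - 11 * of_real q * (of_real (thA q) * of_real (thB q)) ^ 5 - of_real (q\<^sup>2) * of_real (thB q) ^ 10)
      * of_real (qpoch (q ^ 5) (q ^ 5)) = complex_of_real (qpoch q q) ^ 11"
  proof -
    have "norm (of_real p :: complex) < 1" "(of_real p :: complex) \<noteq> 0" "\<bar>q\<bar> < 1" using p q by auto
    note icosahedral_complex[OF w w1 this(1,2)]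
    thus ?thesis unfolding pp using \<open>\<bar>q\<bar> < 1\<close> by (simp only: thA_of_real qpoch_of_real n5)
  qed
  hence "complex_of_real ((thA q ^ 10 - 11 * q * (thA q * thB q) ^ 5 - q\<^sup>2 * thB q ^ 10) * qpoch (q ^ 5) (q ^ 5)) = of_real (qpoch q q ^ 11)"
    by simp
  thus ?thesis by (simp only: of_real_eq_iff)
qed

section \<open>The Wronskian of the two theta functions\<close>

lemma abs_summable_Times:
  fixes f :: "'a \<Rightarrow> real" and g :: "'b \<Rightarrow> real"
  assumes f: "f abs_summable_on A" and g: "g abs_summable_on B"
  shows "(\<lambda>(x,y). f x * g y) summable_on A \<times> B"
    and "infsum (\<lambda>(x,y). f x * g y) (A \<times> B) = infsum f A * infsum g B"
proof -
  have "(\<lambda>x. norm (f x) * infsum (\<lambda>y. norm (g y)) B) summable_on A"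
    by (intro summable_on_cmult_left f)
  hence m: "(\<lambda>x. norm (infsum (\<lambda>y. norm (f x * g y)) B)) summable_on A"
    by (simp add: abs_mult infsum_cmult_right' infsum_nonneg)
  have "(\<lambda>p. f (fst p) * g (snd p)) abs_summable_on Sigma A (\<lambda>_. B)"
    by (rule iffD2[OF Infinite_Sum.abs_summable_on_Sigma_iff])
       (use m g in \<open>simp add: abs_mult summable_on_cmult_right\<close>)
  hence "(\<lambda>(x,y). f x * g y) abs_summable_on A \<times> B" by (simp add: case_prod_unfold)
  thus s: "(\<lambda>(x,y). f x * g y) summable_on A \<times> B"
    by (rule abs_summable_summable)
  show "infsum (\<lambda>(x,y). f x * g y) (A \<times> B) = infsum f A * infsum g B"
    using infsum_Sigma_banach[OF s] by (simp add: infsum_cmult_right' infsum_cmult_left')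
qed

text \<open>On odd integers this is the nontrivial character modulo 4; as a power of -1 it is easily
  followed through shifts.\<close>

definition chi4 :: "int \<Rightarrow> real" where "chi4 m = (-1) powi ((m - 1) div 2)"

lemma chi4_minus: "odd m \<Longrightarrow> chi4 (-m) = - chi4 m"
proof (elim oddE)
  fix b assume "m = 2 * b + 1"
  moreover have "(- (2 * b + 1) - 1) div 2 = - b - 1" "((2 * b + 1) - 1) div 2 = b" by auto
  moreover have "(-1::real) powi b = - ((-1) powi (- b - 1))"
    using sign_shift[of "-b-1", where 'a = real] sign_minus[of b, where 'a = real] by simp
  ultimately show ?thesis unfolding chi4_def by (simp only: minus_minus)
qed

lemma chi4_add: "odd n \<Longrightarrow> chi4 (m + 2 * n) = - chi4 m"
proof (elim oddE)
  fix c assume n: "n = 2 * c + 1"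
  have "(m + 2 * n - 1) div 2 = (m - 1) div 2 + (2 * c + 1)" unfolding n by auto
  moreover have "(-1::real) powi (x + (2 * c + 1)) = - ((-1) powi x)" for x
    by (simp add: power_int_add power_int_minus_left)
  ultimately show ?thesis by (simp add: chi4_def)
qed

lemma chi4_10: "chi4 (10 * k + 1) = (-1) powi k" "chi4 (10 * l + 3) = - ((-1) powi l)"
proof -
  have 1: "(10 * k + 1 - 1) div 2 = 5 * k" and 2: "(10 * l + 3 - 1) div 2 = 5 * l + 1" by auto
  show "chi4 (10 * k + 1) = (-1) powi k" "chi4 (10 * l + 3) = - ((-1) powi l)"
    unfolding chi4_def 1 2 by (cases "even k"; cases "even l"; simp add: power_int_add power_int_minus_left)+
qed

lemma abs_chi4: "\<bar>chi4 m\<bar> = 1"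
  using norm_sign[where 'a = real] by (simp add: chi4_def)

abbreviation sq :: "int \<Rightarrow> nat" where "sq m \<equiv> nat (m\<^sup>2)"

lemma abs_le_sq: "\<bar>m\<bar> \<le> m\<^sup>2" for m :: int
  using int_square_ge[of m] by (simp add: power2_eq_square)

lemma abs_summable_sq:
  fixes c :: "int \<Rightarrow> real"
  assumes u: "0 < u" "u < 1" and c: "\<And>m. \<bar>c m\<bar> \<le> C * real_of_int (m\<^sup>2) ^ k" and t: "t > 0"
  shows "(\<lambda>m. c m * u ^ (t * sq m)) abs_summable_on A"
proof -
  have e: "\<bar>m\<bar> \<le> int (t * sq m) + int 0" for m
  proof -
    have "1 * m\<^sup>2 \<le> int t * m\<^sup>2" using t by (intro mult_right_mono) auto
    thus ?thesis using abs_le_sq[of m] by simp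
  qed
  have "(\<lambda>m. c m * u ^ (t * sq m)) abs_summable_on UNIV"
  proof (rule abs_summable_qseries[where d = 0 and C = "\<bar>C\<bar>" and D = 0 and k = k, OF _ e])
    fix m
    have "\<bar>c m\<bar> \<le> C * real_of_int (m\<^sup>2) ^ k" by (rule c)
    also have "\<dots> \<le> \<bar>C\<bar> * real_of_int (m\<^sup>2) ^ k" by (intro mult_right_mono) auto
    also have "\<dots> \<le> \<bar>C\<bar> * (0 + real (t * sq m)) ^ k"
    proof (intro mult_left_mono power_mono)
      have "1 * real_of_int (m\<^sup>2) \<le> real t * real_of_int (m\<^sup>2)" using t by (intro mult_right_mono) auto
      thus "real_of_int (m\<^sup>2) \<le> 0 + real (t * sq m)" by simp
    qed auto
    finally show "norm (c m) \<le> \<bar>C\<bar> * (0 + real (t * sq m)) ^ k" by simp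
  qed (use u in auto)
  thus ?thesis using summable_on_subset_banach by blast
qed

text \<open>Moments of a unary theta series over the odd integers. The character being odd, the
  moment of order 0 vanishes, and this removes most terms of the double sums below.\<close>

definition csum :: "nat \<Rightarrow> real \<Rightarrow> nat \<Rightarrow> real" where
  "csum t u j = (\<Sum>\<^sub>\<infinity>m\<in>{m. odd m}. chi4 m * of_int m ^ j * u ^ (t * sq m))"

lemma abs_summable_csum:
  assumes u: "0 < u" "u < 1" and t: "t > 0"
  shows "(\<lambda>m. chi4 m * of_int m ^ j * u ^ (t * sq m)) abs_summable_on A"
proof (rule abs_summable_sq[OF u _ t])
  fix m :: int
  have "\<bar>real_of_int m\<bar> \<le> real_of_int (m\<^sup>2)"
    using abs_le_sq[of m] by (metis of_int_abs of_int_le_iff)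
  hence "\<bar>real_of_int m\<bar> ^ j \<le> real_of_int (m\<^sup>2) ^ j" by (intro power_mono) auto
  thus "\<bar>chi4 m * of_int m ^ j\<bar> \<le> 1 * real_of_int (m\<^sup>2) ^ j"
    by (simp add: abs_mult power_abs abs_chi4)
qed

lemma csum_0: "csum t u 0 = 0"
proof -
  have "csum t u 0 = (\<Sum>\<^sub>\<infinity>m\<in>{m. odd m}. chi4 (-m) * of_int (-m) ^ 0 * u ^ (t * sq (-m)))"
    unfolding csum_def by (rule infsum_reindex_bij_witness[of _ uminus uminus]) auto
  also have "\<dots> = (\<Sum>\<^sub>\<infinity>m\<in>{m. odd m}. - (chi4 m * of_int m ^ 0 * u ^ (t * sq m)))"
    by (rule infsum_cong) (simp add: chi4_minus)
  also have "\<dots> = - csum t u 0" unfolding csum_def by (rule infsum_uminus)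
  finally show ?thesis by simp
qed

text \<open>
  With \<open>q = u^40\<close> the Wronskian is a sum over \<open>a \<equiv> 1\<close>, \<open>b \<equiv> 3\<close> mod 10 of \<open>\<plusminus>(b^2 - a^2) u^(a^2 + b^2)\<close>. Writing
  \<open>a + bi = (1 - 2i)(m + ni)\<close> turns it into a sum over the odd pairs on the line \<open>m + 2n \<equiv> 1\<close> mod 5. Multiplication by \<open>i\<close> permutes the
  four nonzero lines, and the line 0 contributes nothing, so that the Wronskian is a quarter of the sum over all odd pairs.
\<close>

definition wron :: "real \<Rightarrow> int \<times> int \<Rightarrow> real" where
  "wron u = (\<lambda>(m,n). chi4 m * chi4 n * of_int (3 * m\<^sup>2 - 3 * n\<^sup>2 - 8 * m * n) * u ^ (5 * sq m + 5 * sq n))"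

abbreviation odds :: "int set" where "odds \<equiv> {m. odd m}"

definition wline :: "int \<Rightarrow> (int \<times> int) set" where
  "wline c = {(m,n). odd m \<and> odd n \<and> (m + 2 * n) mod 5 = c}"

text \<open>The quadratic coefficient splits the double sum into products of moments. The square
  terms meet a moment of order 0, so only the cross term \<open>- 8 * m * n\<close> remains.\<close>

lemma wron_sum:
  assumes u: "0 < u" "u < 1"
  shows "wron u summable_on odds \<times> odds" "infsum (wron u) (odds \<times> odds) = - 8 * (csum 5 u 1)\<^sup>2"
proof -
  define f where "f j m = chi4 m * of_int m ^ j * u ^ (5 * sq m)" for j m
  have f: "f j abs_summable_on odds" for j
    unfolding f_def by (rule abs_summable_csum[OF u]) simp
  have fs: "infsum (f j) odds = csum 5 u j" for j by (simp add: f_def[abs_def] csum_def)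
  have p: "((\<lambda>(x,y). f i x * f j y) has_sum (csum 5 u i * csum 5 u j)) (odds \<times> odds)" for i j
    using abs_summable_Times[OF f f] by (simp add: has_sum_iff fs)
  have eq: "wron u = (\<lambda>z. 3 * (case z of (x,y) \<Rightarrow> f 2 x * f 0 y) + (-3) * (case z of (x,y) \<Rightarrow> f 0 x * f 2 y)
      + (-8) * (case z of (x,y) \<Rightarrow> f 1 x * f 1 y))"
    by (auto simp: fun_eq_iff wron_def f_def algebra_simps power_add)
  have "(wron u has_sum (3 * (csum 5 u 2 * csum 5 u 0) + (-3) * (csum 5 u 0 * csum 5 u 2) + (-8) * (csum 5 u 1 * csum 5 u 1))) (odds \<times> odds)"
    unfolding eq by (intro has_sum_add has_sum_cmult_right p)
  thus "wron u summable_on odds \<times> odds" "infsum (wron u) (odds \<times> odds) = - 8 * (csum 5 u 1)\<^sup>2"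
    by (auto simp: has_sum_iff csum_0 power2_eq_square)
qed

lemma wron_lines:
  assumes u: "0 < u" "u < 1"
  shows "infsum (wron u) (odds \<times> odds) = (\<Sum>c\<in>{0..4}. infsum (wron u) (wline c))"
proof -
  have "odds \<times> odds = (\<Union>c\<in>{0..4}. wline c)"
  proof safe
    fix m n :: int assume "odd m" "odd n"
    moreover have "(m + 2 * n) mod 5 \<in> {0..4}" using pos_mod_bound[of 5 "m+2*n"] pos_mod_sign[of 5 "m+2*n"] by auto
    ultimately show "(m, n) \<in> (\<Union>c\<in>{0..4}. wline c)" by (auto simp: wline_def)
  qed (auto simp: wline_def)
  moreover have "wron u summable_on wline c" for c
    by (rule summable_on_subset_banach[OF wron_sum(1)[OF u]]) (auto simp: wline_def)
  hence "((wron u) has_sum (\<Sum>c\<in>{0..4}. infsum (wron u) (wline c))) (\<Union>c\<in>{0..4}. wline c)"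
    by (intro sum_has_sum has_sum_infsum) (auto simp: wline_def)
  ultimately show ?thesis by (simp add: infsumI)
qed

text \<open>The rotation sends \<open>m + 2 n\<close> to \<open>- n + 2 m\<close>, which is its
  double modulo 5, and 2 generates the nonzero residues. Both the quadratic form and the product of
  the characters change sign, so \<open>wron u\<close> is invariant.\<close>

lemma wline_rot: "c \<in> {0..4} \<Longrightarrow> infsum (wron u) (wline c) = infsum (wron u) (wline ((2 * c) mod 5))"
proof (rule infsum_reindex_bij_witness[of _ "\<lambda>(m,n). (n, -m)" "\<lambda>(m,n). (-n, m)"])
  show "(case z of (m,n) \<Rightarrow> (-n, m)) \<in> wline ((2 * c) mod 5)" if "z \<in> wline c" for z
  proof -
    obtain m n where z: "z = (m,n)" by force
    have o: "odd m" "odd n" and c: "(m + 2 * n) mod 5 = c" using that by (auto simp: z wline_def)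
    define t where "t = (m + 2 * n) div 5"
    have "m + 2 * n = 5 * t + c" unfolding t_def c[symmetric] by simp
    hence "-n + 2 * m = 5 * (2 * t - n) + 2 * c" by (simp add: algebra_simps)
    hence "(-n + 2 * m) mod 5 = (2 * c) mod 5" by (simp only: mod_mult_self4)
    thus ?thesis using o unfolding z prod.case wline_def by simp
  qed
  show "(case z of (m,n) \<Rightarrow> (n, -m)) \<in> wline c" if c: "c \<in> {0..4}" and "z \<in> wline ((2 * c) mod 5)" for z
  proof -
    obtain m n where z: "z = (m,n)" by force
    have "(m + 2 * n) mod 5 = (2 * c) mod 5" "odd m" "odd n" using that by (auto simp: z wline_def)
    then obtain t where "m + 2 * n - 2 * c = 5 * t" by (auto simp: mod_eq_dvd_iff elim!: dvdE)
    hence "n + 2 * (-m) = 5 * (n - 2 * t - c) + c" by (simp add: algebra_simps)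
    hence "(n + 2 * (-m)) mod 5 = c mod 5" by (simp only: mod_mult_self4)
    hence "(n + 2 * (-m)) mod 5 = c" using c by simp
    thus ?thesis using \<open>odd m\<close> \<open>odd n\<close> unfolding z prod.case wline_def by simp
  qed
  show "wron u (case z of (m,n) \<Rightarrow> (-n, m)) = wron u z" if "z \<in> wline c" for z
  proof -
    obtain m n where z: "z = (m,n)" by force
    have "odd n" using that by (auto simp: z wline_def)
    thus ?thesis unfolding z prod.case wron_def by (simp add: chi4_minus algebra_simps)
  qed
qed (auto simp: wline_def)

text \<open>On this line \<open>m + n i\<close> is divisible by \<open>1 + 2 i\<close>, with
  quotient \<open>c + d i\<close>. In \<open>c\<close> and \<open>d\<close> the form has no cross
  term, so each product contains a moment of order 0.\<close>

lemma wline_0: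
  assumes u: "0 < u" "u < 1"
  shows "infsum (wron u) (wline 0) = 0"
proof -
  define f where "f j m = chi4 m * of_int m ^ j * u ^ (25 * sq m)" for j m
  have f: "f j abs_summable_on odds" for j
    unfolding f_def by (rule abs_summable_csum[OF u]) simp
  have fs: "infsum (f j) odds = csum 25 u j" for j by (simp add: f_def[abs_def] csum_def)
  have p: "((\<lambda>(x,y). f i x * f j y) has_sum (csum 25 u i * csum 25 u j)) (odds \<times> odds)" for i j
    using abs_summable_Times[OF f f] by (simp add: has_sum_iff fs)
  define F where "F z = (-25) * (case z of (x,y) \<Rightarrow> f 2 x * f 0 y) + 25 * (case z of (x,y) \<Rightarrow> f 0 x * f 2 y)" for z
  define i :: "int \<times> int \<Rightarrow> int \<times> int" where "i = (\<lambda>(c,d). (c - 2 * d, 2 * c + d))"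
  define j :: "int \<times> int \<Rightarrow> int \<times> int" where "j = (\<lambda>(m,n). ((m + 2 * n) div 5, (n - 2 * m) div 5))"
  have "infsum (wron u) (wline 0) = infsum F (odds \<times> odds)"
  proof (rule infsum_reindex_bij_witness[of _ i j])
    fix z assume "z \<in> wline 0"
    then obtain m n where z: "z = (m,n)" "odd m" "odd n" "(m + 2 * n) mod 5 = 0" by (auto simp: wline_def)
    then obtain c where c: "m + 2 * n = 5 * c" by (auto elim!: dvdE simp: mod_eq_0_iff_dvd)
    define d where "d = n - 2 * c"
    have n: "n = 2 * c + d" and m: "m = c - 2 * d" and nm: "n - 2 * m = 5 * d"
      using c by (auto simp: d_def)
    have od: "odd c" "odd d" using z(2,3) n m by auto
    have jz: "j z = (c, d)" using c nm by (simp add: j_def z(1))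
    show "i (j z) = z" unfolding jz by (simp add: i_def z(1) m n)
    show "j z \<in> odds \<times> odds" unfolding jz using od by simp
    have "chi4 m = - chi4 c" using chi4_add[of "-d" c] od m by simp
    moreover have "chi4 n = - chi4 d" using chi4_add[of c d] od n by (simp add: add.commute)
    moreover have "3 * m\<^sup>2 - 3 * n\<^sup>2 - 8 * m * n = -25 * c\<^sup>2 + 25 * d\<^sup>2" unfolding m n by algebra
    moreover have "5 * sq m + 5 * sq n = 25 * sq c + 25 * sq d"
    proof -
      have "5 * m\<^sup>2 + 5 * n\<^sup>2 = 25 * c\<^sup>2 + 25 * d\<^sup>2" unfolding m n by algebra
      thus ?thesis by (simp add: nat_eq_iff flip: int_int_eq)
    qed
    ultimately have "wron u (m,n) = chi4 c * chi4 d * of_int (-25 * c\<^sup>2 + 25 * d\<^sup>2) * u ^ (25 * sq c + 25 * sq d)"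
      unfolding wron_def prod.case by simp
    thus "F (j z) = wron u z"
      unfolding jz unfolding z(1) F_def prod.case by (simp add: f_def algebra_simps power_add)
  next
    fix z assume "z \<in> odds \<times> odds"
    then obtain c d where z: "z = (c,d)" "odd c" "odd d" by auto
    have e: "(c - 2 * d) + 2 * (2 * c + d) = 5 * c" "(2 * c + d) - 2 * (c - 2 * d) = 5 * d" by auto
    have iz: "i z = (c - 2 * d, 2 * c + d)" by (simp add: i_def z(1))
    show "j (i z) = z" unfolding iz j_def prod.case e by (simp add: z(1))
    show "i z \<in> wline 0" unfolding iz wline_def using z e by simp
  qed
  also have "\<dots> = (-25) * (csum 25 u 2 * csum 25 u 0) + 25 * (csum 25 u 0 * csum 25 u 2)"
    unfolding F_def by (intro infsumI has_sum_add has_sum_cmult_right p)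
  also have "\<dots> = 0" by (simp add: csum_0)
  finally show ?thesis .
qed

definition rterm :: "int \<Rightarrow> real \<Rightarrow> nat \<Rightarrow> int \<Rightarrow> real" where
  "rterm c u j k = (-1) powi k * of_int (10 * k + c) ^ j * u ^ sq (10 * k + c)"

lemma abs_summable_rterm:
  assumes u: "0 < u" "u < 1"
  shows "rterm 1 u j abs_summable_on UNIV" "rterm 3 u j abs_summable_on UNIV"
proof -
  have s: "(\<lambda>k. norm (chi4 (10 * k + c) * of_int (10 * k + c) ^ j * u ^ (1 * sq (10 * k + c)))) summable_on UNIV" for c
  proof -
    have "inj (\<lambda>k. 10 * k + c)" by (auto simp: inj_def)
    thus ?thesis using abs_summable_csum[OF u, of 1 j "range (\<lambda>k. 10 * k + c)"]
      unfolding summable_on_reindex[OF \<open>inj _\<close>] o_def by simp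
  qed
  show "rterm 1 u j abs_summable_on UNIV" "rterm 3 u j abs_summable_on UNIV"
    using s[of 1] s[of 3] unfolding chi4_10 by (simp_all add: rterm_def abs_mult)
qed

text \<open>The new coordinates are the real and imaginary parts of
  \<open>(1 - 2 i) (m + n i)\<close>. For odd \<open>m\<close>, \<open>n\<close> on this line they
  are congruent to 1 and 3 modulo 10, and the form becomes the difference of their squares.\<close>

lemma wline_1:
  assumes u: "0 < u" "u < 1"
  shows "infsum (wron u) (wline 1) = infsum (rterm 1 u 2) UNIV * infsum (rterm 3 u 0) UNIV
    - infsum (rterm 1 u 0) UNIV * infsum (rterm 3 u 2) UNIV"
proof -
  define f g where "f = rterm 1 u" and "g = rterm 3 u"
  have p: "((\<lambda>(x,y). f i x * g j y) has_sum (infsum (f i) UNIV * infsum (g j) UNIV)) (UNIV \<times> UNIV)" for i j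
    using abs_summable_Times[OF abs_summable_rterm[OF u]] by (simp add: has_sum_iff f_def g_def)
  define F where "F z = (case z of (x,y) \<Rightarrow> f 2 x * g 0 y) + (-1) * (case z of (x,y) \<Rightarrow> f 0 x * g 2 y)" for z
  define i :: "int \<times> int \<Rightarrow> int \<times> int" where "i = (\<lambda>(k,l). (2 * k - 4 * l - 1, 4 * k + 2 * l + 1))"
  define j :: "int \<times> int \<Rightarrow> int \<times> int" where "j = (\<lambda>(m,n). ((m + 2 * n - 1) div 10, (n - 2 * m - 3) div 10))"
  have "infsum (wron u) (wline 1) = infsum F (UNIV \<times> UNIV)"
  proof (rule infsum_reindex_bij_witness[of _ i j])
    fix z assume "z \<in> wline 1"
    then obtain m n where z: "z = (m,n)" "odd m" "odd n" "(m + 2 * n) mod 5 = 1" by (auto simp: wline_def)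
    define k l where "k = (m + 2 * n - 1) div 10" and "l = (n - 2 * m - 3) div 10"
    have a: "m + 2 * n = 10 * k + 1" using z unfolding k_def by presburger
    have b: "n - 2 * m = 10 * l + 3" using z unfolding l_def by presburger
    have m: "m = 2 * k - 4 * l - 1" and n: "n = 4 * k + 2 * l + 1" using a b by auto
    have jz: "j z = (k, l)" by (simp add: j_def z(1) k_def l_def)
    show "i (j z) = z" unfolding jz by (simp add: i_def z(1) m n)
    have "chi4 m = - ((-1) powi k)" using chi4_add[of n m] z a by (simp add: chi4_10)
    moreover have "chi4 n = (-1) powi l" using chi4_add[of "-m" n] z b by (simp add: chi4_10)
    moreover have "3 * m\<^sup>2 - 3 * n\<^sup>2 - 8 * m * n = (10 * l + 3)\<^sup>2 - (10 * k + 1)\<^sup>2" unfolding m n by algebra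
    moreover have "5 * sq m + 5 * sq n = sq (10 * k + 1) + sq (10 * l + 3)"
    proof -
      have "5 * m\<^sup>2 + 5 * n\<^sup>2 = (10 * k + 1)\<^sup>2 + (10 * l + 3)\<^sup>2" unfolding m n by algebra
      thus ?thesis by (simp add: nat_eq_iff flip: int_int_eq)
    qed
    ultimately have "wron u (m,n) = - ((-1) powi k) * (-1) powi l * of_int ((10 * l + 3)\<^sup>2 - (10 * k + 1)\<^sup>2) * u ^ (sq (10 * k + 1) + sq (10 * l + 3))"
      unfolding wron_def prod.case by simp
    thus "F (j z) = wron u z"
      unfolding jz unfolding z(1) F_def prod.case by (simp add: f_def g_def rterm_def algebra_simps power_add del: of_int_add of_int_mult)
  next
    fix z :: "int \<times> int"
    obtain k l where z: "z = (k,l)" by force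
    have e: "(2 * k - 4 * l - 1) + 2 * (4 * k + 2 * l + 1) = 10 * k + 1" "(4 * k + 2 * l + 1) - 2 * (2 * k - 4 * l - 1) = 10 * l + 3" by auto
    have iz: "i z = (2 * k - 4 * l - 1, 4 * k + 2 * l + 1)" by (simp add: i_def z)
    show "j (i z) = z" unfolding iz j_def prod.case e by (simp add: z)
    have "(10 * k + 1) mod 5 = 1" by presburger
    thus "i z \<in> wline 1" unfolding iz wline_def mem_Collect_eq prod.case e by simp
  qed auto
  also have "\<dots> = infsum (f 2) UNIV * infsum (g 0) UNIV + (-1) * (infsum (f 0) UNIV * infsum (g 2) UNIV)"
    unfolding F_def by (intro infsumI has_sum_add has_sum_cmult_right p)
  finally show ?thesis by (simp add: f_def g_def)
qed

text \<open>Completing the square gives \<open>u^((10k+c)^2) = u^(c^2) q^(e k)\<close>, so the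
  second moment amounts to applying \<open>40 q d/dq + c^2\<close>.\<close>

lemma rterm_moments:
  fixes e :: "int \<Rightarrow> nat" and c :: int
  assumes u: "u ^ 40 = q" and e: "\<And>k. (10 * k + c)\<^sup>2 = 40 * int (e k) + c\<^sup>2"
    and S: "((\<lambda>k. (-1) powi k * q ^ e k) has_sum S) UNIV"
    and S': "((\<lambda>k. (-1) powi k * real (e k) * q ^ (e k - 1)) has_sum S') UNIV"
  shows "infsum (rterm c u 0) UNIV = u ^ sq c * S"
    and "infsum (rterm c u 2) UNIV = u ^ sq c * (40 * q * S' + of_int (c\<^sup>2) * S)"
proof -
  have pw: "u ^ sq (10 * k + c) = u ^ sq c * q ^ e k" for k
  proof -
    have "sq (10 * k + c) = 40 * e k + sq c" unfolding e by (simp add: nat_add_distrib)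
    thus ?thesis unfolding u[symmetric] by (simp add: power_add power_mult)
  qed
  have "rterm c u 0 = (\<lambda>k. u ^ sq c * ((-1) powi k * q ^ e k))"
    unfolding rterm_def pw by (simp add: fun_eq_iff)
  thus "infsum (rterm c u 0) UNIV = u ^ sq c * S"
    using infsumI[OF has_sum_cmult_right[OF S, of "u ^ sq c"]] by (simp only:)
  have pred: "real n * q ^ n = q * (real n * q ^ (n - 1))" for n by (cases n) auto
  have "rterm c u 2 k = (u ^ sq c * 40 * q) * ((-1) powi k * real (e k) * q ^ (e k - 1)) + (u ^ sq c * of_int (c\<^sup>2)) * ((-1) powi k * q ^ e k)" for k
  proof -
    have "real_of_int ((10 * k + c)\<^sup>2) = 40 * real (e k) + of_int (c\<^sup>2)"
      by (simp only: e of_int_add of_int_mult of_int_numeral of_int_of_nat_eq)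
    hence "rterm c u 2 k = (-1) powi k * (40 * real (e k) + of_int (c\<^sup>2)) * (u ^ sq c * q ^ e k)"
      unfolding rterm_def pw by (simp only: of_int_power)
    also have "\<dots> = u ^ sq c * 40 * ((-1) powi k * (real (e k) * q ^ e k)) + (u ^ sq c * of_int (c\<^sup>2)) * ((-1) powi k * q ^ e k)"
      by (simp add: algebra_simps)
    finally show ?thesis unfolding pred by (simp add: mult_ac)
  qed
  hence "rterm c u 2 = (\<lambda>k. (u ^ sq c * 40 * q) * ((-1) powi k * real (e k) * q ^ (e k - 1)) + (u ^ sq c * of_int (c\<^sup>2)) * ((-1) powi k * q ^ e k))"
    by (rule ext)
  hence "infsum (rterm c u 2) UNIV = (u ^ sq c * 40 * q) * S' + (u ^ sq c * of_int (c\<^sup>2)) * S"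
    using infsumI[OF has_sum_add[OF has_sum_cmult_right[OF S'] has_sum_cmult_right[OF S]]] by (simp only:)
  thus "infsum (rterm c u 2) UNIV = u ^ sq c * (40 * q * S' + of_int (c\<^sup>2) * S)" by (simp add: algebra_simps)
qed

lemma tri_ge: "\<bar>j\<bar> \<le> int (tri j) + int 1"
proof -
  have "j * (j - 1) \<ge> 2 * \<bar>j\<bar> - 2"
  proof (cases "j \<ge> 1")
    case True
    have "(j - 1) * (j - 2) \<ge> 0" using True by (cases "j = 1") auto
    thus ?thesis using True by (simp add: algebra_simps)
  next
    case False
    hence "j * (j + 1) \<ge> 0" by (cases "j = 0") (auto intro: mult_nonpos_nonpos)
    thus ?thesis using False by (simp add: algebra_simps)
  qed
  thus ?thesis using two_tri[of j] by simp
qed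

text \<open>With \<open>m = 2 j - 1\<close> the exponent \<open>5 m^2\<close> is
  \<open>40 tri j + 5\<close>, and the coefficient \<open>2 j - 1\<close> splits into twice Jacobi's
  series for the cube and the moment of order 0, which vanishes.\<close>

lemma csum_euler_cube:
  assumes u: "0 < u" "u < 1" and q: "u ^ 40 = q"
  shows "csum 5 u 1 = 2 * u ^ 5 * qpoch q q ^ 3"
proof -
  have nq: "norm q < 1" "q \<noteq> 0" unfolding q[symmetric] using u by (auto simp: power_less_one_iff)
  have bij: "bij_betw (\<lambda>j::int. 2 * j - 1) UNIV odds"
    by (rule bij_betw_byWitness[where f' = "\<lambda>m. (m + 1) div 2"]) (auto elim!: oddE)
  have tri: "5 * sq (2 * j - 1) = 40 * tri j + 5" for j
  proof -
    have "5 * (2 * j - 1)\<^sup>2 = 40 * int (tri j) + 5" using two_tri[of j] by (simp add: algebra_simps power2_eq_square)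
    thus ?thesis by (simp flip: int_int_eq)
  qed
  have chi: "chi4 (2 * j - 1) = - ((-1) powi j)" for j
  proof -
    have "(2 * j - 1 - 1) div 2 = j - 1" by simp
    thus ?thesis unfolding chi4_def using sign_shift[of "j - 1", where 'a = real] by simp
  qed
  have trm: "chi4 (2 * j - 1) * of_int (2 * j - 1) ^ i * u ^ (5 * sq (2 * j - 1)) = - (u ^ 5) * ((-1) powi j * of_int (2 * j - 1) ^ i * q ^ tri j)" for i j
    unfolding tri chi q[symmetric] by (simp add: power_add power_mult)
  have cs: "csum 5 u i = - (u ^ 5) * (\<Sum>\<^sub>\<infinity>j. (-1) powi j * of_int (2 * j - 1) ^ i * q ^ tri j)" for i
    unfolding csum_def using infsum_reindex_bij_betw[OF bij, of "\<lambda>m. chi4 m * of_int m ^ i * u ^ (5 * sq m)"]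
    unfolding trm infsum_cmult_right' by simp
  have sj: "(\<lambda>j. of_int j * (-1) powi j * q ^ tri j) abs_summable_on UNIV"
  proof (rule abs_summable_qseries[where d = 1 and C = 1 and D = 1 and k = 1, OF nq(1) tri_ge])
    fix j
    have "real_of_int \<bar>j\<bar> \<le> real_of_int (int (tri j) + int 1)" unfolding of_int_le_iff by (rule tri_ge)
    thus "norm (of_int j * (-1) powi j :: real) \<le> 1 * (1 + real (tri j)) ^ 1"
      by (simp add: abs_mult norm_sign[where 'a = real, simplified])
  qed
  have s0: "(\<Sum>\<^sub>\<infinity>j. (-1) powi j * q ^ tri j) = 0" using cs[of 0] csum_0 u by simp
  have s0s: "(\<lambda>j. (-1) powi j * q ^ tri j) summable_on UNIV"
    using abs_summable_theta[OF nq(1), of "-1"] by (rule abs_summable_summable)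
  have "(\<Sum>\<^sub>\<infinity>j. (-1) powi j * of_int (2 * j - 1) ^ 1 * q ^ tri j)
      = (\<Sum>\<^sub>\<infinity>j. 2 * (of_int j * (-1) powi j * q ^ tri j) + (-1) * ((-1) powi j * q ^ tri j))"
    by (intro infsum_cong) (simp add: algebra_simps)
  also have "\<dots> = 2 * (- (qpoch q q ^ 3)) + (-1) * 0"
    using jacobi_cube[OF nq sj]
    by (intro infsumI has_sum_add has_sum_cmult_right)
       (auto simp: has_sum_iff s0 s0s abs_summable_summable[OF sj])
  finally show ?thesis using cs[of 1] by simp
qed

definition thA' :: "real \<Rightarrow> real" where
  "thA' q = (\<Sum>\<^sub>\<infinity>k. (-1) powi k * real (eA k) * q ^ (eA k - 1))"
definition thB' :: "real \<Rightarrow> real" where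
  "thB' q = (\<Sum>\<^sub>\<infinity>k. (-1) powi k * real (eB k) * q ^ (eB k - 1))"

lemma thA_DERIV:
  assumes "\<bar>q\<bar> < 1"
  shows "(thA has_real_derivative thA' q) (at q)" "(thB has_real_derivative thB' q) (at q)"
  unfolding thA_def[abs_def] thA'_def thB_def[abs_def] thB'_def
  by (rule qseries_has_derivative(1)[where d = 0 and C = 1 and D = 0 and k = 0, OF assms];
      use eA_ge eB_ge in \<open>auto simp: norm_sign[where 'a = real, simplified]\<close>)+

theorem wronskian:
  fixes q :: real
  assumes q: "0 < q" "q < 1"
  shows "thA q * thB q + 5 * q * (thA q * thB' q - thA' q * thB q) = qpoch q q ^ 6"
proof -
  define u where "u = root 40 q"
  have u: "0 < u" "u < 1" "u ^ 40 = q" using q by (auto simp: u_def)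
  have q1: "\<bar>q\<bar> < 1" and nq: "norm q < 1" using q by auto
  have l: "infsum (wron u) (wline 2) = infsum (wron u) (wline 1)"
       "infsum (wron u) (wline 4) = infsum (wron u) (wline 1)" "infsum (wron u) (wline 3) = infsum (wron u) (wline 1)"
    using wline_rot[of 1 u] wline_rot[of 2 u] wline_rot[of 4 u] by auto
  have set: "{0..4::int} = {0,1,2,3,4}" by auto
  have W: "- 8 * (csum 5 u 1)\<^sup>2 = 4 * infsum (wron u) (wline 1)"
    using wron_lines[OF u(1,2)] wron_sum(2)[OF u(1,2)] wline_0[OF u(1,2)] l unfolding set by simp
  have hA: "((\<lambda>k. (-1) powi k * q ^ eA k) has_sum thA q) UNIV" and hB: "((\<lambda>k. (-1) powi k * q ^ eB k) has_sum thB q) UNIV"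
    unfolding thA_def thB_def by (intro has_sum_infsum abs_summable_summable[OF summable_thA(1)[OF nq]] abs_summable_summable[OF summable_thA(2)[OF nq]])+
  note sd = abs_summable_summable[OF qseries_has_derivative(2)[where d = 0 and C = 1 and D = 0 and k = 0, OF q1]]
  have hA': "((\<lambda>k. (-1) powi k * real (eA k) * q ^ (eA k - 1)) has_sum thA' q) UNIV"
    unfolding thA'_def
    by (intro has_sum_infsum sd) (use eA_ge in \<open>auto simp: norm_sign[where 'a = real, simplified]\<close>)
  have hB': "((\<lambda>k. (-1) powi k * real (eB k) * q ^ (eB k - 1)) has_sum thB' q) UNIV"
    unfolding thB'_def
    by (intro has_sum_infsum sd) (use eB_ge in \<open>auto simp: norm_sign[where 'a = real, simplified]\<close>)
  have "(10 * k + 1)\<^sup>2 = 40 * int (eA k) + 1\<^sup>2" "(10 * k + 3)\<^sup>2 = 40 * int (eB k) + 3\<^sup>2" for k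
    using two_eA[of k] two_eB[of k] by (simp_all add: algebra_simps power2_eq_square)
  note M = rterm_moments[OF u(3) this(1) hA hA'] rterm_moments[OF u(3) this(2) hB hB']
  \<comment> \<open>On the left the power of \<open>u\<close> is \<open>1^2 + 3^2\<close> and the
    factor 8 is \<open>3^2 - 1^2\<close>, both from the shifts in the moments.\<close>
  have "u ^ 10 * (8 * (thA q * thB q + 5 * q * (thA q * thB' q - thA' q * thB q))) = u ^ 10 * (8 * qpoch q q ^ 6)"
    using W unfolding wline_1[OF u(1,2)] M csum_euler_cube[OF u] by (simp add: eval_nat_numeral algebra_simps)
  thus ?thesis using u by simp
qed

section \<open>The Rogers--Ramanujan function\<close>

text \<open>Pairing \<open>n\<close> with \<open>- n - 1\<close>, rather than with
  \<open>- n\<close>, produces the factors \<open>1 - q^(4n+2)\<close> and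
  \<open>1 - q^(2n+1)\<close> of Rogers' series.\<close>

lemma sums_int_pair:
  fixes f :: "int \<Rightarrow> real"
  assumes "f abs_summable_on UNIV"
  shows "(\<lambda>n. f (int n) + f (- int n - 1)) sums infsum f UNIV"
proof -
  have s: "f summable_on A" for A
    using abs_summable_summable[OF assms] summable_on_subset_banach by blast
  have U: "(UNIV :: int set) = range int \<union> range (\<lambda>n. - int n - 1)"
  proof -
    have "x \<in> range int \<union> range (\<lambda>n. - int n - 1)" for x
    proof (cases "x \<ge> 0")
      case True thus ?thesis by (auto intro: range_eqI[of _ _ "nat x"])
    next
      case False thus ?thesis by (auto intro: range_eqI[of _ _ "nat (-x-1)"])
    qed
    thus ?thesis by blast
  qed
  have i: "inj int" "inj (\<lambda>n. - int n - 1)" by (auto simp: inj_def)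
  have "((\<lambda>n. f (int n)) has_sum infsum f (range int)) UNIV"
    using has_sum_reindex[OF i(1), of f] has_sum_infsum[OF s[of "range int"]] by (simp add: o_def)
  hence 1: "(\<lambda>n. f (int n)) sums infsum f (range int)" by (rule has_sum_imp_sums)
  have "((\<lambda>n. f (- int n - 1)) has_sum infsum f (range (\<lambda>n. - int n - 1))) UNIV"
    using has_sum_reindex[OF i(2), of f] has_sum_infsum[OF s[of "range (\<lambda>n. - int n - 1)"]] by (simp add: o_def)
  hence 2: "(\<lambda>n. f (- int n - 1)) sums infsum f (range (\<lambda>n. - int n - 1))" by (rule has_sum_imp_sums)
  have "infsum f UNIV = infsum f (range int) + infsum f (range (\<lambda>n. - int n - 1))"
    by (subst U, rule infsum_Un_disjoint) (auto intro: s)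
  thus ?thesis using sums_add[OF 1 2] by simp
qed

context
  fixes q :: real
  assumes q: "0 < q" "q < 1"
begin

lemma thA_eq_rogers: "thA q = rogers_G q 1" "thB q = rogers_H q 1"
proof -
  have nq: "norm q < 1" using q by simp
  have e: "int (e5 n) * 2 = int n * (5 * int n + 1)" for n
  proof -
    have "int (2 * e5 n) = int (n * (5 * n + 1))" by (simp only: two_e5)
    thus ?thesis by (simp add: algebra_simps)
  qed
  have sg: "(-1::real) powi (- int n - 1) = - ((-1) ^ n)" for n
    using sign_shift[of "- int n - 1", where 'a = real] sign_minus[of "int n", where 'a = real] by simp
  have A: "eA (int n) = e5 n" "eA (- int n - 1) = e5 n + (4 * n + 2)" for n
  proof -
    have "int (eA (int n)) = int (e5 n)" "int (eA (- int n - 1)) = int (e5 n + (4 * n + 2))"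
      using two_eA[of "int n"] two_eA[of "- int n - 1"] e[of n] by (simp_all add: algebra_simps)
    thus "eA (int n) = e5 n" "eA (- int n - 1) = e5 n + (4 * n + 2)" by (simp_all only: of_nat_eq_iff)
  qed
  have B: "eB (int n) = e5 n + n" "eB (- int n - 1) = (e5 n + n) + (2 * n + 1)" for n
  proof -
    have "int (eB (int n)) = int (e5 n + n)" "int (eB (- int n - 1)) = int ((e5 n + n) + (2 * n + 1))"
      using two_eB[of "int n"] two_eB[of "- int n - 1"] e[of n] by (simp_all add: algebra_simps)
    thus "eB (int n) = e5 n + n" "eB (- int n - 1) = (e5 n + n) + (2 * n + 1)" by (simp_all only: of_nat_eq_iff)
  qed
  have "(\<lambda>n. (-1) ^ n * q ^ e5 n * (1 - q ^ (4 * n + 2))) sums thA q"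
    using sums_int_pair[OF summable_thA(1)[OF nq]] unfolding A sg thA_def[symmetric] power_add[of q "e5 _"]
    by (simp only: power_int_of_nat) (simp add: algebra_simps)
  thus "thA q = rogers_G q 1" using rogers_at_1(1)[OF q] sums_unique2 by blast
  have "(\<lambda>n. (-1) ^ n * q ^ (e5 n + n) * (1 - q ^ (2 * n + 1))) sums thB q"
    using sums_int_pair[OF summable_thA(2)[OF nq]] unfolding B sg thB_def[symmetric] power_add[of q "e5 _ + _"]
    by (simp only: power_int_of_nat) (simp add: algebra_simps)
  thus "thB q = rogers_H q 1" using rogers_at_1(2)[OF q] sums_unique2 by blast
qed

lemma thA_pos: "thA q > 0" "thB q > 0"
  using rogers_pos[OF q, of 0] thA_eq_rogers by simp_all

lemma RR_eq: "RR q = q powr (1/5) * thB q / thA q"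
  using RR_eq_rogers[OF q] thA_eq_rogers by simp

lemma RR_pos: "RR q > 0"
  unfolding RR_eq using thA_pos q by simp

text \<open>The continued fraction is at least 1. This bound forces \<open>RR q\<close> to 0 with
  \<open>q\<close>, so that \<open>RR\<close> takes all small positive values.\<close>

lemma RR_le: "RR q \<le> q powr (1/5)"
proof -
  have "thB q \<le> thA q"
    using rog_c_ge_1[OF q, of 0] thA_pos unfolding rog_c_def[OF q] thA_eq_rogers by simp
  hence "q powr (1/5) * thB q \<le> q powr (1/5) * thA q" by (intro mult_left_mono) auto
  thus ?thesis unfolding RR_eq using thA_pos by (simp add: divide_simps)
qed

lemma euler_pos: "qpoch q q > 0"
proof -
  have nq: "norm q < 1" using q by simp
  have "qfac q n \<ge> 0" for n
    unfolding qfac_def by (intro prod_nonneg) (use one_minus_pos[OF q] in \<open>auto simp: less_imp_le\<close>)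
  hence "qpoch q q \<ge> 0" using LIMSEQ_le_const[OF qfac_LIMSEQ[OF nq]] by blast
  thus ?thesis using qpoch_self_nonzero[OF nq] by simp
qed

lemma RR_pow5: "RR q ^ 5 = q * thB q ^ 5 / thA q ^ 5"
proof -
  have "(q powr (1/5)) ^ 5 = q" using q by (simp add: powr_power)
  thus ?thesis unfolding RR_eq by (simp add: power_mult_distrib power_divide)
qed

text \<open>The icosahedral relation carries the factor \<open>g\<close>, Euler's product at
  \<open>q^5\<close>. Enlarging the fraction by \<open>A * B = f * g\<close> absorbs it:
  \<open>f^11\<close> becomes \<open>f^12\<close> and the power of \<open>A * B\<close> becomes 6,
  ready for the sixth root.\<close>

lemma RR_icosahedral:
  "1 / RR q ^ 5 - 11 - RR q ^ 5 = qpoch q q ^ 12 / (q * (thA q * thB q) ^ 6)"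
proof -
  define A B f g where "A = thA q" and "B = thB q" and "f = qpoch q q" and "g = qpoch (q^5) (q^5)"
  have pos: "A > 0" "B > 0" "f > 0" using thA_pos euler_pos by (simp_all add: A_def B_def f_def)
  have AB: "A * B = f * g" unfolding A_def B_def f_def g_def using q by (intro thA_times_thB) auto
  have I: "(A ^ 10 - 11 * q * (A * B) ^ 5 - q\<^sup>2 * B ^ 10) * g = f ^ 11"
    unfolding A_def B_def f_def g_def by (rule icosahedral[OF q])
  have "1 / RR q ^ 5 - 11 - RR q ^ 5 = (A ^ 10 - 11 * q * (A * B) ^ 5 - q\<^sup>2 * B ^ 10) / (q * (A * B) ^ 5)"
    unfolding RR_pow5 A_def[symmetric] B_def[symmetric] using pos q
    by (simp add: field_simps power_mult_distrib power2_eq_square flip: power_add)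
  also have "\<dots> = ((A ^ 10 - 11 * q * (A * B) ^ 5 - q\<^sup>2 * B ^ 10) * (A * B)) / (q * (A * B) ^ 6)"
    using pos q by (simp add: divide_simps eval_nat_numeral)
  also have "(A ^ 10 - 11 * q * (A * B) ^ 5 - q\<^sup>2 * B ^ 10) * (A * B) = ((A ^ 10 - 11 * q * (A * B) ^ 5 - q\<^sup>2 * B ^ 10) * g) * f"
    unfolding AB by (simp add: mult_ac)
  also have "\<dots> = f ^ 12" unfolding I by (simp add: eval_nat_numeral)
  finally show ?thesis by (simp add: A_def B_def f_def)
qed

lemma RR_domain_pos: "1 / RR q ^ 5 - 11 - RR q ^ 5 > 0"
  unfolding RR_icosahedral using q thA_pos euler_pos by simp

lemma RR_icosahedral_root:
  "(1 / RR q ^ 5 - 11 - RR q ^ 5) powr (1/6) = qpoch q q ^ 2 / (q powr (1/6) * (thA q * thB q))"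
proof -
  have p: "qpoch q q ^ 2 / (q powr (1/6) * (thA q * thB q)) > 0" (is "?x > 0") using q thA_pos euler_pos by simp
  have "(q powr (1/6)) ^ 6 = q" using q by (simp add: powr_power)
  hence e: "1 / RR q ^ 5 - 11 - RR q ^ 5 = ?x ^ 6"
    unfolding RR_icosahedral by (simp add: power_divide power_mult_distrib flip: power_mult)
  have "?x ^ 6 = ?x powr 6" using powr_realpow[OF p, of 6] by simp
  moreover have "(?x powr 6) powr (1/6) = ?x powr 1" by (simp only: powr_powr) simp
  moreover have "?x powr 1 = ?x" by (intro powr_one less_imp_le p)
  ultimately show ?thesis unfolding e by (simp only:)
qed

lemma RR_DERIV: "(RR has_real_derivative RR q * qpoch q q ^ 6 / (5 * q * (thA q * thB q))) (at q)"
proof -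
  have q1: "\<bar>q\<bar> < 1" using q by simp
  have "((\<lambda>x. x powr (1/5) * thB x / thA x) has_real_derivative
     (((1/5) * q powr (1/5 - 1) * thB q + thB' q * q powr (1/5)) * thA q - q powr (1/5) * thB q * thA' q) / (thA q * thA q)) (at q)"
    using thA_pos q by (auto intro!: derivative_eq_intros thA_DERIV[OF q1])
  also have "q powr (1/5 - 1) = q powr (1/5) / q" using q by (simp only: powr_diff powr_one)
  \<comment> \<open>Once \<open>1 / (5 q)\<close> is extracted, the power
    \<open>q powr (1/5)\<close> contributes \<open>A B\<close> and the quotient rule
    \<open>5 q (A B' - A' B)\<close>.\<close>
  also have "(((1/5) * (q powr (1/5) / q) * thB q + thB' q * q powr (1/5)) * thA q - q powr (1/5) * thB q * thA' q) / (thA q * thA q)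
    = RR q * (thA q * thB q + 5 * q * (thA q * thB' q - thA' q * thB q)) / (5 * q * (thA q * thB q))"
    unfolding RR_eq using q thA_pos by (simp add: field_simps)
  also have "thA q * thB q + 5 * q * (thA q * thB' q - thA' q * thB q) = qpoch q q ^ 6" by (rule wronskian[OF q])
  finally have "((\<lambda>x. x powr (1/5) * thB x / thA x) has_real_derivative RR q * qpoch q q ^ 6 / (5 * q * (thA q * thB q))) (at q)" .
  thus ?thesis
  proof (rule has_field_derivative_transform_within_open)
    show "open {0<..<1::real}" "q \<in> {0<..<1}" using q by auto
  qed (use Submission.RR_eq in auto)
qed

end

lemma RR_strict_mono:
  assumes "0 < p" "p < q" "q < 1"
  shows "RR p < RR q"
proof (rule DERIV_pos_imp_increasing[OF assms(2)])
  fix x assume "p \<le> x" "x \<le> q"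
  hence x: "0 < x" "x < 1" using assms by auto
  have "RR x * qpoch x x ^ 6 / (5 * x * (thA x * thB x)) > 0"
    using x thA_pos[OF x] RR_pos[OF x] euler_pos[OF x] by simp
  thus "\<exists>y. (RR has_real_derivative y) (at x) \<and> 0 < y"
    using RR_DERIV[OF x] by blast
qed

lemma RR_eq_iff: "0 < p \<Longrightarrow> p < 1 \<Longrightarrow> 0 < q \<Longrightarrow> q < 1 \<Longrightarrow> RR p = RR q \<longleftrightarrow> p = q"
  using RR_strict_mono by (metis linorder_neqE_linordered_idom less_irrefl)

section \<open>Theta constants and the elliptic modulus\<close>

text \<open>\<open>jt2\<close> is the classical \<open>theta_2\<close> without its factor \<open>q^(1/4)\<close>.\<close>

definition pron :: "int \<Rightarrow> nat" where "pron n = nat (n\<^sup>2 + n)"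

lemma int_sq: "int (sq n) = n\<^sup>2" by simp

lemma int_pron: "int (pron n) = n\<^sup>2 + n"
  using abs_le_sq[of n] by (simp add: pron_def)

definition jt3 :: "real \<Rightarrow> real" where "jt3 q = (\<Sum>\<^sub>\<infinity>n. q ^ sq n)"
definition jt4 :: "real \<Rightarrow> real" where "jt4 q = jt3 (- q)"
definition jt2 :: "real \<Rightarrow> real" where "jt2 q = (\<Sum>\<^sub>\<infinity>n. q ^ pron n)"

lemma sq_ge: "\<bar>n\<bar> \<le> int (sq n) + int 0"
  using abs_le_sq[of n] by simp

lemma pron_ge: "\<bar>n\<bar> \<le> int (pron n) + int 1"
proof -
  have "n\<^sup>2 + n \<ge> \<bar>n\<bar> - 1"
  proof (cases "n \<ge> 0")
    case True thus ?thesis using zero_le_power2[of n] by linarith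
  next
    case False
    have "(n + 1)\<^sup>2 \<ge> 0" by simp
    thus ?thesis using False by (simp add: power2_eq_square algebra_simps)
  qed
  thus ?thesis using int_pron[of n] by simp
qed

lemma abs_summable_jt:
  assumes "\<bar>q\<bar> < (1::real)"
  shows "(\<lambda>n. q ^ sq n) abs_summable_on A" "(\<lambda>n. q ^ pron n) abs_summable_on A"
proof -
  have "(\<lambda>n. 1 * q ^ sq n) abs_summable_on UNIV"
    by (rule abs_summable_qseries[where d = 0 and C = 1 and D = 0 and k = 0, OF _ sq_ge]) (use assms in auto)
  thus "(\<lambda>n. q ^ sq n) abs_summable_on A" using summable_on_subset_banach by fastforce
  have "(\<lambda>n. 1 * q ^ pron n) abs_summable_on UNIV"
    by (rule abs_summable_qseries[where d = 1 and C = 1 and D = 0 and k = 0, OF _ pron_ge]) (use assms in auto)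
  thus "(\<lambda>n. q ^ pron n) abs_summable_on A" using summable_on_subset_banach by fastforce
qed

section \<open>Product forms of the theta constants\<close>

lemma qpoch_plus_minus:
  fixes a q :: "'a::{real_normed_field,banach}"
  assumes q: "norm q < 1"
  shows "qpoch a q * qpoch (- a) q = qpoch (a\<^sup>2) (q\<^sup>2)"
proof -
  have q2: "norm (q\<^sup>2) < 1" using q by (simp add: norm_power power_less_one_iff)
  have "(\<lambda>N. (\<Prod>k<N. 1 - a * q ^ k) * (\<Prod>k<N. 1 - (- a) * q ^ k)) \<longlonglongrightarrow> qpoch a q * qpoch (- a) q"
    by (intro tendsto_mult qpoch_LIMSEQ q)
  moreover have "(\<Prod>k<N. 1 - a * q ^ k) * (\<Prod>k<N. 1 - (- a) * q ^ k) = (\<Prod>k<N. 1 - a\<^sup>2 * (q\<^sup>2) ^ k)" for N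
    unfolding prod.distrib[symmetric]
    by (rule prod.cong[OF refl]) (simp add: algebra_simps power2_eq_square power_mult_distrib)
  moreover have "(\<lambda>N. \<Prod>k<N. 1 - a\<^sup>2 * (q\<^sup>2) ^ k) \<longlonglongrightarrow> qpoch (a\<^sup>2) (q\<^sup>2)" by (intro qpoch_LIMSEQ q2)
  ultimately show ?thesis using LIMSEQ_unique by simp
qed

lemma jt3_product:
  assumes q: "\<bar>q\<bar> < 1" "q \<noteq> 0"
  shows "jt3 q = qpoch (q\<^sup>2) (q\<^sup>2) * (qpoch (- q) (q\<^sup>2))\<^sup>2"
proof -
  have q2: "norm (q\<^sup>2) < 1" using q by (simp add: power_less_one_iff abs_square_less_1)
  have "(- (- q)) powi j * (q\<^sup>2) ^ tri j = q ^ sq j" for j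
  proof -
    have "(q\<^sup>2) ^ tri j = q powi int (2 * tri j)" by (simp only: power_int_of_nat power_mult)
    hence "q powi j * (q\<^sup>2) ^ tri j = q powi j * q powi (2 * int (tri j))" by simp
    also have "\<dots> = q powi (j + 2 * int (tri j))" using q by (simp add: power_int_add)
    also have "j + 2 * int (tri j) = int (sq j)" using two_tri[of j] by (simp add: algebra_simps power2_eq_square)
    finally show ?thesis by (simp only: minus_minus power_int_of_nat)
  qed
  moreover have "(\<Sum>\<^sub>\<infinity>j. (- (- q)) powi j * (q\<^sup>2) ^ tri j) = qpoch (q\<^sup>2) (q\<^sup>2) * qpoch (- q) (q\<^sup>2) * qpoch (q\<^sup>2 / (- q)) (q\<^sup>2)"
    by (rule jacobi_triple) (use q q2 in auto)
  moreover have "q\<^sup>2 / (- q) = - q" using q by (simp add: power2_eq_square)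
  ultimately show ?thesis unfolding jt3_def by (simp add: power2_eq_square mult_ac)
qed

text \<open>Here \<open>z = -1\<close>; the first factor of \<open>qpoch (- 1) (q\<^sup>2)\<close>
  is the 2 in front.\<close>

lemma jt2_product:
  assumes q: "\<bar>q\<bar> < 1" "q \<noteq> 0"
  shows "jt2 q = 2 * qpoch (q\<^sup>2) (q\<^sup>2) * (qpoch (- (q\<^sup>2)) (q\<^sup>2))\<^sup>2"
proof -
  have q2: "norm (q\<^sup>2) < 1" using q by (simp add: power_less_one_iff abs_square_less_1)
  have e: "(- (- 1)) powi j * (q\<^sup>2) ^ tri j = q ^ pron (j - 1)" for j
  proof -
    have "2 * tri j = pron (j - 1)"
    proof -
      have "int (2 * tri j) = int (pron (j - 1))"
        using two_tri[of j] int_pron[of "j-1"] by (simp add: algebra_simps power2_eq_square)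
      thus ?thesis by (simp only: of_nat_eq_iff)
    qed
    thus ?thesis by (simp flip: power_mult)
  qed
  have "jt2 q = (\<Sum>\<^sub>\<infinity>j. q ^ pron (j - 1))" unfolding jt2_def
    by (rule infsum_reindex_bij_witness[of _ "\<lambda>j. j - 1" "\<lambda>j. j + 1"]) auto
  also have "\<dots> = (\<Sum>\<^sub>\<infinity>j. (- (- 1)) powi j * (q\<^sup>2) ^ tri j)" unfolding e ..
  also have "\<dots> = qpoch (q\<^sup>2) (q\<^sup>2) * qpoch (- 1) (q\<^sup>2) * qpoch (q\<^sup>2 / (- 1)) (q\<^sup>2)"
    by (rule jacobi_triple) (use q q2 in auto)
  also have "qpoch (- 1) (q\<^sup>2) = 2 * qpoch (- (q\<^sup>2)) (q\<^sup>2)"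
    using qpoch_rec[OF q2, of "- 1"] by simp
  finally show ?thesis by (simp add: power2_eq_square mult_ac)
qed

lemma euler_even_odd:
  fixes q :: real
  assumes "\<bar>q\<bar> < 1"
  shows "qpoch q q = qpoch q (q\<^sup>2) * qpoch (q\<^sup>2) (q\<^sup>2)"
  using qpoch_dissect[of q 2 q] assms by (simp add: eval_nat_numeral lessThan_Suc mult_ac)

lemma jt4_euler:
  assumes q: "\<bar>q\<bar> < 1" "q \<noteq> 0"
  shows "jt4 q * qpoch (q\<^sup>2) (q\<^sup>2) = (qpoch q q)\<^sup>2"
  unfolding jt4_def using jt3_product[of "- q"] q euler_even_odd[OF q(1)]
  by (simp add: power2_eq_square mult_ac)

text \<open>The geometric half of the arithmetic-geometric mean step for
  \<open>(jt3 q)\<^sup>2\<close> and \<open>(jt4 q)\<^sup>2\<close>; the arithmetic half is the mean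
  of \<open>jt3_square\<close> and \<open>jt4_square\<close>.\<close>

lemma jt3_jt4:
  assumes q: "\<bar>q\<bar> < 1" "q \<noteq> 0"
  shows "jt3 q * jt4 q = (jt4 (q\<^sup>2))\<^sup>2"
proof -
  have q2: "\<bar>q\<^sup>2\<bar> < 1" using q by (simp add: abs_square_less_1)
  define a b F where "a = qpoch (- q) (q\<^sup>2)" and "b = qpoch q (q\<^sup>2)" and "F = qpoch (q\<^sup>2) (q\<^sup>2)"
  have ab: "a * b = qpoch (q\<^sup>2) ((q\<^sup>2)\<^sup>2)"
    using qpoch_plus_minus[of "q\<^sup>2" q] q2 by (simp only: a_def b_def real_norm_def mult.commute)
  have 3: "jt3 q = F * a\<^sup>2" unfolding a_def F_def by (rule jt3_product[OF q])
  have "\<bar>- q\<bar> < 1" "- q \<noteq> 0" using q by auto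
  from jt3_product[OF this] have 4: "jt4 q = F * b\<^sup>2"
    by (simp only: jt4_def b_def F_def power2_minus minus_minus)
  have "\<bar>- (q\<^sup>2)\<bar> < 1" "- (q\<^sup>2) \<noteq> 0" using q q2 by auto
  from jt3_product[OF this] have 5: "jt4 (q\<^sup>2) = qpoch ((q\<^sup>2)\<^sup>2) ((q\<^sup>2)\<^sup>2) * (a * b)\<^sup>2"
    by (simp only: jt4_def ab power2_minus minus_minus)
  have 6: "F = (a * b) * qpoch ((q\<^sup>2)\<^sup>2) ((q\<^sup>2)\<^sup>2)"
    unfolding F_def ab by (rule euler_even_odd[OF q2])
  have "F * a\<^sup>2 * (F * b\<^sup>2) = F\<^sup>2 * (a * b)\<^sup>2" by (simp add: power2_eq_square mult_ac)
  also have "\<dots> = (qpoch ((q\<^sup>2)\<^sup>2) ((q\<^sup>2)\<^sup>2) * (a * b)\<^sup>2)\<^sup>2"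
    unfolding 6 power_mult_distrib by (simp add: power2_eq_square mult_ac)
  finally show ?thesis unfolding 3 4 5 .
qed

text \<open>The classical \<open>theta_2 theta_3 theta_4 = 2 eta^3\<close>. It rests on Euler's
  theorem on odd and distinct parts, which is \<open>EO\<close>.\<close>

lemma jt_product:
  assumes q: "0 < q" "q < 1"
  shows "jt2 q * jt3 q * jt4 q = 2 * qpoch (q\<^sup>2) (q\<^sup>2) ^ 3"
proof -
  have q1: "\<bar>q\<bar> < 1" "q \<noteq> 0" "norm q < 1" and nz: "qpoch q q \<noteq> 0" using q qpoch_self_nonzero[of q] by auto
  define F E O' where "F = qpoch (q\<^sup>2) (q\<^sup>2)" and "E = qpoch (-q) q" and "O' = qpoch q (q\<^sup>2)"
  have 1: "E = qpoch (-q) (q\<^sup>2) * qpoch (-(q\<^sup>2)) (q\<^sup>2)"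
    unfolding E_def using qpoch_dissect[of q 2 "-q"] q1 by (simp add: eval_nat_numeral lessThan_Suc mult_ac)
  have 2: "qpoch q q * E = F" unfolding E_def F_def by (rule qpoch_plus_minus) (use q1 in auto)
  have 3: "qpoch q q = O' * F" unfolding O'_def F_def by (rule euler_even_odd[OF q1(1)])
  have "F \<noteq> 0" using nz 3 by auto
  hence EO: "E * O' = 1" using 2 3 by (simp add: mult.commute)
  have j2: "jt2 q = 2 * F * (qpoch (- (q\<^sup>2)) (q\<^sup>2))\<^sup>2" unfolding F_def by (rule jt2_product[OF q1(1,2)])
  have j3: "jt3 q = F * (qpoch (-q) (q\<^sup>2))\<^sup>2" unfolding F_def by (rule jt3_product[OF q1(1,2)])
  have "\<bar>- q\<bar> < 1" "- q \<noteq> 0" using q by auto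
  from jt3_product[OF this] have j4: "jt4 q = F * O'\<^sup>2"
    by (simp only: jt4_def O'_def F_def power2_minus minus_minus)
  have "jt2 q * jt3 q * jt4 q = 2 * F ^ 3 * (E * O')\<^sup>2"
    unfolding j2 j3 j4 1 by (simp add: power2_eq_square power3_eq_cube mult_ac)
  thus ?thesis unfolding EO F_def by simp
qed

text \<open>Positivity of the alternating series \<open>jt4\<close> is not visible termwise, so it
  is read off from Euler products; \<open>jt3_jt4\<close> and \<open>jt_product\<close> then pass it
  on to \<open>jt3\<close> and \<open>jt2\<close>.\<close>

lemma jt_pos:
  assumes q: "0 < q" "q < 1"
  shows "jt4 q > 0" "jt3 q > 0" "jt2 q > 0"
proof -
  have p4: "jt4 r > 0" if r: "0 < r" "r < 1" for r
  proof -
    have "0 < r\<^sup>2" "r\<^sup>2 < 1" using r by (auto simp: power_less_one_iff)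
    hence "qpoch (r\<^sup>2) (r\<^sup>2) > 0" by (rule euler_pos)
    moreover have "jt4 r * qpoch (r\<^sup>2) (r\<^sup>2) > 0" using jt4_euler[of r] euler_pos[OF r] r by simp
    ultimately show ?thesis by (simp add: zero_less_mult_iff)
  qed
  show 4: "jt4 q > 0" by (rule p4[OF q])
  have q2: "0 < q\<^sup>2" "q\<^sup>2 < 1" using q by (auto simp: power_less_one_iff)
  have "jt3 q * jt4 q > 0" using jt3_jt4[of q] p4[OF q2] q by simp
  thus 3: "jt3 q > 0" using 4 by (simp add: zero_less_mult_iff)
  have "jt2 q * (jt3 q * jt4 q) > 0" using jt_product[OF q] euler_pos[OF q2] by (simp add: mult.assoc)
  thus "jt2 q > 0" by (rule zero_less_mult_pos2[OF _ mult_pos_pos[OF 3 4]])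
qed

section \<open>Duplication formulas and Jacobi's quartic identity\<close>

lemma parity_split:
  fixes F :: "int \<times> int \<Rightarrow> real"
  assumes s: "F summable_on UNIV"
  shows "infsum F UNIV = infsum (\<lambda>(a,b). F (a + b, a - b)) UNIV + infsum (\<lambda>(a,b). F (a + b + 1, a - b)) UNIV"
proof -
  have s': "F summable_on A" for A using s summable_on_subset_banach by blast
  define Ev where "Ev = {z::int\<times>int. even (fst z + snd z)}"
  have b1: "bij_betw (\<lambda>(a,b). (a + b, a - b)) UNIV Ev"
    by (rule bij_betw_byWitness[where f' = "\<lambda>(m,n). ((m + n) div 2, m - (m + n) div 2)"])
       (auto simp: Ev_def; presburger)+
  have b2: "bij_betw (\<lambda>(a,b). (a + b + 1, a - b)) UNIV (- Ev)"
    by (rule bij_betw_byWitness[where f' = "\<lambda>(m,n). ((m + n - 1) div 2, m - 1 - (m + n - 1) div 2)"])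
       (auto simp: Ev_def; presburger)+
  have "infsum F (Ev \<union> - Ev) = infsum F Ev + infsum F (- Ev)"
    by (rule infsum_Un_disjoint[OF s' s']) auto
  also have "Ev \<union> - Ev = UNIV" by simp
  finally show ?thesis
    using infsum_reindex_bij_betw[OF b1, of F] infsum_reindex_bij_betw[OF b2, of F] by (simp add: case_prod_unfold)
qed

text \<open>The double sum splits by the parity of the sum of the indices. On either half the
  coordinates \<open>a\<close>, \<open>b\<close> decouple with doubled exponents: the even half
  gives squares, and the shift by 1 in the odd half gives \<open>n^2 + n\<close>, hence
  \<open>jt2\<close>.\<close>

lemma jt3_square:
  assumes q: "\<bar>q\<bar> < 1"
  shows "(jt3 q)\<^sup>2 = (jt3 (q\<^sup>2))\<^sup>2 + q * (jt2 (q\<^sup>2))\<^sup>2"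
proof -
  have q2: "\<bar>q\<^sup>2\<bar> < 1" using q by (simp add: abs_square_less_1)
  note T = abs_summable_Times[OF abs_summable_jt(1)[OF q, of UNIV] abs_summable_jt(1)[OF q, of UNIV]]
  note T3 = abs_summable_Times[OF abs_summable_jt(1)[OF q2, of UNIV] abs_summable_jt(1)[OF q2, of UNIV]]
  note T2 = abs_summable_Times[OF abs_summable_jt(2)[OF q2, of UNIV] abs_summable_jt(2)[OF q2, of UNIV]]
  have e1: "q ^ sq (a + b) * q ^ sq (a - b) = (q\<^sup>2) ^ sq a * (q\<^sup>2) ^ sq b" for a b
  proof -
    have "int (sq (a + b) + sq (a - b)) = int (2 * sq a + 2 * sq b)" by (simp only: of_nat_add of_nat_mult of_nat_numeral int_sq) algebra
    hence "sq (a + b) + sq (a - b) = 2 * sq a + 2 * sq b" by (simp only: of_nat_eq_iff)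
    thus ?thesis by (metis power_add power_mult)
  qed
  have e2: "q ^ sq (a + b + 1) * q ^ sq (a - b) = q * ((q\<^sup>2) ^ pron a * (q\<^sup>2) ^ pron b)" for a b
  proof -
    have "int (sq (a + b + 1) + sq (a - b)) = int (Suc (2 * pron a + 2 * pron b))"
      by (simp only: of_nat_add of_nat_mult of_nat_numeral of_nat_Suc int_sq int_pron) algebra
    hence "sq (a + b + 1) + sq (a - b) = Suc (2 * pron a + 2 * pron b)" by (simp only: of_nat_eq_iff)
    thus ?thesis by (metis power_add power_mult power_Suc)
  qed
  have "(jt3 q)\<^sup>2 = infsum (\<lambda>(x,y). q ^ sq x * q ^ sq y) UNIV"
    using T(2) by (simp add: jt3_def power2_eq_square)
  also have "\<dots> = infsum (\<lambda>(a,b). q ^ sq (a + b) * q ^ sq (a - b)) UNIV + infsum (\<lambda>(a,b). q ^ sq (a + b + 1) * q ^ sq (a - b)) UNIV"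
    using parity_split[of "\<lambda>(x,y). q ^ sq x * q ^ sq y"] T(1) by simp
  also have "infsum (\<lambda>(a,b). q ^ sq (a + b) * q ^ sq (a - b)) UNIV = (jt3 (q\<^sup>2))\<^sup>2"
    unfolding e1 using T3(2) by (simp add: jt3_def power2_eq_square)
  also have "infsum (\<lambda>(a,b). q ^ sq (a + b + 1) * q ^ sq (a - b)) UNIV = q * (jt2 (q\<^sup>2))\<^sup>2"
    unfolding e2 using T2(2) by (simp add: jt2_def power2_eq_square case_prod_unfold infsum_cmult_right')
  finally show ?thesis .
qed

lemma jt4_square:
  assumes q: "\<bar>q\<bar> < 1"
  shows "(jt4 q)\<^sup>2 = (jt3 (q\<^sup>2))\<^sup>2 - q * (jt2 (q\<^sup>2))\<^sup>2"
  using jt3_square[of "- q"] q by (simp add: jt4_def)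

lemma jt_0: "jt3 0 = 1" "jt4 0 = 1" "jt2 0 = 2"
proof -
  have "jt3 0 = infsum (\<lambda>n. 0 ^ sq n) {0}" unfolding jt3_def
    by (rule infsum_cong_neutral) auto
  thus "jt3 0 = 1" by simp
  thus "jt4 0 = 1" by (simp add: jt4_def)
  have "pron n \<noteq> 0" if "n \<notin> {0,-1}" for n
  proof -
    have "n\<^sup>2 + n = n * (n + 1)" by algebra
    hence "n\<^sup>2 + n \<noteq> 0" using that by auto
    thus ?thesis using int_pron[of n] by linarith
  qed
  hence "jt2 0 = infsum (\<lambda>n. 0 ^ pron n) {0,-1}" unfolding jt2_def
    by (intro infsum_cong_neutral) auto
  thus "jt2 0 = 2" by (simp add: pron_def)
qed

lemma jt2_square:
  assumes q: "\<bar>q\<bar> < 1"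
  shows "(jt2 q)\<^sup>2 = 2 * jt2 (q\<^sup>2) * jt3 (q\<^sup>2)"
proof (cases "q = 0")
  case True
  thus ?thesis by (simp add: jt_0)
next
  case False
  define p where "p = q\<^sup>2"
  have p: "\<bar>p\<bar> < 1" "p \<noteq> 0" "norm p < 1" using q False by (auto simp: p_def abs_square_less_1)
  define E A B F where "E = qpoch (- p) p" and "A = qpoch (- p) (p\<^sup>2)" and "B = qpoch (- (p\<^sup>2)) (p\<^sup>2)"
    and "F = qpoch (p\<^sup>2) (p\<^sup>2)"
  have E: "E = A * B"
    using qpoch_dissect[OF p(3), of 2 "- p"] by (simp add: E_def A_def B_def eval_nat_numeral lessThan_Suc mult_ac)
  have 1: "qpoch p p * E = F" unfolding E_def F_def by (rule qpoch_plus_minus[OF p(3)])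
  have 2: "jt2 q = 2 * qpoch p p * E\<^sup>2" unfolding p_def E_def by (rule jt2_product[OF q False])
  have 3: "jt2 p = 2 * F * B\<^sup>2" unfolding F_def B_def by (rule jt2_product[OF p(1,2)])
  have 4: "jt3 p = F * A\<^sup>2" unfolding F_def A_def by (rule jt3_product[OF p(1,2)])
  have "(jt2 q)\<^sup>2 = 4 * (qpoch p p * E)\<^sup>2 * E\<^sup>2" unfolding 2 by (simp add: power2_eq_square)
  also have "\<dots> = 4 * F\<^sup>2 * (A * B)\<^sup>2" unfolding 1 by (simp only: E)
  also have "\<dots> = 2 * jt2 p * jt3 p" unfolding 3 4 by (simp add: power2_eq_square)
  finally show ?thesis by (simp only: p_def)
qed

text \<open>Squaring the formulas for \<open>(jt3 q)\<^sup>2\<close> and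
  \<open>(jt4 q)\<^sup>2\<close> and subtracting leaves four times the mixed term, which
  \<open>jt2_square\<close> identifies.\<close>

lemma jacobi_quartic:
  assumes q: "\<bar>q\<bar> < 1"
  shows "jt3 q ^ 4 = q * jt2 q ^ 4 + jt4 q ^ 4"
proof -
  have "jt3 q ^ 4 = ((jt3 q)\<^sup>2)\<^sup>2" "jt4 q ^ 4 = ((jt4 q)\<^sup>2)\<^sup>2" "jt2 q ^ 4 = ((jt2 q)\<^sup>2)\<^sup>2" by (simp_all flip: power_mult)
  thus ?thesis unfolding jt3_square[OF q] jt4_square[OF q] jt2_square[OF q] by algebra
qed

lemma real_le_pred: "\<bar>1 * real m\<bar> \<le> 1 * (1 + real (m - 1)) ^ 1"
  by (cases m) auto

definition jt3' :: "real \<Rightarrow> real" where "jt3' q = (\<Sum>\<^sub>\<infinity>n. 1 * real (sq n) * q ^ (sq n - 1))"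
definition jt2' :: "real \<Rightarrow> real" where "jt2' q = (\<Sum>\<^sub>\<infinity>n. 1 * real (pron n) * q ^ (pron n - 1))"

lemma jt_DERIV:
  assumes q: "\<bar>q\<bar> < 1"
  shows "(jt3 has_real_derivative jt3' q) (at q)" "(jt2 has_real_derivative jt2' q) (at q)"
    "isCont jt3' q" "isCont jt2' q"
proof -
  have "((\<lambda>x. \<Sum>\<^sub>\<infinity>n. 1 * x ^ sq n) has_real_derivative jt3' q) (at q)" unfolding jt3'_def
    by (rule qseries_has_derivative(1)[where d = 0 and C = 1 and D = 0 and k = 0, OF q sq_ge]) auto
  thus "(jt3 has_real_derivative jt3' q) (at q)" by (simp add: jt3_def[abs_def])
  have "((\<lambda>x. \<Sum>\<^sub>\<infinity>n. 1 * x ^ pron n) has_real_derivative jt2' q) (at q)" unfolding jt2'_def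
    by (rule qseries_has_derivative(1)[where d = 1 and C = 1 and D = 0 and k = 0, OF q pron_ge]) auto
  thus "(jt2 has_real_derivative jt2' q) (at q)" by (simp add: jt2_def[abs_def])
  have s: "\<bar>n\<bar> \<le> int (sq n - 1) + int 1" "\<bar>n\<bar> \<le> int (pron n - 1) + int 2" for n
    using sq_ge[of n] pron_ge[of n] by linarith+
  show "isCont jt3' q" unfolding jt3'_def[abs_def]
    by (rule DERIV_isCont, rule qseries_has_derivative(1)[where d = 1 and C = 1 and D = 1 and k = 1, OF q s(1)]) (rule real_le_pred)
  show "isCont jt2' q" unfolding jt2'_def[abs_def]
    by (rule DERIV_isCont, rule qseries_has_derivative(1)[where d = 2 and C = 1 and D = 1 and k = 1, OF q s(2)]) (rule real_le_pred)
qed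

lemma jt4_DERIV:
  assumes q: "\<bar>q\<bar> < 1"
  shows "(jt4 has_real_derivative - jt3' (- q)) (at q)"
proof -
  have "((\<lambda>x. jt3 (- x)) has_real_derivative jt3' (- q) * (- 1)) (at q)"
    by (rule DERIV_chain2[OF jt_DERIV(1)]) (use q in \<open>auto intro!: derivative_eq_intros\<close>)
  thus ?thesis by (simp add: jt4_def[abs_def])
qed

definition modl :: "real \<Rightarrow> real" where "modl q = q * jt2 q ^ 4 / jt3 q ^ 4"

text \<open>The logarithmic derivative \<open>q x' / x\<close> of \<open>x = modl q\<close>, written
  with the derivative series so that it stays continuous at \<open>q = 0\<close>, where
  \<open>modl\<close> vanishes.\<close>

definition modl_P :: "real \<Rightarrow> real" where
  "modl_P q = 1 + 4 * q * (jt2' q / jt2 q - jt3' q / jt3 q)"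

lemma one_minus_modl:
  assumes q: "0 < q" "q < 1"
  shows "1 - modl q = (jt4 q / jt3 q) ^ 4"
proof -
  have "jt3 q ^ 4 = q * jt2 q ^ 4 + jt4 q ^ 4" using q by (intro jacobi_quartic) auto
  hence "jt4 q ^ 4 / jt3 q ^ 4 = (jt3 q ^ 4 - q * jt2 q ^ 4) / jt3 q ^ 4" by simp
  also have "\<dots> = 1 - modl q" using jt_pos[OF q] by (simp add: modl_def diff_divide_distrib)
  finally show ?thesis by (simp add: power_divide)
qed

lemma modl_bounds:
  assumes q: "0 < q" "q < 1"
  shows "0 < modl q" "modl q < 1"
proof -
  show "0 < modl q" using jt_pos[OF q] q by (simp add: modl_def)
  have "1 - modl q > 0" unfolding one_minus_modl[OF q] using jt_pos[OF q] by simp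
  thus "modl q < 1" by simp
qed

lemma modl_DERIV_P:
  assumes q: "0 < q" "q < 1"
  shows "(modl has_real_derivative modl q * modl_P q / q) (at q)"
proof -
  have q1: "\<bar>q\<bar> < 1" using q by simp
  have e: "jt3 q ^ 4 * jt3 q ^ 4 = jt3 q ^ 8" "jt3 q ^ 3 * jt3 q = jt3 q ^ 4" "jt2 q ^ 3 * jt2 q = jt2 q ^ 4"
    by (simp_all flip: power_add power_Suc2)
  have "((\<lambda>q. q * jt2 q ^ 4 / jt3 q ^ 4) has_real_derivative
    ((jt2 q ^ 4 + q * (4 * jt2 q ^ 3 * jt2' q)) * jt3 q ^ 4 - q * jt2 q ^ 4 * (4 * jt3 q ^ 3 * jt3' q)) / (jt3 q ^ 4 * jt3 q ^ 4)) (at q)"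
    using jt_pos[OF q] by (auto intro!: derivative_eq_intros jt_DERIV[OF q1])
  also have "((jt2 q ^ 4 + q * (4 * jt2 q ^ 3 * jt2' q)) * jt3 q ^ 4 - q * jt2 q ^ 4 * (4 * jt3 q ^ 3 * jt3' q)) / (jt3 q ^ 4 * jt3 q ^ 4)
     = modl q * modl_P q / q"
    unfolding modl_def modl_P_def using jt_pos[OF q] q
    by (simp add: divide_simps) algebra
  finally show ?thesis by (simp add: modl_def[abs_def])
qed

text \<open>Landen's transformation on the level of the modulus: \<open>Y\<close> is the
  complementary modulus at \<open>q\<close>, and the duplication formulas for \<open>jt3\<close> and
  \<open>jt4\<close> are solved for the modulus at \<open>q\<^sup>2\<close>.\<close>

lemma modl_square:
  assumes q: "0 < q" "q < 1"
  defines "Y \<equiv> (jt4 q / jt3 q)\<^sup>2"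
  shows "modl (q\<^sup>2) = ((1 - Y) / (1 + Y))\<^sup>2"
proof -
  have q1: "\<bar>q\<bar> < 1" using q by simp
  have p: "jt3 q > 0" "(jt3 q)\<^sup>2 + (jt4 q)\<^sup>2 > 0" using jt_pos[OF q] by (auto intro: add_pos_pos)
  have "(1 - Y) / (1 + Y) = ((jt3 q)\<^sup>2 - (jt4 q)\<^sup>2) / ((jt3 q)\<^sup>2 + (jt4 q)\<^sup>2)"
    unfolding Y_def using p by (simp add: power_divide divide_simps)
  also have "\<dots> = q * (jt2 (q\<^sup>2))\<^sup>2 / (jt3 (q\<^sup>2))\<^sup>2"
    unfolding jt3_square[OF q1] jt4_square[OF q1] by simp
  finally show ?thesis unfolding modl_def by (simp add: power_divide power_mult_distrib flip: power_mult)
qed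

text \<open>The logarithmic derivative \<open>modl_P\<close> equals \<open>theta_4^4\<close> because their quotient is invariant under squaring \<open>q\<close> and tends to 1 at 0.\<close>

lemma modl_P_square:
  assumes q: "0 < q" "q < 1"
  shows "modl_P (q\<^sup>2) / jt4 (q\<^sup>2) ^ 4 = modl_P q / jt4 q ^ 4"
proof -
  have q1: "\<bar>q\<bar> < 1" and q2: "0 < q\<^sup>2" "q\<^sup>2 < 1" using q by (auto simp: power_less_one_iff)
  note pos = jt_pos[OF q]
  define Y where "Y = (\<lambda>s. (jt4 s / jt3 s)\<^sup>2)"
  define y where "y = Y q"
  have y0: "y > 0" using pos by (simp add: y_def Y_def)
  have X: "1 - y\<^sup>2 = modl q" using one_minus_modl[OF q] by (simp add: y_def Y_def flip: power_mult)
  have y1: "y < 1"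
  proof -
    have "y\<^sup>2 < 1" using X modl_bounds[OF q] by simp
    thus ?thesis using y0 by (simp add: power_less_one_iff abs_square_less_1)
  qed
  obtain D where D: "(Y has_real_derivative D) (at q)"
  proof -
    have "jt3 q \<noteq> 0" using pos by simp
    from DERIV_power[OF DERIV_divide[OF jt4_DERIV[OF q1] jt_DERIV(1)[OF q1] this], of 2]
    show ?thesis using that unfolding Y_def by blast
  qed
  have op: "open {0<..<1::real}" "q \<in> {0<..<1}" using q by auto
  have "((\<lambda>s. 1 - (Y s)\<^sup>2) has_real_derivative - (2 * y * D)) (at q)"
    by (auto intro!: derivative_eq_intros D simp: y_def)
  hence "(modl has_real_derivative - (2 * y * D)) (at q)"
    by (rule has_field_derivative_transform_within_open[OF _ op])
       (use one_minus_modl in \<open>force simp: Y_def simp flip: power_mult\<close>)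
  hence D1: "- (2 * y * D) = modl q * modl_P q / q"
    by (rule DERIV_unique[OF _ modl_DERIV_P[OF q]])
  have "((\<lambda>s. ((1 - Y s) / (1 + Y s))\<^sup>2) has_real_derivative 2 * ((1 - y) / (1 + y)) * ((- D * (1 + y) - (1 - y) * D) / ((1 + y) * (1 + y)))) (at q)"
    using y0 unfolding y_def by (auto intro!: derivative_eq_intros D) (simp add: algebra_simps)
  hence A: "((\<lambda>s. modl (s\<^sup>2)) has_real_derivative 2 * ((1 - y) / (1 + y)) * ((- D * (1 + y) - (1 - y) * D) / ((1 + y) * (1 + y)))) (at q)"
    by (rule has_field_derivative_transform_within_open[OF _ op]) (use modl_square in \<open>simp add: Y_def\<close>)
  \<comment> \<open>\<open>modl (s\<^sup>2)\<close> is differentiated in two ways, through Landen's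
    formula in \<open>A\<close> and by the chain rule in \<open>B\<close>. The comparison brings in
    \<open>modl_P (q\<^sup>2)\<close>, and \<open>D1\<close> eliminates \<open>D\<close>.\<close>
  have B: "((\<lambda>s. modl (s\<^sup>2)) has_real_derivative (modl (q\<^sup>2) * modl_P (q\<^sup>2) / q\<^sup>2) * (2 * q)) (at q)"
    by (rule DERIV_chain2[where f = modl and g = "\<lambda>s. s\<^sup>2", OF modl_DERIV_P[OF q2]]) (auto intro!: derivative_eq_intros)
  have "(modl (q\<^sup>2) * modl_P (q\<^sup>2) / q\<^sup>2) * (2 * q) = 2 * ((1 - y) / (1 + y)) * ((- D * (1 + y) - (1 - y) * D) / ((1 + y) * (1 + y)))"
    by (rule DERIV_unique[OF B A])
  also have "modl (q\<^sup>2) = ((1 - y) / (1 + y))\<^sup>2" using modl_square[OF q] by (simp add: y_def Y_def)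
  finally have E: "((1 - y) / (1 + y))\<^sup>2 * modl_P (q\<^sup>2) / q\<^sup>2 * (2 * q) = 2 * ((1 - y) / (1 + y)) * ((- D * (1 + y) - (1 - y) * D) / ((1 + y) * (1 + y)))" .
  have "modl_P (q\<^sup>2) * (1 - y\<^sup>2) = - 2 * q * D"
  proof -
    have nz: "1 - y \<noteq> 0" "1 + y \<noteq> 0" "q \<noteq> 0" using y0 y1 q by auto
    define a b where "a = 1 - y" and "b = 1 + y"
    have "a \<noteq> 0" "b \<noteq> 0" using nz by (auto simp: a_def b_def)
    have s: "- D * b - a * D = - 2 * D" by (simp add: a_def b_def algebra_simps)
    have "(a / b)\<^sup>2 * modl_P (q\<^sup>2) / q\<^sup>2 * (2 * q) = 2 * (a / b) * ((- 2 * D) / (b * b))"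
      using E unfolding a_def[symmetric] b_def[symmetric] s .
    hence "a * (a * modl_P (q\<^sup>2) * b) = a * (- 2 * q * D)"
      using \<open>a \<noteq> 0\<close> \<open>b \<noteq> 0\<close> nz(3) by (simp add: field_simps power2_eq_square)
    hence "a * modl_P (q\<^sup>2) * b = - 2 * q * D" using \<open>a \<noteq> 0\<close> by (metis mult_left_cancel)
    thus ?thesis by (simp add: a_def b_def algebra_simps power2_eq_square)
  qed
  hence "y * (modl_P (q\<^sup>2) * modl q) = q * (- (2 * y * D))" unfolding X by simp
  also have "\<dots> = modl q * modl_P q" unfolding D1 using q by simp
  finally have F: "y * modl_P (q\<^sup>2) = modl_P q" using modl_bounds[OF q] by simp
  have "jt4 (q\<^sup>2) ^ 4 = (jt3 q * jt4 q)\<^sup>2" using jt3_jt4[of q] q by (simp flip: power_mult)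
  thus ?thesis unfolding F[symmetric] using pos jt_pos[OF q2] by (simp add: y_def Y_def field_simps power2_eq_square eval_nat_numeral)
qed

text \<open>The substitute for modularity: the orbit \<open>q^(2^n)\<close> tends to 0 while the
  value of \<open>G\<close> along it is constant, so the limit at 0 is that value.\<close>

lemma squaring_invariant:
  fixes G :: "real \<Rightarrow> real"
  assumes lim: "(G \<longlongrightarrow> L) (at_right 0)" and inv: "\<And>p. 0 < p \<Longrightarrow> p < 1 \<Longrightarrow> G (p\<^sup>2) = G p"
    and q: "0 < q" "q < 1"
  shows "G q = L"
proof -
  have it: "0 < q ^ (2 ^ n) \<and> q ^ (2 ^ n) < 1 \<and> G (q ^ (2 ^ n)) = G q" for n
  proof (induction n)
    case 0 show ?case using q by simp
  next
    case (Suc n)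
    have "2 ^ Suc n = 2 ^ n * (2::nat)" by simp
    hence e: "q ^ (2 ^ Suc n) = (q ^ (2 ^ n))\<^sup>2" by (simp only: power_mult)
    define p where "p = q ^ (2 ^ n)"
    have p: "0 < p" "p < 1" "G p = G q" using Suc by (auto simp: p_def)
    thus ?case unfolding e p_def[symmetric] using inv[OF p(1,2)] by (auto simp: power_less_one_iff)
  qed
  have "(\<lambda>n. q ^ (2 ^ n)) \<longlonglongrightarrow> 0"
  proof (rule filterlim_compose[OF LIMSEQ_power_zero])
    show "filterlim (\<lambda>n::nat. 2 ^ n :: nat) at_top sequentially"
      by (rule filterlim_subseq) (auto simp: strict_mono_def)
  qed (use q in auto)
  moreover have "q ^ (2 ^ n) \<in> {0<..} \<and> q ^ (2 ^ n) \<noteq> 0" for n using it[of n] by (metis greaterThan_iff less_irrefl)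
  ultimately have "filterlim (\<lambda>n. q ^ (2 ^ n)) (at_right 0) sequentially"
    unfolding filterlim_at by (blast intro: always_eventually)
  hence "(\<lambda>n. G (q ^ (2 ^ n))) \<longlonglongrightarrow> L" by (rule filterlim_compose[OF lim])
  hence "(\<lambda>n. G q) \<longlonglongrightarrow> L" using it by simp
  thus ?thesis by (simp add: LIMSEQ_const_iff)
qed

lemma modl_P_eq:
  assumes q: "0 < q" "q < 1"
  shows "modl_P q = jt4 q ^ 4"
proof -
  define G where "G s = modl_P s / jt4 s ^ 4" for s
  have c: "isCont G 0"
  proof -
    have "isCont jt2 0" "isCont jt3 0" "isCont jt4 0" "isCont jt2' 0" "isCont jt3' 0"
      using jt_DERIV[of 0] jt4_DERIV[of 0] by (auto intro: DERIV_isCont)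
    thus ?thesis unfolding G_def modl_P_def by (intro continuous_intros) (auto simp: jt_0)
  qed
  have "G q = G 0"
  proof (rule squaring_invariant[OF _ _ q])
    show "(G \<longlongrightarrow> G 0) (at_right 0)" using c by (auto simp: isCont_def intro: tendsto_mono[OF at_le])
    show "G (p\<^sup>2) = G p" if "0 < p" "p < 1" for p unfolding G_def by (rule modl_P_square[OF that])
  qed
  hence "modl_P q / jt4 q ^ 4 = 1" by (simp only: G_def modl_P_def[of 0] jt_0) simp
  thus ?thesis by (metis divide_eq_1_iff)
qed

section \<open>Complete elliptic integrals and the singular modulus\<close>

lemma ellK_radicand_pos:
  assumes "0 \<le> k" "k < (1::real)"
  shows "1 - k\<^sup>2 * (sin t)\<^sup>2 > 0"
proof -
  have "k\<^sup>2 * (sin t)\<^sup>2 \<le> k\<^sup>2 * 1" by (intro mult_left_mono) (auto simp: abs_square_le_1)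
  moreover have "k\<^sup>2 < 1" using assms by (simp add: power_less_one_iff)
  ultimately show ?thesis by simp
qed

lemma ellK_continuous:
  assumes "0 \<le> k" "k < (1::real)"
  shows "continuous_on A (\<lambda>t. 1 / sqrt (1 - k\<^sup>2 * (sin t)\<^sup>2))"
  using ellK_radicand_pos[OF assms] by (intro continuous_intros) (auto simp: less_imp_neq[symmetric])

text \<open>Landen's substitution carries the interval up to \<open>pi/2\<close> to the one up to
  \<open>pi\<close>, and the integrand is symmetric about \<open>pi/2\<close>.\<close>

lemma ellK_double:
  assumes k: "0 \<le> k" "k < 1"
  shows "integral {0..pi} (\<lambda>t. 1 / sqrt (1 - k\<^sup>2 * (sin t)\<^sup>2)) = 2 * ellK k"
proof -
  let ?F = "\<lambda>t. 1 / sqrt (1 - k\<^sup>2 * (sin t)\<^sup>2)"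
  have "integral {0..pi/2} ?F + integral {pi/2..pi} ?F = integral {0..pi} ?F"
    by (rule Henstock_Kurzweil_Integration.integral_combine) (auto intro!: integrable_continuous_real ellK_continuous k)
  moreover have "integral {-(pi/2)..0} (?F \<circ> (\<lambda>x. x + pi)) = integral {-(pi/2)+pi..0+pi} ?F"
    by (rule integral_shift) (rule ellK_continuous[OF k])
  moreover have "?F \<circ> (\<lambda>x. x + pi) = ?F" by (auto simp: fun_eq_iff)
  moreover have "integral {-(pi/2)..0} ?F = integral {0..pi/2} ?F"
    using Henstock_Kurzweil_Integration.integral_reflect_real[of "pi/2" 0 ?F] by simp
  ultimately show ?thesis by (simp add: ellK_def)
qed

text \<open>The substitution is \<open>t -> t + arctan (y tan t)\<close>, rewritten as \<open>g\<close> below so that the arctangent has no poles.\<close>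

theorem landen:
  assumes y: "0 < y" "y < 1"
  shows "(1 + y) * ellK (sqrt (1 - y\<^sup>2)) = 2 * ellK ((1 - y) / (1 + y))"
proof -
  define k1 where "k1 = (1 - y) / (1 + y)"
  have k1: "0 \<le> k1" "k1 < 1" "k1 * (1 + y) = 1 - y" using y by (auto simp: k1_def divide_simps)
  have y2: "y\<^sup>2 \<le> 1" using y by (simp add: power_le_one)
  define F where "F = (\<lambda>t. 1 / sqrt (1 - k1\<^sup>2 * (sin t)\<^sup>2))"
  define N where "N x = (cos x)\<^sup>2 + y * (sin x)\<^sup>2" for x
  define M where "M x = (cos x)\<^sup>2 + y\<^sup>2 * (sin x)\<^sup>2" for x
  \<comment> \<open>By the subtraction formula \<open>w x\<close> is the tangent of
    \<open>x - arctan (y * tan x)\<close>; its denominator \<open>N x\<close> is positive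
    everywhere.\<close>
  define w where "w x = (1 - y) * (sin x * cos x) / N x" for x
  define g where "g x = 2 * x - arctan (w x)" for x
  define C where "C x = (1 - y) * ((cos x)\<^sup>2 - (sin x)\<^sup>2) * N x - (1 - y) * (sin x * cos x) * ((2 * y - 2) * (sin x * cos x))" for x
  have pos: "(cos x)\<^sup>2 + a * (sin x)\<^sup>2 > 0" if "a > 0" for a x :: real
  proof (cases "sin x = 0")
    case True
    hence "(cos x)\<^sup>2 = 1" using sin_cos_squared_add[of x] by simp
    thus ?thesis using True by simp
  next
    case False
    hence "a * (sin x)\<^sup>2 > 0" using that by simp
    thus ?thesis by (simp add: add_nonneg_pos)
  qed
  have N: "N x > 0" and M: "M x > 0" for x using pos[of y x] pos[of "y\<^sup>2" x] y by (auto simp: N_def M_def)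
  have cs: "(cos x)\<^sup>2 = 1 - (sin x)\<^sup>2" for x :: real by (simp add: cos_squared_eq)
  have NM: "(N x)\<^sup>2 + (1 - y)\<^sup>2 * ((sin x)\<^sup>2 * (cos x)\<^sup>2) = M x" for x
    unfolding N_def M_def cs by algebra
  have w2: "1 + (w x)\<^sup>2 = M x / (N x)\<^sup>2" for x
    unfolding NM[of x, symmetric] w_def using N[of x] by (simp add: power_divide power_mult_distrib add_divide_distrib)
  have sing: "(sin (g x))\<^sup>2 = (1 + y)\<^sup>2 * ((sin x)\<^sup>2 * (cos x)\<^sup>2) / M x" for x
  proof -
    have W: "1 + (w x)\<^sup>2 > 0" by (simp add: add_pos_nonneg)
    have "sin (g x) = (sin (2 * x) - w x * cos (2 * x)) / sqrt (1 + (w x)\<^sup>2)"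
      unfolding g_def sin_diff cos_arctan sin_arctan by (simp add: diff_divide_distrib mult.commute)
    hence "(sin (g x))\<^sup>2 = (sin (2 * x) - w x * cos (2 * x))\<^sup>2 / (1 + (w x)\<^sup>2)"
      using W by (simp add: power_divide)
    also have "sin (2 * x) - w x * cos (2 * x) = (1 + y) * (sin x * cos x) / N x"
    proof -
      have "2 * N x - (1 - y) * ((cos x)\<^sup>2 - (sin x)\<^sup>2) = 1 + y"
        unfolding N_def cs by algebra
      hence "(sin x * cos x) * (2 * N x - (1 - y) * ((cos x)\<^sup>2 - (sin x)\<^sup>2)) / N x = (sin x * cos x) * (1 + y) / N x" by simp
      thus ?thesis unfolding sin_double cos_double w_def using N[of x] by (simp add: field_simps)
    qed
    also have "((1 + y) * (sin x * cos x) / N x)\<^sup>2 / (1 + (w x)\<^sup>2) = (1 + y)\<^sup>2 * ((sin x)\<^sup>2 * (cos x)\<^sup>2) / M x"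
      unfolding w2 using N[of x] M[of x] by (simp add: power_divide power_mult_distrib)
    finally show ?thesis .
  qed
  have Fg: "F (g x) = sqrt (M x) / N x" for x
  proof -
    have "k1\<^sup>2 * (sin (g x))\<^sup>2 = (k1 * (1 + y))\<^sup>2 * ((sin x)\<^sup>2 * (cos x)\<^sup>2) / M x"
      unfolding sing by (simp add: power_mult_distrib)
    also have "\<dots> = (M x - (N x)\<^sup>2) / M x" unfolding k1(3) using NM[of x] by simp
    finally have "1 - k1\<^sup>2 * (sin (g x))\<^sup>2 = (N x)\<^sup>2 / M x" using M[of x] by (simp add: diff_divide_distrib)
    thus ?thesis unfolding F_def using N[of x] by (simp add: real_sqrt_divide)
  qed
  have Dg: "(g has_real_derivative (1 + y) * N x / M x) (at x)" for x
  proof -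
    have DN: "(N has_real_derivative (2 * y - 2) * (sin x * cos x)) (at x)"
      unfolding N_def[abs_def] by (auto intro!: derivative_eq_intros simp: algebra_simps)
    have "(w has_real_derivative C x / (N x * N x)) (at x)"
      unfolding w_def[abs_def] using N[of x] by (auto intro!: derivative_eq_intros DN simp: C_def algebra_simps power2_eq_square)
    hence "(g has_real_derivative 2 - C x / (N x * N x) / (1 + (w x)\<^sup>2)) (at x)"
      unfolding g_def[abs_def] by (auto intro!: derivative_eq_intros simp: divide_inverse mult_ac)
    also have "C x / (N x * N x) / (1 + (w x)\<^sup>2)
       = C x / M x"
      unfolding w2 using N[of x] by (simp add: power2_eq_square)
    also have "2 - C x / M x = (1 + y) * N x / M x"
    proof -
      have "2 * M x - C x = (1 + y) * N x"
        using sin_cos_squared_add[of x] unfolding C_def N_def M_def by algebra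
      thus ?thesis using M[of x] by (simp add: divide_simps)
    qed
    finally show ?thesis .
  qed
  have g0: "g 0 = 0" "g (pi/2) = pi" by (auto simp: g_def w_def)
  have "((\<lambda>x. ((1 + y) * N x / M x) *\<^sub>R F (g x)) has_integral (integral {g 0..g (pi/2)} F)) {0..pi/2}"
  proof (rule has_integral_substitution[where c = "- pi" and d = "2 * pi"])
    show "g ` {0..pi/2} \<subseteq> {- pi..2 * pi}"
    proof safe
      fix x assume "x \<in> {0..pi/2}"
      thus "g x \<in> {- pi..2 * pi}" using arctan_bounded[of "w x"] unfolding g_def atLeastAtMost_iff by linarith
    qed
    show "continuous_on {- pi..2 * pi} F" unfolding F_def by (rule ellK_continuous[OF k1(1,2)])
    show "(g has_real_derivative (1 + y) * N x / M x) (at x within {0..pi/2})" for x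
      by (rule has_field_derivative_at_within[OF Dg])
  qed (auto simp: g0)
  hence "((\<lambda>x. ((1 + y) * N x / M x) *\<^sub>R F (g x)) has_integral (2 * ellK k1)) {0..pi/2}"
    unfolding g0 F_def using ellK_double[OF k1(1,2)] by simp
  moreover have "((1 + y) * N x / M x) *\<^sub>R F (g x) = (1 + y) * (1 / sqrt (1 - (sqrt (1 - y\<^sup>2))\<^sup>2 * (sin x)\<^sup>2))" for x
  proof -
    have "1 - (sqrt (1 - y\<^sup>2))\<^sup>2 * (sin x)\<^sup>2 = M x" using y2 unfolding M_def cs by (simp add: algebra_simps)
    moreover have "M x = sqrt (M x) * sqrt (M x)" using M[of x] by simp
    ultimately show ?thesis unfolding Fg using N[of x] M[of x]
      by (simp add: divide_simps)
  qed
  ultimately have "((\<lambda>x. (1 + y) * (1 / sqrt (1 - (sqrt (1 - y\<^sup>2))\<^sup>2 * (sin x)\<^sup>2))) has_integral (2 * ellK k1)) {0..pi/2}"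
    by simp
  hence "integral {0..pi/2} (\<lambda>x. (1 + y) * (1 / sqrt (1 - (sqrt (1 - y\<^sup>2))\<^sup>2 * (sin x)\<^sup>2))) = 2 * ellK k1"
    by (rule integral_unique)
  thus ?thesis unfolding ellK_def k1_def by (simp only: integral_mult_right)
qed

text \<open>Both bounds tend to \<open>pi / 2\<close> as the modulus tends to 0, which gives the
  limit of the denominator of \<open>K'/K\<close>.\<close>

lemma ellK_ge: 
  assumes k: "0 \<le> k" "k < 1"
  shows "ellK k \<ge> pi / 2" "ellK k \<le> (pi / 2) / sqrt (1 - k\<^sup>2)"
proof -
  have i: "(\<lambda>t. 1 / sqrt (1 - k\<^sup>2 * (sin t)\<^sup>2)) integrable_on {0..pi/2}"
    by (intro integrable_continuous_real ellK_continuous k)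
  have c: "integral {0..pi/2} (\<lambda>t. c::real) = (pi / 2) * c" for c by simp
  have "integral {0..pi/2} (\<lambda>t. 1::real) \<le> ellK k" unfolding ellK_def
  proof (rule integral_le)
    fix t show "1 \<le> 1 / sqrt (1 - k\<^sup>2 * (sin t)\<^sup>2)"
      using ellK_radicand_pos[OF k, of t] by (simp add: divide_simps)
  qed (use i in auto)
  thus "ellK k \<ge> pi / 2" unfolding c by simp
  have k2: "1 - k\<^sup>2 > 0" using k by (simp add: power_less_one_iff)
  have "ellK k \<le> integral {0..pi/2} (\<lambda>t. 1 / sqrt (1 - k\<^sup>2))" unfolding ellK_def
  proof (rule integral_le)
    fix t
    have "k\<^sup>2 * (sin t)\<^sup>2 \<le> k\<^sup>2 * 1" by (intro mult_left_mono) (auto simp: abs_square_le_1)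
    thus "1 / sqrt (1 - k\<^sup>2 * (sin t)\<^sup>2) \<le> 1 / sqrt (1 - k\<^sup>2)"
      using k2 by (intro divide_left_mono) auto
  qed (use i in auto)
  thus "ellK k \<le> (pi / 2) / sqrt (1 - k\<^sup>2)" unfolding c by simp
qed

lemma ellK_pos: "0 \<le> k \<Longrightarrow> k < 1 \<Longrightarrow> ellK k > 0"
  using ellK_ge(1)[of k] pi_gt_zero by linarith

lemma ellK_strict_mono:
  assumes k: "0 \<le> k" "k < l" "l < 1"
  shows "ellK k < ellK l"
  unfolding ellK_def
proof (rule integral_less_real)
  have k1: "k < 1" and l: "0 \<le> l" using k by auto
  show "continuous_on {0..pi/2} (\<lambda>t. 1 / sqrt (1 - k\<^sup>2 * (sin t)\<^sup>2))"
       "continuous_on {0..pi/2} (\<lambda>t. 1 / sqrt (1 - l\<^sup>2 * (sin t)\<^sup>2))"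
    by (intro ellK_continuous k k1 l)+
  show "{0<..<pi/2} \<noteq> {}" using pi_gt_zero by (simp add: not_le)
  fix t :: real assume t: "t \<in> {0<..<pi/2}"
  hence "sin t > 0" by (intro sin_gt_zero) auto
  hence "k\<^sup>2 * (sin t)\<^sup>2 < l\<^sup>2 * (sin t)\<^sup>2" using k by (intro mult_strict_right_mono power_strict_mono) auto
  thus "1 / sqrt (1 - k\<^sup>2 * (sin t)\<^sup>2) < 1 / sqrt (1 - l\<^sup>2 * (sin t)\<^sup>2)"
    using ellK_radicand_pos[OF l k(3), of t] by (intro divide_strict_left_mono mult_pos_pos) auto
qed

text \<open>Near modulus 1 the integrand is compared with its product with \<open>sin t\<close>,
  which has an elementary primitive. The two differ by at most 1 pointwise, so \<open>K\<close> is
  known up to \<open>pi / 2\<close>, an error that disappears on division by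
  \<open>- ln q\<close>.\<close>

lemma ellK_log_bounds:
  assumes y: "0 < y" "y < 1"
  defines "k \<equiv> sqrt (1 - y\<^sup>2)"
  shows "ln ((1 + k) / y) / k \<le> ellK k" "ellK k \<le> ln ((1 + k) / y) / k + pi / 2"
proof -
  have y2: "y\<^sup>2 < 1" using y by (simp add: power_less_one_iff)
  have k2: "k\<^sup>2 = 1 - y\<^sup>2" using y2 by (simp add: k_def)
  have k: "0 < k" "k < 1" using y y2 by (auto simp: k_def real_sqrt_lt_1_iff)
  have rad: "1 - k\<^sup>2 * (sin t)\<^sup>2 = y\<^sup>2 + k\<^sup>2 * (cos t)\<^sup>2" for t
    unfolding k2 cos_squared_eq by algebra
  have radp: "y\<^sup>2 + k\<^sup>2 * (cos t)\<^sup>2 > 0" for t using y by (intro add_pos_nonneg) auto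
  define A where "A t = - (1 / k) * arsinh (k * cos t / y)" for t
  have D: "(A has_real_derivative sin t / sqrt (y\<^sup>2 + k\<^sup>2 * (cos t)\<^sup>2)) (at t)" for t
  proof -
    have "(A has_real_derivative - (1 / k) * (1 / sqrt ((k * cos t / y)\<^sup>2 + 1) * (k * - sin t / y))) (at t)"
      unfolding A_def[abs_def] using y
      by (intro DERIV_cmult DERIV_chain2[OF arsinh_real_has_field_derivative]) (auto intro!: derivative_eq_intros)
    also have "sqrt ((k * cos t / y)\<^sup>2 + 1) = sqrt (y\<^sup>2 + k\<^sup>2 * (cos t)\<^sup>2) / y"
    proof -
      have "(k * cos t / y)\<^sup>2 + 1 = (y\<^sup>2 + k\<^sup>2 * (cos t)\<^sup>2) / y\<^sup>2"
        using y by (simp add: power_divide power_mult_distrib add_divide_distrib add.commute)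
      thus ?thesis using y by (simp add: real_sqrt_divide)
    qed
    also have "- (1 / k) * (1 / (sqrt (y\<^sup>2 + k\<^sup>2 * (cos t)\<^sup>2) / y) * (k * - sin t / y)) = sin t / sqrt (y\<^sup>2 + k\<^sup>2 * (cos t)\<^sup>2)"
      using y k radp[of t] by (simp add: field_simps)
    finally show ?thesis .
  qed
  have I: "((\<lambda>t. sin t / sqrt (y\<^sup>2 + k\<^sup>2 * (cos t)\<^sup>2)) has_integral (A (pi/2) - A 0)) {0..pi/2}"
    by (rule fundamental_theorem_of_calculus)
       (auto intro!: has_field_derivative_at_within D simp flip: has_real_derivative_iff_has_vector_derivative)
  have A: "A (pi/2) - A 0 = ln ((1 + k) / y) / k"
  proof -
    have "sqrt ((k / y)\<^sup>2 + 1) = 1 / y"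
    proof -
      have "(k / y)\<^sup>2 + 1 = (1 / y)\<^sup>2" using y by (simp add: power_divide k2 diff_divide_distrib)
      thus ?thesis using y by (simp add: real_sqrt_divide)
    qed
    hence "arsinh (k / y) = ln ((1 + k) / y)"
      by (simp add: arsinh_real_def add_divide_distrib add.commute)
    thus ?thesis by (simp add: A_def)
  qed
  have iK: "(\<lambda>t. 1 / sqrt (1 - k\<^sup>2 * (sin t)\<^sup>2)) integrable_on {0..pi/2}"
    using k by (intro integrable_continuous_real ellK_continuous) auto
  have int: "integral {0..pi/2} (\<lambda>t. sin t / sqrt (y\<^sup>2 + k\<^sup>2 * (cos t)\<^sup>2)) = ln ((1 + k) / y) / k"
    using I A by (simp add: integral_unique)
  have ii: "(\<lambda>t. sin t / sqrt (y\<^sup>2 + k\<^sup>2 * (cos t)\<^sup>2)) integrable_on {0..pi/2}" using I by blast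
  show "ln ((1 + k) / y) / k \<le> ellK k"
    unfolding int[symmetric] ellK_def
  proof (rule integral_le[OF ii iK])
    fix t show "sin t / sqrt (y\<^sup>2 + k\<^sup>2 * (cos t)\<^sup>2) \<le> 1 / sqrt (1 - k\<^sup>2 * (sin t)\<^sup>2)"
      unfolding rad using radp[of t] by (intro divide_right_mono) auto
  qed
  have "ellK k \<le> integral {0..pi/2} (\<lambda>t. sin t / sqrt (y\<^sup>2 + k\<^sup>2 * (cos t)\<^sup>2) + 1)"
    unfolding ellK_def
  proof (rule integral_le[OF iK])
    show "(\<lambda>t. sin t / sqrt (y\<^sup>2 + k\<^sup>2 * (cos t)\<^sup>2) + 1) integrable_on {0..pi/2}"
      by (intro integrable_add ii) auto
    fix t :: real assume t: "t \<in> {0..pi/2}"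
    have s: "0 \<le> sin t" "sin t \<le> 1" using t by (auto intro!: sin_ge_zero)
    \<comment> \<open>This bounds the difference of the two integrands by 1. It holds because
      \<open>(1 - sin t)\<^sup>2 \<le> (cos t)\<^sup>2\<close>, and the radicand is at least
      \<open>(cos t)\<^sup>2\<close> in view of \<open>k\<^sup>2 = 1 - y\<^sup>2\<close>.\<close>
    have "1 - sin t \<le> sqrt (y\<^sup>2 + k\<^sup>2 * (cos t)\<^sup>2)"
    proof (rule real_le_rsqrt)
      have "(1 - sin t)\<^sup>2 \<le> (1 - sin t) * (1 + sin t)"
        unfolding power2_eq_square using s by (intro mult_left_mono) auto
      also have "\<dots> = (cos t)\<^sup>2" unfolding cos_squared_eq by (simp add: algebra_simps power2_eq_square)
      also have "\<dots> \<le> y\<^sup>2 + k\<^sup>2 * (cos t)\<^sup>2"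
      proof -
        have "y\<^sup>2 * (cos t)\<^sup>2 \<le> y\<^sup>2 * 1" by (intro mult_left_mono) (auto simp: abs_square_le_1)
        thus ?thesis unfolding k2 by (simp add: algebra_simps)
      qed
      finally show "(1 - sin t)\<^sup>2 \<le> y\<^sup>2 + k\<^sup>2 * (cos t)\<^sup>2" .
    qed
    thus "1 / sqrt (1 - k\<^sup>2 * (sin t)\<^sup>2) \<le> sin t / sqrt (y\<^sup>2 + k\<^sup>2 * (cos t)\<^sup>2) + 1"
      unfolding rad using radp[of t] by (simp add: divide_simps)
  qed
  also have "\<dots> = ln ((1 + k) / y) / k + pi / 2"
    using integral_add[OF ii integrable_const_ivl[of 1 0 "pi/2"]] by (simp add: int)
  finally show "ellK k \<le> ln ((1 + k) / y) / k + pi / 2" .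
qed

section \<open>The nome as a function of \<open>K'/K\<close>\<close>

definition ellK_ratio :: "real \<Rightarrow> real" where
  "ellK_ratio q = ellK (sqrt (1 - modl q)) / ellK (sqrt (modl q))"

lemma sqrt_modl_square:
  assumes q: "0 < q" "q < 1"
  shows "sqrt (modl (q\<^sup>2)) = (1 - sqrt (1 - modl q)) / (1 + sqrt (1 - modl q))"
proof -
  have m: "0 < modl q" "modl q < 1" by (rule modl_bounds[OF q])+
  have "sqrt (1 - modl q) = (jt4 q / jt3 q)\<^sup>2"
    unfolding one_minus_modl[OF q] by (rule real_sqrt_unique) (auto simp flip: power_mult)
  hence "modl (q\<^sup>2) = ((1 - sqrt (1 - modl q)) / (1 + sqrt (1 - modl q)))\<^sup>2"
    using modl_square[OF q] by simp
  moreover have "(1 - sqrt (1 - modl q)) / (1 + sqrt (1 - modl q)) \<ge> 0"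
    using m by (intro divide_nonneg_nonneg) auto
  ultimately show ?thesis by (simp only: real_sqrt_abs abs_of_nonneg)
qed

text \<open>Landen's transformation is used twice, for the modulus at \<open>q\<close> and with
  \<open>k1\<close> in the place of the complementary modulus. Passing to \<open>q\<^sup>2\<close>
  multiplies \<open>K\<close> by \<open>(1 + y) / 2\<close> and \<open>K'\<close> by
  \<open>1 + y\<close>.\<close>

lemma ellK_ratio_square:
  assumes q: "0 < q" "q < 1"
  shows "ellK_ratio (q\<^sup>2) = 2 * ellK_ratio q"
proof -
  have m: "0 < modl q" "modl q < 1" by (rule modl_bounds[OF q])+
  have q2: "0 < q\<^sup>2" "q\<^sup>2 < 1" using q by (auto simp: power_less_one_iff)
  have m2: "0 < modl (q\<^sup>2)" "modl (q\<^sup>2) < 1" by (rule modl_bounds[OF q2])+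
  define y where "y = sqrt (1 - modl q)"
  define k1 where "k1 = sqrt (modl (q\<^sup>2))"
  have y: "0 < y" "y < 1" "sqrt (1 - y\<^sup>2) = sqrt (modl q)" using m by (auto simp: y_def)
  have k1: "0 < k1" "k1 < 1" "k1\<^sup>2 = modl (q\<^sup>2)" using m2 by (auto simp: k1_def)
  have k1y: "k1 = (1 - y) / (1 + y)" unfolding k1_def y_def by (rule sqrt_modl_square[OF q])
  have inv: "(1 - k1) / (1 + k1) = y" "1 + k1 = 2 / (1 + y)"
    unfolding k1y using y by (simp_all add: divide_simps)
  have L1: "(1 + y) * ellK (sqrt (modl q)) = 2 * ellK k1"
    using landen[OF y(1,2)] unfolding y(3) k1y .
  have L2: "2 / (1 + y) * ellK (sqrt (1 - modl (q\<^sup>2))) = 2 * ellK y"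
    using landen[OF k1(1,2)] unfolding inv(1) unfolding inv(2) k1(3) .
  have p: "ellK (sqrt (modl q)) > 0" "ellK k1 > 0" using m k1 by (auto intro!: ellK_pos)
  have "ellK k1 = (1 + y) * ellK (sqrt (modl q)) / 2" using L1 by simp
  moreover have "ellK (sqrt (1 - modl (q\<^sup>2))) = (1 + y) * ellK y" using L2 y by (simp add: field_simps)
  ultimately show ?thesis
    unfolding ellK_ratio_def k1_def[symmetric] y_def[symmetric] using y p by (simp add: divide_simps)
qed

lemma jt_at_right:
  "(jt3 \<longlongrightarrow> 1) (at_right 0)" "(jt2 \<longlongrightarrow> 2) (at_right 0)"
proof -
  have "isCont jt3 0" "isCont jt2 0" using jt_DERIV[of 0] by (auto intro: DERIV_isCont)
  hence "(jt3 \<longlongrightarrow> jt3 0) (at 0)" "(jt2 \<longlongrightarrow> jt2 0) (at 0)" by (simp_all add: isCont_def)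
  thus "(jt3 \<longlongrightarrow> 1) (at_right 0)" "(jt2 \<longlongrightarrow> 2) (at_right 0)"
    unfolding jt_0 by (auto intro: tendsto_mono[OF at_le])
qed

lemma modl_at_right: "(modl \<longlongrightarrow> 0) (at_right 0)"
proof -
  have "((\<lambda>q. q * jt2 q ^ 4 / jt3 q ^ 4) \<longlongrightarrow> 0 * 2 ^ 4 / 1 ^ 4) (at_right 0)"
    by (intro tendsto_intros jt_at_right) auto
  thus ?thesis by (simp add: modl_def[abs_def])
qed

lemma eventually_unit_interval: "eventually (\<lambda>q::real. 0 < q \<and> q < 1) (at_right 0)"
  unfolding eventually_at_right_field by (intro exI[of _ 1]) auto

text \<open>As \<open>q\<close> tends to 0 the denominator \<open>K\<close> tends to
  \<open>pi / 2\<close>, and \<open>K'\<close> is asymptotic to \<open>- ln (sqrt (modl q))\<close>,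
  that is to \<open>- ln q / 2\<close>, because \<open>modl q / q\<close> has a positive
  limit.\<close>

lemma ellK_ratio_limit: "((\<lambda>q. ellK_ratio q / (- ln q)) \<longlongrightarrow> 1 / pi) (at_right 0)"
proof -
  have K0: "((\<lambda>q. ellK (sqrt (modl q))) \<longlongrightarrow> pi / 2) (at_right 0)"
  proof (rule tendsto_sandwich)
    show "eventually (\<lambda>q. pi / 2 \<le> ellK (sqrt (modl q))) (at_right 0)"
      using eventually_unit_interval
    proof eventually_elim
      case (elim q)
      thus ?case using ellK_ge(1)[of "sqrt (modl q)"] modl_bounds[of q] by (simp add: less_imp_le)
    qed
    show "eventually (\<lambda>q. ellK (sqrt (modl q)) \<le> (pi / 2) / sqrt (1 - modl q)) (at_right 0)"
      using eventually_unit_interval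
    proof eventually_elim
      case (elim q)
      thus ?case using ellK_ge(2)[of "sqrt (modl q)"] modl_bounds[of q] by (simp add: less_imp_le)
    qed
    have "((\<lambda>q. (pi / 2) / sqrt (1 - modl q)) \<longlongrightarrow> (pi / 2) / sqrt (1 - 0)) (at_right 0)"
      by (intro tendsto_intros modl_at_right) auto
    thus "((\<lambda>q. (pi / 2) / sqrt (1 - modl q)) \<longlongrightarrow> pi / 2) (at_right 0)" by simp
  qed auto
  define E where "E q = ln ((1 + sqrt (1 - modl q)) / sqrt (modl q)) / sqrt (1 - modl q)" for q
  have l: "filterlim (\<lambda>q::real. - ln q) at_top (at_right 0)"
    using ln_at_0 by (simp add: filterlim_uminus_at_bot)
  have E: "((\<lambda>q. E q / (- ln q)) \<longlongrightarrow> 1 / 2) (at_right 0)"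
  proof -
    \<comment> \<open>\<open>c\<close> collects what stays bounded after \<open>- ln q / 2\<close>
      is split off from the logarithm in \<open>E\<close>.\<close>
    define c where "c q = ln (1 + sqrt (1 - modl q)) - 2 * ln (jt2 q / jt3 q)" for q
    have c: "(c \<longlongrightarrow> ln (1 + sqrt (1 - 0)) - 2 * ln (2 / 1)) (at_right 0)"
      unfolding c_def by (intro tendsto_intros modl_at_right jt_at_right) auto
    have "((\<lambda>q. (c q / (- ln q) + 1 / 2) / sqrt (1 - modl q)) \<longlongrightarrow> (0 + 1 / 2) / sqrt (1 - 0)) (at_right 0)"
      by (intro tendsto_intros modl_at_right real_tendsto_divide_at_top[OF c l]) auto
    moreover have "eventually (\<lambda>q. (c q / (- ln q) + 1 / 2) / sqrt (1 - modl q) = E q / (- ln q)) (at_right 0)"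
      using eventually_unit_interval
    proof eventually_elim
      case (elim q)
      hence q: "0 < q" "q < 1" by auto
      note m = modl_bounds[OF q] and j = jt_pos[OF q]
      have ln: "ln q < 0" using q by simp
      have "modl q = q * (jt2 q / jt3 q) ^ 4" by (simp add: modl_def power_divide)
      hence "ln (modl q) = ln q + 4 * ln (jt2 q / jt3 q)"
        using q j by (simp add: ln_mult ln_realpow)
      hence "ln (sqrt (modl q)) = ln q / 2 + 2 * ln (jt2 q / jt3 q)" using m by (simp add: ln_sqrt)
      moreover have "1 + sqrt (1 - modl q) > 0" using m by (intro add_pos_nonneg) auto
      ultimately have e1: "ln ((1 + sqrt (1 - modl q)) / sqrt (modl q)) = c q - ln q / 2"
        using m by (simp add: c_def ln_div)
      have e2: "c q / (- ln q) + 1 / 2 = (c q - ln q / 2) / (- ln q)" using ln by (simp add: field_simps)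
      show ?case unfolding E_def e1 e2 by (simp only: divide_divide_eq_left mult.commute)
    qed
    ultimately show ?thesis by (simp add: filterlim_cong tendsto_cong)
  qed
  have K1: "((\<lambda>q. ellK (sqrt (1 - modl q)) / (- ln q)) \<longlongrightarrow> 1 / 2) (at_right 0)"
  proof (rule tendsto_sandwich[OF _ _ E])
    have B: "E q \<le> ellK (sqrt (1 - modl q)) \<and> ellK (sqrt (1 - modl q)) \<le> E q + pi / 2" if q: "0 < q" "q < 1" for q
    proof -
      note m = modl_bounds[OF q]
      have y: "0 < sqrt (modl q)" "sqrt (modl q) < 1" using m by auto
      have "sqrt (1 - (sqrt (modl q))\<^sup>2) = sqrt (1 - modl q)" using m by simp
      thus ?thesis using ellK_log_bounds[OF y] unfolding E_def by simp
    qed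
    show "eventually (\<lambda>q. E q / (- ln q) \<le> ellK (sqrt (1 - modl q)) / (- ln q)) (at_right 0)"
      using eventually_unit_interval
    proof eventually_elim
      case (elim q)
      thus ?case using B[of q] by (intro divide_right_mono) auto
    qed
    show "eventually (\<lambda>q. ellK (sqrt (1 - modl q)) / (- ln q) \<le> E q / (- ln q) + (pi / 2) / (- ln q)) (at_right 0)"
      using eventually_unit_interval
    proof eventually_elim
      case (elim q)
      have "ellK (sqrt (1 - modl q)) / (- ln q) \<le> (E q + pi / 2) / (- ln q)"
        using B[of q] elim by (intro divide_right_mono) auto
      thus ?case by (simp add: add_divide_distrib diff_divide_distrib)
    qed
    have "((\<lambda>q. E q / (- ln q) + (pi / 2) / (- ln q)) \<longlongrightarrow> 1 / 2 + 0) (at_right 0)"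
      by (intro tendsto_add E real_tendsto_divide_at_top[OF tendsto_const l])
    thus "((\<lambda>q. E q / (- ln q) + (pi / 2) / (- ln q)) \<longlongrightarrow> 1 / 2) (at_right 0)" by simp
  qed
  have "((\<lambda>q. (ellK (sqrt (1 - modl q)) / (- ln q)) / ellK (sqrt (modl q))) \<longlongrightarrow> (1 / 2) / (pi / 2)) (at_right 0)"
    by (intro tendsto_divide K1 K0) auto
  thus ?thesis by (simp add: ellK_ratio_def mult.commute)
qed

theorem ellK_ratio_eq:
  assumes q: "0 < q" "q < 1"
  shows "ellK_ratio q = - ln q / pi"
proof -
  define G where "G s = ellK_ratio s / (- ln s)" for s
  have "G q = 1 / pi"
  proof (rule squaring_invariant[OF _ _ q])
    show "(G \<longlongrightarrow> 1 / pi) (at_right 0)" unfolding G_def by (rule ellK_ratio_limit)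
    show "G (p\<^sup>2) = G p" if "0 < p" "p < 1" for p
      unfolding G_def using that by (simp add: ellK_ratio_square ln_realpow)
  qed
  moreover have "ln q < 0" using q by simp
  ultimately show ?thesis unfolding G_def by (simp add: field_simps)
qed

text \<open>\<open>K'\<close> decreases and \<open>K\<close> increases with the modulus; this is the
  uniqueness behind the definite description in \<open>sing_mod\<close>.\<close>

lemma ellK_quotient_strict_antimono:
  assumes k: "0 < k" "k < l" "l < 1"
  shows "ellK (sqrt (1 - l\<^sup>2)) / ellK l < ellK (sqrt (1 - k\<^sup>2)) / ellK k"
proof -
  have "k\<^sup>2 < l\<^sup>2" "l\<^sup>2 < 1" "0 < k\<^sup>2" using k by (auto simp: power_less_one_iff intro: power_strict_mono)
  hence a: "0 \<le> sqrt (1 - l\<^sup>2)" "sqrt (1 - l\<^sup>2) < sqrt (1 - k\<^sup>2)" "sqrt (1 - k\<^sup>2) < 1" by auto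
  have "ellK (sqrt (1 - l\<^sup>2)) < ellK (sqrt (1 - k\<^sup>2))" by (rule ellK_strict_mono[OF a])
  moreover have "ellK k < ellK l" using k by (intro ellK_strict_mono) auto
  moreover have "ellK (sqrt (1 - l\<^sup>2)) > 0" "ellK k > 0" using a k by (auto intro!: ellK_pos)
  ultimately show ?thesis by (intro frac_less) auto
qed

theorem sing_mod_eq:
  assumes r: "0 < r"
  shows "sing_mod r = sqrt (modl (exp (- pi * sqrt r)))"
proof -
  define q where "q = exp (- pi * sqrt r)"
  have q: "0 < q" "q < 1" using r by (auto simp: q_def)
  note m = modl_bounds[OF q]
  have e: "ellK (sqrt (1 - (sqrt (modl q))\<^sup>2)) / ellK (sqrt (modl q)) = sqrt r"
    using ellK_ratio_eq[OF q] m by (simp add: ellK_ratio_def q_def)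
  show ?thesis unfolding sing_mod_def q_def[symmetric]
  proof (rule the_equality)
    show "0 < sqrt (modl q) \<and> sqrt (modl q) < 1 \<and> ellK (sqrt (1 - (sqrt (modl q))\<^sup>2)) / ellK (sqrt (modl q)) = sqrt r"
      using e m by simp
    fix k assume k: "0 < k \<and> k < 1 \<and> ellK (sqrt (1 - k\<^sup>2)) / ellK k = sqrt r"
    show "k = sqrt (modl q)"
    proof (rule ccontr)
      assume "k \<noteq> sqrt (modl q)"
      then consider "k < sqrt (modl q)" | "sqrt (modl q) < k" by linarith
      thus False
        using ellK_quotient_strict_antimono[of k "sqrt (modl q)"] ellK_quotient_strict_antimono[of "sqrt (modl q)" k] k e m
        by cases auto
    qed
  qed
qed

section \<open>The hypergeometric side\<close>

definition hypc :: "nat \<Rightarrow> real" where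
  "hypc n = pochhammer (1/6) n * pochhammer (1/3) n / (pochhammer (7/6) n * fact n)"

definition bfun :: "real \<Rightarrow> real" where
  "bfun x = 3 * 2 powr (1/3) * (x powr (1/6) * (\<Sum>n. hypc n * x ^ n))"

text \<open>As 7/6 exceeds 1/6 by 1, the quotient of their Pochhammer symbols is
  \<open>(1/6) / (n + 1/6)\<close>. Multiplication by \<open>n + 1/6\<close> is the operator
  \<open>x d/dx + 1/6\<close>, which therefore leaves the binomial series of
  \<open>(1 - x)^(-1/3)\<close>.\<close>

lemma hypc_eq: "(real n + 1/6) * hypc n = (1/6) * (pochhammer (1/3) n / fact n)"
proof -
  have p: "pochhammer (7/6) n > (0::real)" by (intro pochhammer_pos) simp
  have "pochhammer (1/6) n * (1/6 + real n) = 1/6 * pochhammer (7/6) n"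
    using pochhammer_rec[of "1/6::real" n] pochhammer_rec'[of "1/6::real" n] by (simp add: mult.commute)
  hence e: "(real n + 1/6) * pochhammer (1/6) n = 1/6 * pochhammer (7/6) n" by (simp add: algebra_simps)
  have "(real n + 1/6) * hypc n = ((real n + 1/6) * pochhammer (1/6) n) * pochhammer (1/3) n / (pochhammer (7/6) n * fact n)"
    by (simp add: hypc_def)
  also have "\<dots> = (1/6) * (pochhammer (1/3) n / fact n)" unfolding e using p by simp
  finally show ?thesis .
qed

lemma binomial_third:
  assumes "\<bar>x\<bar> < (1::real)"
  shows "(\<lambda>n. pochhammer (1/3) n / fact n * x ^ n) sums ((1 - x) powr (-1/3))"
proof -
  have "(\<lambda>n. ((-1/3) gchoose n) * (-x) ^ n) sums (1 + (-x)) powr (-1/3)"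
    by (rule gen_binomial_real) (use assms in simp)
  moreover have "((-1/3) gchoose n) * (-x) ^ n = pochhammer (1/3) n / fact n * x ^ n" for n
  proof -
    have "(-1) ^ n * (-x) ^ n = x ^ n" by (simp flip: power_mult_distrib)
    hence "(-1) ^ n * P * (-x) ^ n = P * x ^ n" for P by (metis mult.assoc mult.commute)
    thus ?thesis unfolding gbinomial_pochhammer by simp
  qed
  ultimately show ?thesis by (simp only: add_uminus_conv_diff)
qed

lemma hypc_nonneg: "hypc n \<ge> 0"
  unfolding hypc_def by (intro divide_nonneg_nonneg mult_nonneg_nonneg pochhammer_nonneg) auto

lemma summable_hypc:
  assumes "\<bar>x\<bar> < 1"
  shows "summable (\<lambda>n. hypc n * x ^ n)"
proof (rule summable_comparison_test')
  have "summable (\<lambda>n. pochhammer (1/3) n / fact n * \<bar>x\<bar> ^ n)"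
    using binomial_third[of "\<bar>x\<bar>"] assms by (simp add: sums_iff)
  thus "summable (\<lambda>n. pochhammer (1/3) n / fact n * \<bar>x\<bar> ^ n)" .
  fix n
  have "1/6 * hypc n \<le> (real n + 1/6) * hypc n" by (intro mult_right_mono hypc_nonneg) auto
  hence "hypc n \<le> pochhammer (1/3) n / fact n" unfolding hypc_eq by simp
  thus "norm (hypc n * x ^ n) \<le> pochhammer (1/3) n / fact n * \<bar>x\<bar> ^ n"
    using hypc_nonneg[of n] mult_right_mono[of "hypc n" "pochhammer (1/3) n / fact n" "\<bar>x\<bar> ^ n"]
    by (simp add: abs_mult power_abs)
qed

text \<open>The relation is not solved for \<open>h'\<close> because the case \<open>x = 0\<close>
  is included; there the lemma supplies continuity for the limit of \<open>bfun\<close>.\<close>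

lemma hypc_DERIV:
  assumes x: "\<bar>x\<bar> < 1"
  obtains h' where "((\<lambda>x. \<Sum>n. hypc n * x ^ n) has_real_derivative h') (at x)"
    "x * h' + (1/6) * (\<Sum>n. hypc n * x ^ n) = (1/6) * (1 - x) powr (-1/3)"
proof -
  obtain r where r: "\<bar>x\<bar> < r" "r < 1" using dense[OF x] by blast
  have D: "((\<lambda>x. \<Sum>n. hypc n * x ^ n) has_real_derivative (\<Sum>n. diffs hypc n * x ^ n)) (at x)"
    by (rule termdiffs_strong[of hypc r]) (use r summable_hypc in auto)
  have sd: "summable (\<lambda>n. diffs hypc n * x ^ n)"
    by (rule termdiff_converges[of _ 1]) (use x summable_hypc in auto)
  have "(\<lambda>n. real n * hypc n * x ^ (n - Suc 0)) sums (\<Sum>n. diffs hypc n * x ^ n)"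
    using diffs_equiv[OF sd] by simp
  hence "(\<lambda>n. x * (real n * hypc n * x ^ (n - Suc 0))) sums (x * (\<Sum>n. diffs hypc n * x ^ n))"
    by (rule sums_mult)
  moreover have "x * (real n * hypc n * x ^ (n - Suc 0)) = real n * hypc n * x ^ n" for n
    by (cases n) auto
  ultimately have 1: "(\<lambda>n. real n * hypc n * x ^ n) sums (x * (\<Sum>n. diffs hypc n * x ^ n))" by simp
  have 2: "(\<lambda>n. (1/6) * (hypc n * x ^ n)) sums ((1/6) * (\<Sum>n. hypc n * x ^ n))"
    by (intro sums_mult summable_sums summable_hypc x)
  have "(\<lambda>n. (real n + 1/6) * hypc n * x ^ n) sums (x * (\<Sum>n. diffs hypc n * x ^ n) + (1/6) * (\<Sum>n. hypc n * x ^ n))"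
    using sums_add[OF 1 2] by (simp add: algebra_simps)
  hence "(\<lambda>n. (1/6) * (pochhammer (1/3) n / fact n * x ^ n)) sums (x * (\<Sum>n. diffs hypc n * x ^ n) + (1/6) * (\<Sum>n. hypc n * x ^ n))"
    unfolding hypc_eq mult.assoc .
  from sums_unique2[OF this sums_mult[OF binomial_third[OF x]]] that[OF D] show ?thesis by simp
qed

lemma bfun_DERIV:
  assumes x: "0 < x" "x < 1"
  shows "(bfun has_real_derivative 2 powr (-2/3) * x powr (-5/6) * (1 - x) powr (-1/3)) (at x)"
proof -
  have x1: "\<bar>x\<bar> < 1" using x by simp
  obtain h' where D: "((\<lambda>x. \<Sum>n. hypc n * x ^ n) has_real_derivative h') (at x)"
    and h: "x * h' + (1/6) * (\<Sum>n. hypc n * x ^ n) = (1/6) * (1 - x) powr (-1/3)" by (rule hypc_DERIV[OF x1])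
  have "((\<lambda>x. x powr (1/6)) has_real_derivative (1/6) * x powr (1/6 - 1)) (at x)"
    by (rule has_real_derivative_powr[OF x(1)])
  from DERIV_cmult[OF DERIV_mult[OF this D], of "3 * 2 powr (1/3)"]
  have "(bfun has_real_derivative 3 * 2 powr (1/3) * ((1/6) * x powr (1/6 - 1) * (\<Sum>n. hypc n * x ^ n) + h' * x powr (1/6))) (at x)"
    by (simp add: bfun_def[abs_def])
  also have "x powr (1/6) = x * x powr (-5/6)"
    using x powr_add[of x 1 "-5/6"] by simp
  also have "(1/6 - 1 :: real) = -5/6" by simp
  also have "3 * 2 powr (1/3) * ((1/6) * x powr (-5/6) * (\<Sum>n. hypc n * x ^ n) + h' * (x * x powr (-5/6)))
     = 3 * 2 powr (1/3) * x powr (-5/6) * (x * h' + (1/6) * (\<Sum>n. hypc n * x ^ n))" by (simp add: algebra_simps)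
  also have "\<dots> = (2 powr (1/3) / 2) * x powr (-5/6) * (1 - x) powr (-1/3)" unfolding h by simp
  also have "2 powr (1/3) / 2 = (2 powr (-2/3) :: real)"
    using powr_diff[of "2::real" "1/3" 1] by simp
  finally show ?thesis .
qed

lemma bfun_at_right: "(bfun \<longlongrightarrow> 0) (at_right 0)"
proof -
  obtain h' where "((\<lambda>x. \<Sum>n. hypc n * x ^ n) has_real_derivative h') (at 0)" by (rule hypc_DERIV[of 0]) auto
  hence "isCont (\<lambda>x. \<Sum>n. hypc n * x ^ n) 0" by (rule DERIV_isCont)
  hence 1: "((\<lambda>x. \<Sum>n. hypc n * x ^ n) \<longlongrightarrow> (\<Sum>n. hypc n * 0 ^ n)) (at_right 0)"
    unfolding isCont_def by (auto intro: tendsto_mono[OF at_le])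
  have 2: "((\<lambda>x::real. x powr (1/6)) \<longlongrightarrow> 0 powr (1/6)) (at_right 0)"
    by (rule tendsto_powr'[OF tendsto_ident_at tendsto_const]) (auto simp: eventually_at_filter)
  have "(bfun \<longlongrightarrow> 3 * 2 powr (1/3) * (0 powr (1/6) * (\<Sum>n. hypc n * 0 ^ n))) (at_right 0)"
    unfolding bfun_def[abs_def] by (intro tendsto_intros 1 2)
  thus ?thesis by simp
qed

lemma bmod_eq:
  assumes r: "0 < r"
  shows "bmod r = bfun (modl (exp (- pi * sqrt r)))"
proof -
  define q where "q = exp (- pi * sqrt r)"
  have q: "0 < q" "q < 1" using r by (auto simp: q_def)
  note m = modl_bounds[OF q]
  have "(sqrt (modl q)) powr (1/3) = (modl q) powr (1/6)"
    using m by (simp add: powr_half_sqrt[symmetric] powr_powr)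
  thus ?thesis unfolding bmod_def sing_mod_eq[OF r] q_def[symmetric] using m
    by (simp add: bfun_def hyp2f1_def hypc_def powr_mult mult_ac)
qed

definition bq :: "real \<Rightarrow> real" where "bq q = bfun (modl q)"

lemma bq_DERIV:
  assumes q: "0 < q" "q < 1"
  shows "(bq has_real_derivative q powr (1/6) * qpoch q q ^ 4 / q) (at q)"
proof -
  note m = modl_bounds[OF q] and j = jt_pos[OF q]
  have q2: "0 < q\<^sup>2" "q\<^sup>2 < 1" using q by (auto simp: power_less_one_iff)
  have e: "0 < qpoch q q" "0 < qpoch (q\<^sup>2) (q\<^sup>2)" by (rule euler_pos[OF q], rule euler_pos[OF q2])
  define x where "x = modl q"
  define Z where "Z = 2 powr (-2/3) * x powr (1/6) * (1 - x) powr (-1/3) * jt4 q ^ 4"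
  have x: "0 < x" "x < 1" using m by (auto simp: x_def)
  have "(modl has_real_derivative x * jt4 q ^ 4 / q) (at q)"
    using modl_DERIV_P[OF q] modl_P_eq[OF q] by (simp add: x_def)
  from DERIV_chain2[where f = bfun and g = modl, OF bfun_DERIV this] x
  have "(bq has_real_derivative (2 powr (-2/3) * x powr (-5/6) * (1 - x) powr (-1/3)) * (x * jt4 q ^ 4 / q)) (at q)"
    by (simp add: bq_def[abs_def] x_def)
  also have "(2 powr (-2/3) * x powr (-5/6) * (1 - x) powr (-1/3)) * (x * jt4 q ^ 4 / q) = Z / q"
  proof -
    have "x powr (1/6) = x * x powr (-5/6)" using x powr_add[of x 1 "-5/6"] by simp
    thus ?thesis by (simp add: Z_def mult_ac)
  qed
  \<comment> \<open>Comparing sixth powers of nonnegative numbers clears all fractional exponents;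
    what remains is a monomial identity in the theta constants, settled by \<open>t\<close> and
    \<open>f\<close>.\<close>
  also have "Z = q powr (1/6) * qpoch q q ^ 4"
  proof (rule power_eq_imp_eq_base[of _ 6])
    have p: "(a powr b) ^ 6 = a powr (6 * b)" if "a > 0" for a b :: real
      using that by (simp add: powr_power mult.commute)
    define F where "F = qpoch (q\<^sup>2) (q\<^sup>2)"
    have t: "jt2 q * jt3 q * jt4 q = 2 * F ^ 3" unfolding F_def by (rule jt_product[OF q])
    have f: "jt4 q * F = (qpoch q q)\<^sup>2" unfolding F_def using q by (intro jt4_euler) auto
    have "Z ^ 6 = 2 powr (-4) * x * (1 - x) powr (-2) * (jt4 q ^ 4) ^ 6"
      unfolding Z_def power_mult_distrib using x by (simp add: p)
    also have "(1 - x) powr (-2) = (jt3 q / jt4 q) ^ 8"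
    proof -
      have "(1 - x) powr (-2) = inverse ((1 - x) ^ 2)"
        using x by (simp add: powr_minus powr_numeral)
      also have "\<dots> = (jt3 q / jt4 q) ^ 8"
        unfolding x_def one_minus_modl[OF q] using j by (simp add: power_inverse[symmetric] flip: power_mult)
      finally show ?thesis .
    qed
    also have "2 powr (-4) = (1/16 :: real)" by (simp add: powr_minus powr_numeral)
    also have "1/16 * x * (jt3 q / jt4 q) ^ 8 * (jt4 q ^ 4) ^ 6 = (q * jt2 q ^ 4 * jt3 q ^ 8 * (jt4 q ^ 4) ^ 6 / 16) / (jt3 q ^ 4 * jt4 q ^ 8)"
      by (simp add: x_def modl_def power_divide)
    also have "\<dots> = q * (jt2 q * jt3 q * jt4 q) ^ 4 * jt4 q ^ 12 / 16"
    proof (subst nonzero_divide_eq_eq)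
      show "jt3 q ^ 4 * jt4 q ^ 8 \<noteq> 0" using j by simp
      show "q * jt2 q ^ 4 * jt3 q ^ 8 * (jt4 q ^ 4) ^ 6 / 16 = q * (jt2 q * jt3 q * jt4 q) ^ 4 * jt4 q ^ 12 / 16 * (jt3 q ^ 4 * jt4 q ^ 8)"
        by algebra
    qed
    also have "\<dots> = q * (jt4 q * F) ^ 12"
    proof -
      have "(2 * F ^ 3) ^ 4 = 16 * F ^ 12" by algebra
      thus ?thesis unfolding t power_mult_distrib[of "jt4 q" F] by simp
    qed
    also have "\<dots> = (q powr (1/6) * qpoch q q ^ 4) ^ 6"
    proof -
      have "(q powr (1/6)) ^ 6 = q" using p[OF q(1), of "1/6"] q by simp
      moreover have "((qpoch q q)\<^sup>2) ^ 12 = (qpoch q q ^ 4) ^ 6" by (simp flip: power_mult)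
      ultimately show ?thesis unfolding f power_mult_distrib[of "q powr (1/6)"] by (simp only:)
    qed
    finally show "Z ^ 6 = (q powr (1/6) * qpoch q q ^ 4) ^ 6" .
    show "0 \<le> Z" using x j by (simp add: Z_def)
  qed (use e q in auto)
  finally show ?thesis .
qed

lemma bq_pos_DERIV:
  fixes q :: real
  assumes q: "0 < q" "q < 1" shows "q powr (1/6) * qpoch q q ^ 4 / q > 0"
  using euler_pos[OF q] q by (intro divide_pos_pos mult_pos_pos zero_less_power) auto

lemma bq_strict_mono:
  assumes "0 < p" "p < q" "q < 1" shows "bq p < bq q"
proof (rule DERIV_pos_imp_increasing[OF assms(2)])
  fix x assume "p \<le> x" "x \<le> q"
  hence x: "0 < x" "x < 1" using assms by auto
  show "\<exists>y. (bq has_real_derivative y) (at x) \<and> 0 < y"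
    using bq_DERIV[OF x] bq_pos_DERIV[OF x] by blast
qed

lemma bq_at_right: "(bq \<longlongrightarrow> 0) (at_right 0)"
  unfolding bq_def[abs_def]
proof (rule filterlim_compose[OF bfun_at_right])
  have "eventually (\<lambda>q. modl q \<in> {0<..} \<and> modl q \<noteq> 0) (at_right 0)"
    using eventually_unit_interval by eventually_elim (use modl_bounds in fastforce)
  thus "filterlim modl (at_right 0) (at_right 0)"
    unfolding filterlim_at using modl_at_right by auto
qed

lemma bq_pos: assumes "0 < q" "q < 1" shows "bq q > 0"
proof -
  \<comment> \<open>The limit at 0 yields only a weak inequality; the passage from
    \<open>q/2\<close> to \<open>q\<close> makes it strict.\<close>
  have "bq (q/2) \<ge> 0"
  proof (rule tendsto_upperbound[OF bq_at_right])
    show "eventually (\<lambda>p. bq p \<le> bq (q/2)) (at_right 0)"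
      unfolding eventually_at_right_field
      by (rule exI[of _ "q/2"]) (use assms bq_strict_mono in \<open>auto intro: less_imp_le\<close>)
  qed auto
  moreover have "bq (q/2) < bq q" using assms by (intro bq_strict_mono) auto
  ultimately show ?thesis by simp
qed

section \<open>The inverse of \<open>RR\<close> and the integral that defines
  \<open>F1\<close>\<close>

definition RRinv :: "real \<Rightarrow> real" where "RRinv t = (THE p. 0 < p \<and> p < 1 \<and> RR p = t)"

lemma RRinv_RR: "0 < p \<Longrightarrow> p < 1 \<Longrightarrow> RRinv (RR p) = p"
  unfolding RRinv_def by (rule the_equality) (auto simp: RR_eq_iff)

lemma RR_surj:
  assumes t: "0 < t" "t < RR q" and q: "0 < q" "q < 1"
  obtains p where "0 < p" "p < q" "RR p = t"
proof -
  \<comment> \<open>The fifth power matches the bound \<open>e powr (1/5)\<close> for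
    \<open>RR e\<close>; the halves keep \<open>e\<close> below \<open>q\<close> and
    \<open>RR e\<close> below \<open>t\<close>.\<close>
  define e where "e = min (q/2) ((t/2) ^ 5)"
  have e: "0 < e" "e < q" "e < 1" using t q by (auto simp: e_def)
  have "RR e \<le> e powr (1/5)" by (rule RR_le[OF e(1,3)])
  also have "\<dots> \<le> ((t/2) ^ 5) powr (1/5)" using e by (intro powr_mono2) (auto simp: e_def)
  also have "\<dots> = t/2"
  proof -
    have "(t/2) ^ 5 = (t/2) powr 5" using powr_realpow[of "t/2" 5] t by simp
    moreover have "((t/2) powr 5) powr (1/5) = (t/2) powr 1" by (simp only: powr_powr) simp
    ultimately show ?thesis using t by simp
  qed
  finally have le: "RR e \<le> t" using t by simp
  have "\<exists>p. e \<le> p \<and> p \<le> q \<and> RR p = t"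
    by (rule IVT) (use le t e q in \<open>auto intro!: DERIV_isCont RR_DERIV\<close>)
  then obtain p where p: "e \<le> p" "p \<le> q" "RR p = t" by blast
  have "p \<noteq> q" using p t by auto
  thus ?thesis using that[of p] p e by auto
qed

lemma RRinv_DERIV:
  assumes p: "0 < p" "p < 1"
  shows "(RRinv has_real_derivative inverse (RR p * qpoch p p ^ 6 / (5 * p * (thA p * thB p)))) (at (RR p))"
proof -
  define d where "d = min (p/2) ((1-p)/2)"
  have d: "d > 0" "\<And>z. \<bar>z - p\<bar> \<le> d \<Longrightarrow> 0 < z \<and> z < 1" using p by (auto simp: d_def abs_le_iff min_def split: if_splits)
  have c: "isCont RRinv (RR p)"
    by (rule isCont_inverse_function[OF d(1)]) (use d(2) in \<open>auto intro!: RRinv_RR DERIV_isCont RR_DERIV\<close>)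
  define b where "b = (1 + p) / 2"
  have b: "p < b" "0 < b" "b < 1" using p by (auto simp: b_def)
  show ?thesis
  proof (rule DERIV_inverse_function[where f = RR and a = 0 and b = "RR b"])
    show "(RR has_real_derivative RR p * qpoch p p ^ 6 / (5 * p * (thA p * thB p))) (at (RRinv (RR p)))"
      using RR_DERIV[OF p] RRinv_RR[OF p] by simp
    show "RR p * qpoch p p ^ 6 / (5 * p * (thA p * thB p)) \<noteq> 0"
      using RR_pos[OF p] euler_pos[OF p] thA_pos[OF p] p by simp
    show "0 < RR p" by (rule RR_pos[OF p])
    show "RR p < RR b" by (rule RR_strict_mono[OF p(1) b(1,3)])
    fix y assume "0 < y" "y < RR b"
    then obtain z where "0 < z" "z < b" "RR z = y" using RR_surj b by blast
    thus "RR (RRinv y) = y" using RRinv_RR[of z] b by auto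
  qed (rule c)
qed

abbreviation F1_integrand :: "real \<Rightarrow> real" where
  "F1_integrand \<equiv> \<lambda>t. 1 / (t * (1 / t ^ 5 - 11 - t ^ 5) powr (1/6))"

text \<open>A primitive of the integrand, extended by 0 to the endpoint, where the integrand has an
  integrable singularity of the order \<open>t^(-1/6)\<close>.\<close>

definition F1_anti :: "real \<Rightarrow> real" where
  "F1_anti t = (if t \<le> 0 then 0 else bq (RRinv t) / 5)"

lemma F1_anti_DERIV:
  assumes p: "0 < p" "p < 1"
  shows "(F1_anti has_real_derivative F1_integrand (RR p)) (at (RR p))"
proof -
  note pos = RR_pos[OF p] euler_pos[OF p] thA_pos[OF p]
  have R: "RRinv (RR p) = p" by (rule RRinv_RR[OF p])
  have "((\<lambda>t. bq (RRinv t)) has_real_derivative (p powr (1/6) * qpoch p p ^ 4 / p) * inverse (RR p * qpoch p p ^ 6 / (5 * p * (thA p * thB p)))) (at (RR p))"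
    by (rule DERIV_chain2[where f = bq and g = RRinv, OF _ RRinv_DERIV[OF p]]) (use bq_DERIV[OF p] R in simp)
  from DERIV_cdivide[OF this, of 5]
  have "((\<lambda>t. bq (RRinv t) / 5) has_real_derivative (p powr (1/6) * qpoch p p ^ 4 / p) * inverse (RR p * qpoch p p ^ 6 / (5 * p * (thA p * thB p))) / 5) (at (RR p))" .
  also have "(p powr (1/6) * qpoch p p ^ 4 / p) * inverse (RR p * qpoch p p ^ 6 / (5 * p * (thA p * thB p))) / 5 = F1_integrand (RR p)"
  proof -
    have "qpoch p p ^ 6 = qpoch p p ^ 4 * (qpoch p p)\<^sup>2" by (simp flip: power_add)
    thus ?thesis unfolding RR_icosahedral_root[OF p] using pos p by (simp add: field_simps)
  qed
  finally show ?thesis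
    by (rule has_field_derivative_transform_within_open[where S = "{0<..}"]) (use pos in \<open>auto simp: F1_anti_def\<close>)
qed

lemma F1_anti_at_0: "(F1_anti \<longlongrightarrow> 0) (at_right 0)"
proof -
  have "((\<lambda>t. bq (RRinv t) / 5) \<longlongrightarrow> 0 / 5) (at_right 0)"
  proof (intro tendsto_divide filterlim_compose[OF bq_at_right])
    have h: "RRinv t < e \<and> 0 < RRinv t" if A: "0 < e" "e < 1" "0 < t" "t < RR e" for e t
    proof -
      obtain p where "0 < p" "p < e" "RR p = t" using RR_surj[OF A(3,4,1,2)] .
      thus ?thesis using RRinv_RR[of p] A by auto
    qed
    have "(RRinv \<longlongrightarrow> 0) (at_right 0)"
    proof (rule tendstoI)
      fix e :: real assume "e > 0"
      define e' where "e' = min e (1/2)"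
      have e': "0 < e'" "e' < 1" "e' \<le> e" using \<open>e > 0\<close> by (auto simp: e'_def)
      show "eventually (\<lambda>t. dist (RRinv t) 0 < e) (at_right 0)"
        unfolding eventually_at_right_field
        by (rule exI[of _ "RR e'"]) (use h[OF e'(1,2)] e' RR_pos[OF e'(1,2)] in \<open>fastforce simp: dist_real_def\<close>)
    qed
    moreover have "eventually (\<lambda>t. RRinv t \<in> {0<..} \<and> RRinv t \<noteq> 0) (at_right 0)"
      unfolding eventually_at_right_field
      by (rule exI[of _ "RR (1/2)"]) (use h[of "1/2"] RR_pos[of "1/2"] in fastforce)
    ultimately show "filterlim RRinv (at_right 0) (at_right 0)"
      unfolding filterlim_at by auto
  qed auto
  moreover have "eventually (\<lambda>t. bq (RRinv t) / 5 = F1_anti t) (at_right 0)"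
    by (auto simp: eventually_at_filter F1_anti_def)
  ultimately show ?thesis by (simp add: tendsto_cong)
qed

text \<open>The integrand is unbounded at 0, so the fundamental theorem is applied in the form that
  asks for continuity on the closed interval and for a derivative only inside.\<close>

lemma F1_integral:
  assumes q: "0 < q" "q < 1"
  shows "(F1_integrand has_integral (bq q / 5)) {0..RR q}"
proof -
  have R: "RR q > 0" by (rule RR_pos[OF q])
  have D: "(F1_anti has_real_derivative F1_integrand t) (at t)" if t: "0 < t" "t \<le> RR q" for t
  proof (cases "t = RR q")
    case True thus ?thesis using F1_anti_DERIV[OF q] by simp
  next
    case False
    hence "t < RR q" using t by simp
    then obtain p where "0 < p" "p < q" "RR p = t" using RR_surj[OF t(1) _ q] by blast
    thus ?thesis using F1_anti_DERIV[of p] q by auto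
  qed
  have "(F1_integrand has_integral (F1_anti (RR q) - F1_anti 0)) {0..RR q}"
  proof (rule fundamental_theorem_of_calculus_interior)
    show "continuous_on {0..RR q} F1_anti"
      unfolding continuous_on_eq_continuous_within
    proof
      fix t assume t: "t \<in> {0..RR q}"
      show "continuous (at t within {0..RR q}) F1_anti"
      proof (cases "t = 0")
        case True
        have "(F1_anti \<longlongrightarrow> F1_anti 0) (at_right 0)" using F1_anti_at_0 by (simp add: F1_anti_def)
        hence "(F1_anti \<longlongrightarrow> F1_anti 0) (at 0 within {0..RR q})"
          using R by (simp add: at_within_Icc_at_right)
        thus ?thesis unfolding True by (simp add: continuous_within)
      next
        case False
        thus ?thesis using D[of t] t by (auto intro: DERIV_isCont continuous_at_imp_continuous_at_within)
      qed
    qed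
    fix t assume "t \<in> {0<..<RR q}"
    thus "(F1_anti has_vector_derivative F1_integrand t) (at t)"
      using D[of t] by (simp add: has_real_derivative_iff_has_vector_derivative)
  qed (use R in simp)
  thus ?thesis using R RRinv_RR[OF q] by (simp add: F1_anti_def)
qed

theorem F1_bq:
  assumes q: "0 < q" "q < 1"
  shows "F1 (bq q) = RR q"
  unfolding F1_def
proof (rule the_equality)
  have "integral {0..RR q} F1_integrand = bq q / 5" using F1_integral[OF q] by (rule integral_unique)
  thus "0 < RR q \<and> 1 / RR q ^ 5 - 11 - RR q ^ 5 > 0 \<and> bq q = 5 * integral {0..RR q} F1_integrand"
    using RR_pos[OF q] RR_domain_pos[OF q] by simp
  fix y assume y: "0 < y \<and> 1 / y ^ 5 - 11 - y ^ 5 > 0 \<and> bq q = 5 * integral {0..y} F1_integrand"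
  have R: "RR q > 0" by (rule RR_pos[OF q])
  show "y = RR q"
  proof (rule ccontr)
    assume "y \<noteq> RR q"
    then consider "y < RR q" | "RR q < y" by linarith
    thus False
    proof cases
      case 1
      \<comment> \<open>Below \<open>RR q\<close> every candidate is itself a value of
        \<open>RR\<close>, so strict monotonicity of \<open>bq\<close> decides.\<close>
      then obtain p where p: "0 < p" "p < q" "RR p = y" using RR_surj[OF _ _ q] y by blast
      have "bq p = 5 * integral {0..y} F1_integrand"
        using integral_unique[OF F1_integral[of p]] p q by simp
      thus False using bq_strict_mono[OF p(1,2) q(2)] y by simp
    next
      case 2
      \<comment> \<open>The integral of a non-integrable function is 0 by convention, whereas \<open>bq q > 0\<close>.\<close>
      have i: "F1_integrand integrable_on {0..y}"
        using y bq_pos[OF q] not_integrable_integral[of F1_integrand "{0..y}"] by fastforce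
      \<comment> \<open>A larger candidate is not known to be a value of \<open>RR\<close>, so
        positivity of the integrand replaces monotonicity of \<open>bq\<close>: the radicand
        decreases in \<open>t\<close> and is positive at \<open>y\<close>, hence on the whole way to
        \<open>y\<close>.\<close>
      have dom: "1 / t ^ 5 - 11 - t ^ 5 > 0" if "RR q \<le> t" "t \<le> y" for t
      proof -
        have le: "t ^ 5 \<le> y ^ 5" and pos: "t ^ 5 > 0" using that R by (auto intro: power_mono)
        moreover have "1 / y ^ 5 \<le> 1 / t ^ 5" by (rule divide_left_mono[OF le]) (use pos y in auto)
        ultimately show ?thesis using y by linarith
      qed
      have "integral {RR q..y} (\<lambda>t. 0) < integral {RR q..y} F1_integrand"
      proof (rule integral_less_real)
        show "continuous_on {RR q..y} F1_integrand"
          using R by (intro continuous_intros) (force dest: dom)+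
        fix t assume "t \<in> {RR q<..<y}"
        thus "0 < F1_integrand t" using dom[of t] R by auto
      qed (use 2 in auto)
      moreover have "integral {0..RR q} F1_integrand + integral {RR q..y} F1_integrand = integral {0..y} F1_integrand"
        using R 2 i by (intro Henstock_Kurzweil_Integration.integral_combine) auto
      ultimately show False using integral_unique[OF F1_integral[OF q]] y by simp
    qed
  qed
qed

corollary F1_bmod: "0 < r \<Longrightarrow> F1 (bmod r) = RR (exp (- pi * sqrt r))"
  using F1_bq[of "exp (- pi * sqrt r)"] by (simp add: bmod_eq bq_def)

section \<open>Inverting the maps of the functional equation\<close>

lemma Omega_RR:
  assumes r: "0 < r" and s: "0 < s"
  shows "Omega s (RR (exp (- pi * sqrt r))) = RR (exp (- pi * s * sqrt r))"
proof -
  have "(THE r'. 0 < r' \<and> RR (exp (- pi * sqrt r')) = RR (exp (- pi * sqrt r))) = r"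
  proof (rule the_equality)
    fix r' assume "0 < r' \<and> RR (exp (- pi * sqrt r')) = RR (exp (- pi * sqrt r))"
    thus "r' = r" using RR_eq_iff[of "exp (- pi * sqrt r')" "exp (- pi * sqrt r)"] r by simp
  qed (use r in simp)
  thus ?thesis by (simp add: Omega_def)
qed

lemma H_eq:
  assumes "0 < n" "0 < x"
  shows "H n x = RR (exp (- pi * (sqrt x / n)))"
  using Omega_RR[of x "1 / n"] assms by (simp add: H_def F1_bmod)

text \<open>\<open>H n\<close> divides \<open>sqrt x\<close> by \<open>n\<close>, so its inverse
  multiplies by \<open>n\<^sup>2\<close>; uniqueness is the injectivity of
  \<open>RR\<close>.\<close>

lemma Hinv_eq:
  assumes n: "0 < n" and m: "0 < m"
  shows "Hinv n (RR (exp (- pi * sqrt m))) = n\<^sup>2 * m"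
  unfolding Hinv_def
proof (rule the_equality)
  have "sqrt (n\<^sup>2 * m) / n = sqrt m" using n by (simp add: real_sqrt_mult)
  thus "0 < n\<^sup>2 * m \<and> H n (n\<^sup>2 * m) = RR (exp (- pi * sqrt m))" using n m by (simp add: H_eq)
  fix x assume x: "0 < x \<and> H n x = RR (exp (- pi * sqrt m))"
  hence "RR (exp (- pi * (sqrt x / n))) = RR (exp (- pi * sqrt m))" using H_eq[OF n] by metis
  moreover have "exp (- pi * (sqrt x / n)) < 1" "exp (- pi * sqrt m) < 1" using x n m by simp_all
  ultimately have "exp (- pi * (sqrt x / n)) = exp (- pi * sqrt m)" using RR_eq_iff by (metis exp_gt_zero)
  hence "pi * (sqrt x / n) = pi * sqrt m" by simp
  hence "sqrt x / n = sqrt m" by (metis mult_left_cancel pi_neq_zero)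
  hence "sqrt x = n * sqrt m" using n by (simp add: field_simps)
  hence "(sqrt x)\<^sup>2 = n\<^sup>2 * (sqrt m)\<^sup>2" by (simp add: power_mult_distrib)
  thus "x = n\<^sup>2 * m" using x m by simp
qed

lemma mG_works:
  assumes "x \<in> mG_dom G" shows "0 < mG G x" "mG_eq G x (mG G x)"
proof -
  have "\<exists>!m. 0 < m \<and> mG_eq G x m" using assms by (simp add: mG_dom_def)
  from theI'[OF this] show "0 < mG G x" "mG_eq G x (mG G x)" by (auto simp: mG_def)
qed

text \<open>\<open>x\<close> can be recovered from \<open>m\<close>: the integral from
  \<open>sqrt m\<close> has only one value, and that value is \<open>x / pi\<close>.\<close>

lemma mGinv_mG:
  assumes x: "x \<in> mG_dom G"
  shows "mGinv G (mG G x) = x"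
  unfolding mGinv_def
proof (rule the_equality)
  fix x' assume x': "x' \<in> mG_dom G \<and> mG G x' = mG G x"
  have "mG_eq G x (mG G x)" "mG_eq G x' (mG G x)" using mG_works[OF x] mG_works[of x' G] x' by auto
  hence "complex_of_real (x / pi) = complex_of_real (x' / pi)"
    unfolding mG_eq_def by (rule has_integral_unique)
  hence "x / pi = x' / pi" by (simp only: of_real_eq_iff)
  thus "x' = x" by simp
qed (use x in simp)

text \<open>\<open>Hinv\<close> after division by \<open>n\<^sup>2\<close> recovers
  \<open>mG G x\<close> from the value of the continued fraction, \<open>Q\<close> moves it to
  \<open>mG G (n\<^sup>2 * x)\<close>, and the outer factor \<open>n\<^sup>2\<close> compensates the
  division by \<open>n\<close> inside \<open>H\<close>.\<close>

theorem theorem7: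
  fixes G :: "real \<Rightarrow> real" and n x :: real
  assumes "smooth G"
    and "0 < n"
    and "x \<in> mG_dom G"
    and "n\<^sup>2 * x \<in> mG_dom G"
  shows "ycf G (n\<^sup>2 * x) = H n (n\<^sup>2 * Q G (n\<^sup>2) (Hinv n (ycf G x) / n\<^sup>2))"
proof -
  have m: "0 < mG G x" "0 < mG G (n\<^sup>2 * x)" using mG_works assms by auto
  have "Hinv n (ycf G x) / n\<^sup>2 = mG G x"
    using Hinv_eq[OF assms(2) m(1)] assms(2) by (simp add: ycf_def)
  hence "Q G (n\<^sup>2) (Hinv n (ycf G x) / n\<^sup>2) = mG G (n\<^sup>2 * x)"
    by (simp add: Q_def mGinv_mG[OF assms(3)])
  moreover have "sqrt (n\<^sup>2 * mG G (n\<^sup>2 * x)) / n = sqrt (mG G (n\<^sup>2 * x))"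
    using assms(2) by (simp add: real_sqrt_mult)
  ultimately show ?thesis using H_eq[OF assms(2), of "n\<^sup>2 * mG G (n\<^sup>2 * x)"] m assms(2) by (simp add: ycf_def)
qed

end
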